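(* (The Generalized Schoen-Yau Identity.) Let $M$ be a smooth 3-manifold with Riemannian metric $g$ and symmetric 2-tensor $k$, let $f,\phi$ be smooth real-valued functions on $M$ with $\phi>0$, and let $\bar g = g+\phi^2\,df\otimes df$. With $v$, $h$, $\mu$, $J$ as defined in the context, and with the 1-form $q = h(v,\cdot)-k(v,\cdot)$, the scalar curvature $\bar R$ of $\bar g$ satisfies $$\bar R = 16\pi(\mu - J(v)) + \|h-k\|_{\bar g}^2 + 2|q|_{\bar g}^2 - \frac{2}{\phi}\,\overline{\mathrm{div}}(\phi q) + (\mathrm{tr}_{\bar g}h)^2 - (\mathrm{tr}_{\bar g}k)^2 + 2\,v(\mathrm{tr}_{\bar g}h-\mathrm{tr}_{\bar g}k) + 2\,k(v,v)(\mathrm{tr}_{\bar g}h-\mathrm{tr}_{\bar g}k).$$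
   Context: Here $v$ is the vector field $v=\phi\nabla f/(1+\phi^2|df|_g^2)^{1/2}$, where $\nabla f$ is the gradient of $f$ with respect to $g$; the symmetric 2-tensor $h$ is $$h=\frac{\phi\,\mathrm{Hess} f+df\otimes d\phi+d\phi\otimes df}{(1+\phi^2|df|_g^2)^{1/2}},$$ with $\mathrm{Hess}f$ the Hessian of $f$ with respect to $g$. The energy density $\mu$ (a function) and momentum density $J$ (a 1-form) are defined from $(g,k)$ by $$8\pi\mu=\tfrac12\left(R+(\mathrm{tr}_g k)^2-\|k\|_g^2\right),\qquad 8\pi J=\mathrm{div}_g\left(k-(\mathrm{tr}_g k)g\right),$$ where $R$ is the scalar curvature of $g$. $\overline{\mathrm{div}}$ is the divergence of 1-forms with respect to the Levi-Civita connection of $\bar g$; norms and traces with subscript $\bar g$ are taken with respect to $\bar g$; $v(\cdot)$ denotes the derivative of a function in the direction $v$. *)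

theory Defs
  imports "HOL-Analysis.Analysis"
begin

section \<open>Smooth functions on open subsets of Euclidean space\<close>

definition pd :: "'n::finite \<Rightarrow> (real^'n \<Rightarrow> 'b::real_normed_vector) \<Rightarrow> real^'n \<Rightarrow> 'b" where
  "pd i F x = frechet_derivative F (at x) (axis i 1)"

primrec Ck_on :: "nat \<Rightarrow> (real^'n::finite) set \<Rightarrow> (real^'n \<Rightarrow> 'b::real_normed_vector) \<Rightarrow> bool" where
  "Ck_on 0 S F \<longleftrightarrow> continuous_on S F"
| "Ck_on (Suc m) S F \<longleftrightarrow> F differentiable_on S \<and> (\<forall>i. Ck_on m S (pd i F))"

text \<open>Only used for open sets.\<close>

definition smooth_on :: "(real^'n::finite) set \<Rightarrow> (real^'n \<Rightarrow> 'b::real_normed_vector) \<Rightarrow> bool" where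
  "smooth_on S F \<longleftrightarrow> (\<forall>m. Ck_on m S F)"


section \<open>Smooth manifolds\<close>

text \<open>A chart is a pair of its domain and its coordinate map; the values of the coordinate map
  outside the domain are irrelevant. The dimension is the cardinality of the index type.\<close>

type_synonym ('a, 'n) chart = "'a set \<times> ('a \<Rightarrow> (real, 'n) vec)"

definition chart_inv :: "('a, 'n::finite) chart \<Rightarrow> real^'n \<Rightarrow> 'a" where
  "chart_inv c = inv_into (fst c) (snd c)"

definition is_chart :: "'a topology \<Rightarrow> ('a, 'n::finite) chart \<Rightarrow> bool" where
  "is_chart M c \<longleftrightarrow> openin M (fst c) \<and> open (snd c ` fst c) \<and>
     homeomorphic_map (subtopology M (fst c)) (top_of_set (snd c ` fst c)) (snd c)"

definition smooth_manifold :: "'a topology \<Rightarrow> ('a, 'n::finite) chart set \<Rightarrow> bool" where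
  "smooth_manifold M A \<longleftrightarrow>
     Hausdorff_space M \<and> second_countable M \<and>
     (\<forall>c\<in>A. is_chart M c) \<and> (\<Union>c\<in>A. fst c) = topspace M \<and>
     (\<forall>c\<in>A. \<forall>d\<in>A. smooth_on (snd c ` (fst c \<inter> fst d)) (snd d \<circ> chart_inv c))"

definition coord_fun :: "('a, 'n::finite) chart \<Rightarrow> ('a \<Rightarrow> real) \<Rightarrow> real^'n \<Rightarrow> real" where
  "coord_fun c u = u \<circ> chart_inv c"

definition smooth_fun_on ::
    "('a, 'n::finite) chart set \<Rightarrow> 'a set \<Rightarrow> ('a \<Rightarrow> real) \<Rightarrow> bool" where
  "smooth_fun_on A V u \<longleftrightarrow> (\<forall>c\<in>A. smooth_on (snd c ` (fst c \<inter> V)) (coord_fun c u))"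

definition smooth_near ::
    "'a topology \<Rightarrow> ('a, 'n::finite) chart set \<Rightarrow> 'a \<Rightarrow> ('a \<Rightarrow> real) \<Rightarrow> bool" where
  "smooth_near M A p u \<longleftrightarrow> (\<exists>V. openin M V \<and> p \<in> V \<and> smooth_fun_on A V u)"


section \<open>Tangent vectors and covariant 2-tensor fields\<close>

text \<open>Tangent vectors at a point are derivations on the functions that are smooth near the point.
  The Leibniz rule makes them depend on germs only. Since HOL functions are total, derivations
  are normalised to vanish on all other functions, so that they are determined by their values
  on smooth germs.\<close>

type_synonym 'a tvec = "('a \<Rightarrow> real) \<Rightarrow> real"

definition tangent_space ::
    "'a topology \<Rightarrow> ('a, 'n::finite) chart set \<Rightarrow> 'a \<Rightarrow> 'a tvec set" where
  "tangent_space M A p = {X.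
     (\<forall>u. \<not> smooth_near M A p u \<longrightarrow> X u = 0) \<and>
     (\<forall>u w. smooth_near M A p u \<longrightarrow> smooth_near M A p w \<longrightarrow>
        X (\<lambda>y. u y + w y) = X u + X w \<and>
        X (\<lambda>y. u y * w y) = u p * X w + w p * X u) \<and>
     (\<forall>a u. smooth_near M A p u \<longrightarrow> X (\<lambda>y. a * u y) = a * X u)}"

definition coord_vec ::
    "'a topology \<Rightarrow> ('a, 'n::finite) chart set \<Rightarrow> ('a, 'n) chart \<Rightarrow> 'n \<Rightarrow> 'a \<Rightarrow> 'a tvec" where
  "coord_vec M A c i p =
     (\<lambda>u. if smooth_near M A p u then pd i (coord_fun c u) (snd c p) else 0)"

type_synonym 'a tensor2 = "'a \<Rightarrow> 'a tvec \<Rightarrow> 'a tvec \<Rightarrow> real"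

definition coord_tensor2 ::
    "'a topology \<Rightarrow> ('a, 'n::finite) chart set \<Rightarrow> ('a, 'n) chart \<Rightarrow> 'a tensor2
      \<Rightarrow> real^'n \<Rightarrow> real^'n^'n" where
  "coord_tensor2 M A c T x = (\<chi> i j.
     T (chart_inv c x) (coord_vec M A c i (chart_inv c x)) (coord_vec M A c j (chart_inv c x)))"

definition smooth_tensor2 ::
    "'a topology \<Rightarrow> ('a, 'n::finite) chart set \<Rightarrow> 'a tensor2 \<Rightarrow> bool" where
  "smooth_tensor2 M A T \<longleftrightarrow>
     (\<forall>p\<in>topspace M. \<forall>X\<in>tangent_space M A p. \<forall>Y\<in>tangent_space M A p.
        \<forall>Z\<in>tangent_space M A p. \<forall>a b.
          T p (\<lambda>u. a * X u + b * Y u) Z = a * T p X Z + b * T p Y Z \<and>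
          T p Z (\<lambda>u. a * X u + b * Y u) = a * T p Z X + b * T p Z Y) \<and>
     (\<forall>c\<in>A. \<forall>i j. smooth_on (snd c ` fst c) (\<lambda>x. coord_tensor2 M A c T x $ i $ j))"

definition symmetric_tensor2 ::
    "'a topology \<Rightarrow> ('a, 'n::finite) chart set \<Rightarrow> 'a tensor2 \<Rightarrow> bool" where
  "symmetric_tensor2 M A T \<longleftrightarrow> smooth_tensor2 M A T \<and>
     (\<forall>p\<in>topspace M. \<forall>X\<in>tangent_space M A p. \<forall>Y\<in>tangent_space M A p. T p X Y = T p Y X)"

definition riemannian_metric ::
    "'a topology \<Rightarrow> ('a, 'n::finite) chart set \<Rightarrow> 'a tensor2 \<Rightarrow> bool" where
  "riemannian_metric M A g \<longleftrightarrow> symmetric_tensor2 M A g \<and>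
     (\<forall>p\<in>topspace M. \<forall>X\<in>tangent_space M A p. X \<noteq> (\<lambda>u. 0) \<longrightarrow> g p X X > 0)"

text \<open>The tensor \<open>g + \<phi>\<^sup>2 df \<otimes> df\<close>, using \<open>df(X) = X f\<close>.\<close>

definition graph_metric :: "'a tensor2 \<Rightarrow> ('a \<Rightarrow> real) \<Rightarrow> ('a \<Rightarrow> real) \<Rightarrow> 'a tensor2" where
  "graph_metric g \<phi> f p X Y = g p X Y + (\<phi> p)\<^sup>2 * (X f * Y f)"


section \<open>Tensor calculus in coordinates\<close>

text \<open>Here \<open>G\<close> is the matrix field of components of a metric in a chart, \<open>T\<close>, \<open>K\<close> are matrix fields
  of components of covariant 2-tensors, \<open>w\<close> is the field of components of a 1-form and
  \<open>F\<close>, \<open>P\<close> are functions, all of them on the image of the chart.\<close>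

definition ginv :: "(real^'n \<Rightarrow> real^'n^'n) \<Rightarrow> real^'n \<Rightarrow> 'n::finite \<Rightarrow> 'n \<Rightarrow> real" where
  "ginv G x i j = matrix_inv (G x) $ i $ j"

text \<open>\<open>christoffel G l i j\<close> is \<open>\<Gamma>\<^sup>l\<^sub>i\<^sub>j\<close>.\<close>

definition christoffel ::
    "(real^'n \<Rightarrow> real^'n^'n) \<Rightarrow> 'n::finite \<Rightarrow> 'n \<Rightarrow> 'n \<Rightarrow> real^'n \<Rightarrow> real" where
  "christoffel G l i j x = 1/2 * (\<Sum>m\<in>UNIV. ginv G x l m *
     (pd i (\<lambda>y. G y $ j $ m) x + pd j (\<lambda>y. G y $ i $ m) x - pd m (\<lambda>y. G y $ i $ j) x))"

text \<open>\<open>riemann G l k i j\<close> is the \<open>l\<close>-th component of \<open>R(\<partial>\<^sub>i, \<partial>\<^sub>j) \<partial>\<^sub>k\<close> with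
  \<open>R(X, Y) Z = \<nabla>\<^sub>X \<nabla>\<^sub>Y Z - \<nabla>\<^sub>Y \<nabla>\<^sub>X Z - \<nabla>\<^bsub>[X, Y]\<^esub> Z\<close>; the scalar curvature of round spheres is positive.\<close>

definition riemann ::
    "(real^'n \<Rightarrow> real^'n^'n) \<Rightarrow> 'n::finite \<Rightarrow> 'n \<Rightarrow> 'n \<Rightarrow> 'n \<Rightarrow> real^'n \<Rightarrow> real" where
  "riemann G l k i j x =
     pd i (christoffel G l j k) x - pd j (christoffel G l i k) x +
     (\<Sum>m\<in>UNIV. christoffel G l i m x * christoffel G m j k x
              - christoffel G l j m x * christoffel G m i k x)"

definition ricci :: "(real^'n \<Rightarrow> real^'n^'n) \<Rightarrow> 'n::finite \<Rightarrow> 'n \<Rightarrow> real^'n \<Rightarrow> real" where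
  "ricci G j k x = (\<Sum>i\<in>UNIV. riemann G i k i j x)"

definition scalar_curvature :: "(real^'n \<Rightarrow> real^'n^'n) \<Rightarrow> real^'n::finite \<Rightarrow> real" where
  "scalar_curvature G x = (\<Sum>j\<in>UNIV. \<Sum>k\<in>UNIV. ginv G x j k * ricci G j k x)"

definition trace2 ::
    "(real^'n \<Rightarrow> real^'n^'n) \<Rightarrow> (real^'n \<Rightarrow> real^'n^'n) \<Rightarrow> real^'n::finite \<Rightarrow> real" where
  "trace2 G T x = (\<Sum>i\<in>UNIV. \<Sum>j\<in>UNIV. ginv G x i j * T x $ i $ j)"

definition norm2_sq ::
    "(real^'n \<Rightarrow> real^'n^'n) \<Rightarrow> (real^'n \<Rightarrow> real^'n^'n) \<Rightarrow> real^'n::finite \<Rightarrow> real" where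
  "norm2_sq G T x = (\<Sum>i\<in>UNIV. \<Sum>j\<in>UNIV. \<Sum>a\<in>UNIV. \<Sum>b\<in>UNIV.
     ginv G x i a * ginv G x j b * T x $ i $ j * T x $ a $ b)"

definition norm1_sq ::
    "(real^'n \<Rightarrow> real^'n^'n) \<Rightarrow> (real^'n \<Rightarrow> real^'n) \<Rightarrow> real^'n::finite \<Rightarrow> real" where
  "norm1_sq G w x = (\<Sum>i\<in>UNIV. \<Sum>j\<in>UNIV. ginv G x i j * w x $ i * w x $ j)"

definition differential :: "(real^'n \<Rightarrow> real) \<Rightarrow> real^'n \<Rightarrow> real^'n::finite" where
  "differential F x = (\<chi> i. pd i F x)"

definition gradient ::
    "(real^'n \<Rightarrow> real^'n^'n) \<Rightarrow> (real^'n \<Rightarrow> real) \<Rightarrow> real^'n \<Rightarrow> real^'n::finite" where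
  "gradient G F x = (\<chi> i. \<Sum>j\<in>UNIV. ginv G x i j * pd j F x)"

definition hessian ::
    "(real^'n \<Rightarrow> real^'n^'n) \<Rightarrow> (real^'n \<Rightarrow> real) \<Rightarrow> real^'n \<Rightarrow> real^'n::finite^'n" where
  "hessian G F x = (\<chi> i j. pd i (pd j F) x - (\<Sum>l\<in>UNIV. christoffel G l i j x * pd l F x))"

text \<open>\<open>(\<nabla>\<^sub>i w)\<^sub>j\<close> and \<open>(\<nabla>\<^sub>l T)\<^sub>i\<^sub>j\<close> for the Levi-Civita connection.\<close>

definition cov_deriv1 ::
    "(real^'n \<Rightarrow> real^'n^'n) \<Rightarrow> (real^'n \<Rightarrow> real^'n) \<Rightarrow> 'n::finite \<Rightarrow> 'n \<Rightarrow> real^'n \<Rightarrow> real" where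
  "cov_deriv1 G w i j x =
     pd i (\<lambda>y. w y $ j) x - (\<Sum>m\<in>UNIV. christoffel G m i j x * w x $ m)"

definition cov_deriv2 ::
    "(real^'n \<Rightarrow> real^'n^'n) \<Rightarrow> (real^'n \<Rightarrow> real^'n^'n) \<Rightarrow> 'n::finite \<Rightarrow> 'n \<Rightarrow> 'n
      \<Rightarrow> real^'n \<Rightarrow> real" where
  "cov_deriv2 G T l i j x = pd l (\<lambda>y. T y $ i $ j) x
     - (\<Sum>m\<in>UNIV. christoffel G m l i x * T x $ m $ j)
     - (\<Sum>m\<in>UNIV. christoffel G m l j x * T x $ i $ m)"

definition div1 ::
    "(real^'n \<Rightarrow> real^'n^'n) \<Rightarrow> (real^'n \<Rightarrow> real^'n) \<Rightarrow> real^'n::finite \<Rightarrow> real" where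
  "div1 G w x = (\<Sum>i\<in>UNIV. \<Sum>j\<in>UNIV. ginv G x i j * cov_deriv1 G w i j x)"

definition div2 ::
    "(real^'n \<Rightarrow> real^'n^'n) \<Rightarrow> (real^'n \<Rightarrow> real^'n^'n) \<Rightarrow> real^'n \<Rightarrow> real^'n::finite" where
  "div2 G T x = (\<chi> j. \<Sum>l\<in>UNIV. \<Sum>i\<in>UNIV. ginv G x l i * cov_deriv2 G T l i j x)"

definition eval1 :: "real^'n \<Rightarrow> real^'n::finite \<Rightarrow> real" where
  "eval1 w X = (\<Sum>i\<in>UNIV. w $ i * X $ i)"

definition eval2 :: "real^'n^'n \<Rightarrow> real^'n \<Rightarrow> real^'n::finite \<Rightarrow> real" where
  "eval2 T X Y = (\<Sum>i\<in>UNIV. \<Sum>j\<in>UNIV. T $ i $ j * X $ i * Y $ j)"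

text \<open>The components of the 1-form \<open>T(X, \<cdot>)\<close>.\<close>

definition insert_vec :: "real^'n^'n \<Rightarrow> real^'n \<Rightarrow> real^'n::finite" where
  "insert_vec T X = (\<chi> j. \<Sum>i\<in>UNIV. T $ i $ j * X $ i)"

definition dir_deriv :: "real^'n \<Rightarrow> (real^'n \<Rightarrow> real) \<Rightarrow> real^'n::finite \<Rightarrow> real" where
  "dir_deriv X F x = (\<Sum>i\<in>UNIV. X $ i * pd i F x)"


section \<open>Energy and momentum density, and the quantities attached to a graph\<close>

definition energy_density ::
    "(real^'n \<Rightarrow> real^'n^'n) \<Rightarrow> (real^'n \<Rightarrow> real^'n^'n) \<Rightarrow> real^'n::finite \<Rightarrow> real" where
  "energy_density G K x =
     1 / (8 * pi) * (1/2 * (scalar_curvature G x + (trace2 G K x)\<^sup>2 - norm2_sq G K x))"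

definition momentum_density ::
    "(real^'n \<Rightarrow> real^'n^'n) \<Rightarrow> (real^'n \<Rightarrow> real^'n^'n) \<Rightarrow> real^'n \<Rightarrow> real^'n::finite" where
  "momentum_density G K x =
     (1 / (8 * pi)) *\<^sub>R div2 G (\<lambda>y. K y - trace2 G K y *\<^sub>R G y) x"

definition graph_slope ::
    "(real^'n \<Rightarrow> real^'n^'n) \<Rightarrow> (real^'n \<Rightarrow> real) \<Rightarrow> (real^'n \<Rightarrow> real) \<Rightarrow> real^'n::finite \<Rightarrow> real" where
  "graph_slope G P F x = sqrt (1 + (P x)\<^sup>2 * norm1_sq G (differential F) x)"

definition graph_v ::
    "(real^'n \<Rightarrow> real^'n^'n) \<Rightarrow> (real^'n \<Rightarrow> real) \<Rightarrow> (real^'n \<Rightarrow> real)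
      \<Rightarrow> real^'n \<Rightarrow> real^'n::finite" where
  "graph_v G P F x = (P x / graph_slope G P F x) *\<^sub>R gradient G F x"

definition graph_h ::
    "(real^'n \<Rightarrow> real^'n^'n) \<Rightarrow> (real^'n \<Rightarrow> real) \<Rightarrow> (real^'n \<Rightarrow> real)
      \<Rightarrow> real^'n \<Rightarrow> real^'n::finite^'n" where
  "graph_h G P F x = (\<chi> i j.
     (P x * hessian G F x $ i $ j + pd i F x * pd j P x + pd i P x * pd j F x)
       / graph_slope G P F x)"

end

theory Submission
  imports Defs
begin

text \<open>
  Write \<open>\<nu>\<close> for the 1-form dual to \<open>v\<close>, \<open>b\<close> for the \<open>g\<close>-bar gradient of \<open>\<phi>\<close>, \<open>w\<^sup>2 = 1 + \<phi>\<^sup>2 |df|\<^sup>2\<close> and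
  \<open>\<lambda>\<close> for the trace of the difference \<open>C\<close> of the two Levi-Civita connections. Then
  \<open>C(X, Y) = h(X, Y) v - (w\<^sup>2/\<phi>) \<nu>(X) \<nu>(Y) b\<close>, and \<open>\<nabla>v\<close> is \<open>h\<close> with one index raised by the graph metric,
  minus \<open>\<nu> \<otimes> b/\<phi>\<close>. The scalar curvature of the graph metric is the \<open>g\<close>-bar trace of \<open>Ric\<close>, which is
  \<open>R - Ric(v, v)\<close>, plus a divergence and terms quadratic in \<open>C\<close>, while
  \<open>Ric(v, v) = div(\<nabla>\<^sub>v v - v div v) - tr (\<nabla>v)\<^sup>2 + (div v)\<^sup>2\<close>. When the two divergences are combined, everything
  involving second derivatives of \<open>\<phi>\<close> cancels and only \<open>2 tr(h) v - 2 h(v, \<cdot>)\<close> remains inside, which is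
  the case \<open>k = 0\<close>. The terms linear in \<open>k\<close> cancel because
  \<open>div(k(v, \<cdot>)) = (div k)(v) + \<langle>k, \<nabla>v\<rangle>\<close>, and those quadratic in \<open>k\<close> because the inverse metrics differ by \<open>v \<otimes> v\<close>.
\<close>

section \<open>Calculus of smooth functions\<close>

text \<open>Up to sign, \<open>h\<close> is the second fundamental form of the graph
  \<open>t = f\<close> in the static spacetime with metric \<open>g\<close>-bar minus
  \<open>phi^2 dt^2\<close>; the metric induced on that graph is \<open>g\<close>, and
  \<open>w\<close> is the Lorentz factor of \<open>v\<close>, since
  \<open>|v|^2 = 1 - 1/w^2\<close>. The proof does not build this spacetime: it stays on the
  3-manifold, where comparing two connections needs only the coordinates of one chart. The obstacle
  is the second derivatives of \<open>phi\<close>. They are never computed, but kept inside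
  divergences of vector fields. Two coincidences make this work: the \<open>g\<close>-bar trace of
  \<open>C\<close> and the field \<open>nabla_v v\<close> contain the same multiple of
  \<open>b\<close>, and raising \<lambda> produces the multiple \<open>v(phi)/(phi w^2)\<close> of
  \<open>v\<close> that also occurs in \<open>div v\<close>. Hence the field whose divergence enters
  the curvature of the graph metric is \<open>Y + 2 Z\<close>, with
  \<open>Y = nabla_v v - v div v\<close> the field of the formula for \<open>Ric(v, v)\<close> and
  \<open>Z = tr(h) v - h(v, .)\<close> raised, and \<open>div Y\<close> cancels. Passing from one
  divergence to the other costs only a pairing with \<lambda>, which equals \<open>d log w\<close>
  because the volume densities have quotient \<open>w\<close>.\<close>

lemma pd_eqI:
  assumes "(u has_derivative D) (at x)"
  shows "pd i u x = D (axis i 1)"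
  using assms frechet_derivative_at unfolding pd_def by metis

lemma has_derivative_pd:
  assumes "u differentiable (at x)"
  obtains D where "(u has_derivative D) (at x)" "\<And>i. pd i u x = D (axis i 1)"
  using assms pd_eqI unfolding differentiable_def by metis

text \<open>Holds without differentiability: the derivative is chosen from the set of all Frechet
  derivatives at the point, and functions that agree near \<open>x\<close> have the same such set,
  be it empty or not.\<close>

lemma pd_cong:
  assumes "open S" "x \<in> S" "\<And>y. y \<in> S \<Longrightarrow> u y = w y"
  shows "pd i u x = pd i w x"
proof -
  have "(u has_derivative D) (at x) \<longleftrightarrow> (w has_derivative D) (at x)" for D
    using has_derivative_transform_within_open[OF _ assms(1,2)] assms(3) by metis
  then show ?thesis
    unfolding pd_def frechet_derivative_def by simp
qed

lemma pd_const [simp]: "pd i (\<lambda>y. c) x = 0"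
  by (rule pd_eqI[OF has_derivative_const])

lemma pd_add:
  assumes "u differentiable (at x)" "w differentiable (at x)"
  shows "pd i (\<lambda>y. u y + w y) x = pd i u x + pd i w x"
proof -
  obtain D E where *: "(u has_derivative D) (at x)" "(w has_derivative E) (at x)"
    "pd i u x = D (axis i 1)" "pd i w x = E (axis i 1)"
    using assms by (metis has_derivative_pd)
  show ?thesis
    using pd_eqI[OF has_derivative_add[OF *(1,2)], of i] *(3,4) by simp
qed

lemma pd_mult:
  fixes u w :: "real^'n::finite \<Rightarrow> real"
  assumes "u differentiable (at x)" "w differentiable (at x)"
  shows "pd i (\<lambda>y. u y * w y) x = pd i u x * w x + u x * pd i w x"
proof -
  obtain D E where *: "(u has_derivative D) (at x)" "(w has_derivative E) (at x)"
    "pd i u x = D (axis i 1)" "pd i w x = E (axis i 1)"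
    using assms by (metis has_derivative_pd)
  show ?thesis
    using pd_eqI[OF has_derivative_mult[OF *(1,2)], of i] *(3,4) by simp
qed

lemma pd_minus:
  assumes "u differentiable (at x)"
  shows "pd i (\<lambda>y. - u y) x = - pd i u x"
proof -
  obtain D where *: "(u has_derivative D) (at x)" "pd i u x = D (axis i 1)"
    using assms by (metis has_derivative_pd)
  show ?thesis
    using pd_eqI[OF has_derivative_minus[OF *(1)], of i] *(2) by simp
qed

lemma pd_chain_real:
  fixes u :: "real^'n::finite \<Rightarrow> real"
  assumes "u differentiable (at x)" "(\<psi> has_real_derivative d) (at (u x))"
  shows "(\<lambda>y. \<psi> (u y)) differentiable (at x)" "pd i (\<lambda>y. \<psi> (u y)) x = pd i u x * d"
proof -
  obtain D where *: "(u has_derivative D) (at x)" "pd i u x = D (axis i 1)"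
    using assms by (metis has_derivative_pd)
  have "((\<lambda>y. \<psi> (u y)) has_derivative (\<lambda>h. D h * d)) (at x)"
    using DERIV_compose_FDERIV[OF assms(2) *(1)] .
  then show "(\<lambda>y. \<psi> (u y)) differentiable (at x)" "pd i (\<lambda>y. \<psi> (u y)) x = pd i u x * d"
    using pd_eqI *(2) by (auto simp: differentiable_def)
qed

lemma pd_vec_nth:
  assumes "u differentiable (at x)"
  shows "(\<lambda>y. u y $ j) differentiable (at x)" "pd i (\<lambda>y. u y $ j) x = pd i u x $ j"
proof -
  obtain D where *: "(u has_derivative D) (at x)" "pd i u x = D (axis i 1)"
    using assms by (metis has_derivative_pd)
  have "((\<lambda>y. u y $ j) has_derivative (\<lambda>h. D h $ j)) (at x)"
    using bounded_linear.has_derivative[OF bounded_linear_vec_nth *(1)] .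
  then show "(\<lambda>y. u y $ j) differentiable (at x)" "pd i (\<lambda>y. u y $ j) x = pd i u x $ j"
    using pd_eqI *(2) by (auto simp: differentiable_def)
qed

section \<open>Closure properties of functions of class C^m on open sets\<close>

lemma Ck_on_cong:
  assumes "open S" "\<And>x. x \<in> S \<Longrightarrow> u x = w x" "Ck_on m S u"
  shows "Ck_on m S w"
  using assms(2,3)
proof (induction m arbitrary: u w)
  case 0
  then show ?case by (simp cong: continuous_on_cong)
next
  case (Suc m)
  have "w differentiable_on S"
    using Suc.prems unfolding Ck_on.simps differentiable_on_def
    by (metis differentiable_transform_within zero_less_one)
  moreover have "Ck_on m S (pd i w)" for i
    by (rule Suc.IH[of "pd i u"]) (use Suc.prems pd_cong[OF assms(1) _ Suc.prems(1)] in auto)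
  ultimately show ?case by simp
qed

lemma Ck_on_differentiable:
  "open S \<Longrightarrow> Ck_on (Suc m) S u \<Longrightarrow> x \<in> S \<Longrightarrow> u differentiable (at x)"
  using differentiable_on_eq_differentiable_at by auto

lemma Ck_on_lower: "Ck_on (Suc m) S u \<Longrightarrow> Ck_on m S u"
proof (induction m arbitrary: u)
  case 0
  then show ?case by (simp add: differentiable_imp_continuous_on)
qed simp

lemma Ck_on_subset: "Ck_on m S u \<Longrightarrow> T \<subseteq> S \<Longrightarrow> Ck_on m T u"
  by (induction m arbitrary: u) (auto intro: continuous_on_subset differentiable_on_subset)

lemma Ck_on_const: "Ck_on m S (\<lambda>y. c)"
proof (induction m arbitrary: c)
  case (Suc m)
  have "pd i (\<lambda>y. c) = (\<lambda>y. 0)" for i :: 'a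
    by (simp add: fun_eq_iff)
  with Suc show ?case by simp
qed simp

text \<open>Calculus rules give a formula for \<open>pd i u\<close> only at points of
  \<open>S\<close>, while \<open>Ck_on\<close> recurses through the total function
  \<open>pd i u\<close>. Agreement on the open set \<open>S\<close> is enough to replace one by the
  other.\<close>

lemma Ck_on_SucI:
  assumes "open S" "\<And>x. x \<in> S \<Longrightarrow> u differentiable (at x)"
    "\<And>i x. x \<in> S \<Longrightarrow> pd i u x = u' i x" "\<And>i. Ck_on m S (u' i)"
  shows "Ck_on (Suc m) S u"
proof -
  have "Ck_on m S (pd i u)" for i
    using Ck_on_cong[OF assms(1) _ assms(4)] assms(3) by metis
  then show ?thesis
    using assms(1,2) by (simp add: differentiable_on_eq_differentiable_at)
qed

lemma Ck_on_add:
  assumes "open S"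
  shows "Ck_on m S u \<Longrightarrow> Ck_on m S w \<Longrightarrow> Ck_on m S (\<lambda>y. u y + w y)"
proof (induction m arbitrary: u w)
  case (Suc m)
  note d = Ck_on_differentiable[OF assms Suc.prems(1)] Ck_on_differentiable[OF assms Suc.prems(2)]
  show ?case
    by (rule Ck_on_SucI[OF assms _ pd_add Suc.IH]) (use Suc.prems d in auto)
qed (simp add: continuous_on_add)

lemma Ck_on_minus:
  assumes "open S"
  shows "Ck_on m S u \<Longrightarrow> Ck_on m S (\<lambda>y. - u y)"
proof (induction m arbitrary: u)
  case (Suc m)
  note d = Ck_on_differentiable[OF assms Suc.prems(1)]
  show ?case
    by (rule Ck_on_SucI[OF assms _ pd_minus Suc.IH]) (use Suc.prems d in auto)
qed (simp add: continuous_on_minus)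

lemma Ck_on_mult:
  fixes u w :: "real^'n::finite \<Rightarrow> real"
  assumes "open S"
  shows "Ck_on m S u \<Longrightarrow> Ck_on m S w \<Longrightarrow> Ck_on m S (\<lambda>y. u y * w y)"
proof (induction m arbitrary: u w)
  case (Suc m)
  note d = Ck_on_differentiable[OF assms Suc.prems(1)] Ck_on_differentiable[OF assms Suc.prems(2)]
  show ?case
    by (rule Ck_on_SucI[OF assms _ pd_mult Ck_on_add[OF assms Suc.IH Suc.IH]])
      (use Suc.prems d Suc.prems[THEN Ck_on_lower] in auto)
qed (simp add: continuous_on_mult)

text \<open>A bootstrap: the derivative of \<open>inverse u\<close> is \<open>pd i u\<close> times a
  polynomial in \<open>inverse u\<close> itself, so regularity of order \<open>m\<close> of the same
  function yields order \<open>m + 1\<close>.\<close>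

lemma Ck_on_inverse:
  fixes u :: "real^'n::finite \<Rightarrow> real"
  assumes "open S" "\<And>x. x \<in> S \<Longrightarrow> u x \<noteq> 0"
  shows "Ck_on m S u \<Longrightarrow> Ck_on m S (\<lambda>y. inverse (u y))"
proof (induction m)
  case 0
  then show ?case using assms(2) by (simp add: continuous_on_inverse)
next
  case (Suc m)
  have ch: "(\<lambda>y. inverse (u y)) differentiable (at x)"
    "pd i (\<lambda>y. inverse (u y)) x = pd i u x * - (inverse (u x) * inverse (u x))" if "x \<in> S" for x i
  proof -
    have "(inverse has_real_derivative - (inverse (u x) * inverse (u x))) (at (u x))"
      using DERIV_inverse[OF assms(2)[OF that], of UNIV] by (simp add: power2_eq_square)
    then show "(\<lambda>y. inverse (u y)) differentiable (at x)"
      "pd i (\<lambda>y. inverse (u y)) x = pd i u x * - (inverse (u x) * inverse (u x))"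
      using pd_chain_real Ck_on_differentiable[OF assms(1) Suc.prems that] by blast+
  qed
  have "Ck_on m S (\<lambda>y. inverse (u y))"
    using Suc Ck_on_lower by blast
  then have "Ck_on m S (\<lambda>y. - (inverse (u y) * inverse (u y)))"
    by (intro Ck_on_minus Ck_on_mult assms(1))
  then show ?case
    using Suc.prems by (intro Ck_on_SucI[OF assms(1) ch Ck_on_mult[OF assms(1)]]) auto
qed

lemma Ck_on_sqrt:
  fixes u :: "real^'n::finite \<Rightarrow> real"
  assumes "open S" "\<And>x. x \<in> S \<Longrightarrow> u x > 0"
  shows "Ck_on m S u \<Longrightarrow> Ck_on m S (\<lambda>y. sqrt (u y))"
proof (induction m)
  case 0
  then show ?case by (simp add: continuous_on_real_sqrt)
next
  case (Suc m)
  have ch: "(\<lambda>y. sqrt (u y)) differentiable (at x)"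
    "pd i (\<lambda>y. sqrt (u y)) x = pd i u x * (inverse (sqrt (u x)) * (1/2))" if "x \<in> S" for x i
  proof -
    have "(sqrt has_real_derivative inverse (sqrt (u x)) * (1/2)) (at (u x))"
      using DERIV_real_sqrt[OF assms(2)[OF that]] by simp
    then show "(\<lambda>y. sqrt (u y)) differentiable (at x)"
      "pd i (\<lambda>y. sqrt (u y)) x = pd i u x * (inverse (sqrt (u x)) * (1/2))"
      using pd_chain_real Ck_on_differentiable[OF assms(1) Suc.prems that] by blast+
  qed
  \<comment> \<open>The derivative contains the inverse of the function under study, so the
    bootstrap passes through \<open>Ck_on_inverse\<close> and needs the root to be nonzero.\<close>
  have "sqrt (u x) \<noteq> 0" if "x \<in> S" for x
    using assms(2)[OF that] by simp
  moreover have "Ck_on m S (\<lambda>y. sqrt (u y))"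
    using Suc Ck_on_lower by blast
  ultimately have "Ck_on m S (\<lambda>y. inverse (sqrt (u y)) * (1/2))"
    by (intro Ck_on_mult Ck_on_inverse Ck_on_const assms(1))
  then show ?case
    using Suc.prems by (intro Ck_on_SucI[OF assms(1) ch Ck_on_mult[OF assms(1)]]) auto
qed

lemma Ck_on_vec_nth:
  assumes "open S"
  shows "Ck_on m S u \<Longrightarrow> Ck_on m S (\<lambda>y. u y $ j)"
proof (induction m arbitrary: u)
  case (Suc m)
  note d = Ck_on_differentiable[OF assms Suc.prems]
  show ?case
    by (rule Ck_on_SucI[OF assms pd_vec_nth(1) pd_vec_nth(2) Suc.IH]) (use Suc.prems d in auto)
qed (simp add: continuous_on_component)

section \<open>Closure rules for smooth functions and the matching rules for partial
  derivatives\<close>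

named_theorems smooth_intros

lemma smooth_on_const [smooth_intros]: "smooth_on S (\<lambda>y. c)"
  by (simp add: smooth_on_def Ck_on_const)

lemma smooth_on_subset: "smooth_on S u \<Longrightarrow> T \<subseteq> S \<Longrightarrow> smooth_on T u"
  unfolding smooth_on_def by (blast intro: Ck_on_subset)

lemma smooth_on_cong:
  "open S \<Longrightarrow> (\<And>x. x \<in> S \<Longrightarrow> u x = w x) \<Longrightarrow> smooth_on S u \<Longrightarrow> smooth_on S w"
  unfolding smooth_on_def using Ck_on_cong[of S u w] by blast

lemma smooth_on_differentiable:
  "open S \<Longrightarrow> smooth_on S u \<Longrightarrow> x \<in> S \<Longrightarrow> u differentiable (at x)"
  unfolding smooth_on_def by (blast intro: Ck_on_differentiable)

lemma smooth_on_pd [smooth_intros]: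
  assumes "smooth_on S u"
  shows "smooth_on S (pd i u)"
  unfolding smooth_on_def
proof
  fix m
  have "Ck_on (Suc m) S u" using assms smooth_on_def by blast
  then show "Ck_on m S (pd i u)" by simp
qed

lemma smooth_on_add [smooth_intros]:
  "open S \<Longrightarrow> smooth_on S u \<Longrightarrow> smooth_on S w \<Longrightarrow> smooth_on S (\<lambda>y. u y + w y)"
  by (simp add: smooth_on_def Ck_on_add)

lemma smooth_on_minus [smooth_intros]:
  "open S \<Longrightarrow> smooth_on S u \<Longrightarrow> smooth_on S (\<lambda>y. - u y)"
  by (simp add: smooth_on_def Ck_on_minus)

lemma smooth_on_diff [smooth_intros]:
  "open S \<Longrightarrow> smooth_on S u \<Longrightarrow> smooth_on S w \<Longrightarrow> smooth_on S (\<lambda>y. u y - w y)"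
  using smooth_on_add[of S u "\<lambda>y. - w y"] smooth_on_minus[of S w] by simp

lemma smooth_on_vec_nth: "open S \<Longrightarrow> smooth_on S u \<Longrightarrow> smooth_on S (\<lambda>y. u y $ j)"
  by (simp add: smooth_on_def Ck_on_vec_nth)

lemma smooth_on_mult [smooth_intros]:
  fixes u w :: "real^'n::finite \<Rightarrow> real"
  shows "open S \<Longrightarrow> smooth_on S u \<Longrightarrow> smooth_on S w \<Longrightarrow> smooth_on S (\<lambda>y. u y * w y)"
  by (simp add: smooth_on_def Ck_on_mult)

lemma smooth_on_divide [smooth_intros]:
  fixes u w :: "real^'n::finite \<Rightarrow> real"
  assumes "open S" "smooth_on S u" "smooth_on S w" "\<And>x. x \<in> S \<Longrightarrow> w x \<noteq> 0"
  shows "smooth_on S (\<lambda>y. u y / w y)"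
  using assms by (simp add: smooth_on_def Ck_on_mult Ck_on_inverse divide_inverse)

lemma smooth_on_sqrt [smooth_intros]:
  fixes u :: "real^'n::finite \<Rightarrow> real"
  assumes "open S" "smooth_on S u" "\<And>x. x \<in> S \<Longrightarrow> u x > 0"
  shows "smooth_on S (\<lambda>y. sqrt (u y))"
  using assms by (simp add: smooth_on_def Ck_on_sqrt)

lemma smooth_on_power [smooth_intros]:
  fixes u :: "real^'n::finite \<Rightarrow> real"
  assumes "open S" "smooth_on S u"
  shows "smooth_on S (\<lambda>y. u y ^ n)"
  by (induction n) (auto intro!: smooth_intros assms)

lemma smooth_on_sum [smooth_intros]:
  assumes "open S" "\<And>i. i \<in> I \<Longrightarrow> smooth_on S (u i)"
  shows "smooth_on S (\<lambda>y. \<Sum>i\<in>I. u i y)"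
  using assms(2) by (induction I rule: infinite_finite_induct) (auto intro!: smooth_intros assms(1))

lemma smooth_on_prod [smooth_intros]:
  fixes u :: "'i \<Rightarrow> real^'n::finite \<Rightarrow> real"
  assumes "open S" "\<And>i. i \<in> I \<Longrightarrow> smooth_on S (u i)"
  shows "smooth_on S (\<lambda>y. \<Prod>i\<in>I. u i y)"
  using assms(2) by (induction I rule: infinite_finite_induct) (auto intro!: smooth_intros assms(1))

lemma pd_add_smooth:
  "open S \<Longrightarrow> x \<in> S \<Longrightarrow> smooth_on S u \<Longrightarrow> smooth_on S w \<Longrightarrow>
    pd i (\<lambda>y. u y + w y) x = pd i u x + pd i w x"
  by (intro pd_add smooth_on_differentiable)

lemma pd_diff_smooth:
  "open S \<Longrightarrow> x \<in> S \<Longrightarrow> smooth_on S u \<Longrightarrow> smooth_on S w \<Longrightarrow>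
    pd i (\<lambda>y. u y - w y) x = pd i u x - pd i w x"
  using pd_add[of u x "\<lambda>y. - w y" i] pd_minus[of w x i]
  by (simp add: smooth_on_differentiable smooth_on_minus)

lemma pd_mult_smooth:
  fixes u w :: "real^'n::finite \<Rightarrow> real"
  shows "open S \<Longrightarrow> x \<in> S \<Longrightarrow> smooth_on S u \<Longrightarrow> smooth_on S w \<Longrightarrow>
    pd i (\<lambda>y. u y * w y) x = pd i u x * w x + u x * pd i w x"
  by (intro pd_mult smooth_on_differentiable)

lemma pd_sum_smooth:
  assumes "open S" "x \<in> S" "\<And>j. j \<in> I \<Longrightarrow> smooth_on S (u j)"
  shows "pd i (\<lambda>y. \<Sum>j\<in>I. u j y) x = (\<Sum>j\<in>I. pd i (u j) x)"
  using assms(3)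
proof (induction I rule: infinite_finite_induct)
  case (insert j I)
  then show ?case
    by (simp add: pd_add_smooth[OF assms(1,2)] smooth_on_sum[OF assms(1)])
qed simp_all

section \<open>Symmetry of second partial derivatives\<close>

lemma pd_axis_deriv:
  fixes u :: "real^'n::finite \<Rightarrow> real"
  assumes "u differentiable (at (a + s *\<^sub>R axis i 1))"
  shows "((\<lambda>s. u (a + s *\<^sub>R axis i 1)) has_real_derivative pd i u (a + s *\<^sub>R axis i 1)) (at s)"
proof -
  obtain D where D: "(u has_derivative D) (at (a + s *\<^sub>R axis i 1))"
    "pd i u (a + s *\<^sub>R axis i 1) = D (axis i 1)"
    using assms by (metis has_derivative_pd)
  have "((\<lambda>s. a + s *\<^sub>R axis i 1) has_derivative (\<lambda>t. t *\<^sub>R axis i 1)) (at s)"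
    by (auto intro!: derivative_eq_intros)
  from diff_chain_at[OF this D(1)] have
    "((\<lambda>s. u (a + s *\<^sub>R axis i 1)) has_derivative (\<lambda>t. D (t *\<^sub>R axis i 1))) (at s)"
    by (simp add: o_def)
  moreover have "(\<lambda>t. D (t *\<^sub>R axis i 1)) = (*) (D (axis i 1))"
    using has_derivative_linear[OF D(1)] by (simp add: linear_scale fun_eq_iff)
  ultimately show ?thesis
    using D(2) by (simp add: has_field_derivative_def)
qed

text \<open>The mean value theorem is applied twice, first along \<open>i\<close> and then along
  \<open>j\<close>. The second difference on the left is symmetric in \<open>i\<close> and
  \<open>j\<close>, the derivative on the right is not yet, and this tension is what
  \<open>pd_commute\<close> exploits.\<close>

lemma second_difference_eq:
  fixes u :: "real^'n::finite \<Rightarrow> real"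
  assumes S: "ball x r \<subseteq> S" "open S" "smooth_on S u" and t: "0 < t" "2 * t < r"
  shows "\<exists>\<xi>. dist x \<xi> \<le> 2 * t \<and>
    u (x + t *\<^sub>R axis i 1 + t *\<^sub>R axis j 1) - u (x + t *\<^sub>R axis i 1) - u (x + t *\<^sub>R axis j 1) + u x
      = t * t * pd j (pd i u) \<xi>"
proof -
  have near: "dist x (x + a *\<^sub>R axis i 1 + b *\<^sub>R axis j 1) \<le> 2 * t"
    if "0 \<le> a" "a \<le> t" "0 \<le> b" "b \<le> t" for a b
  proof -
    have "dist x (x + a *\<^sub>R axis i 1 + b *\<^sub>R axis j 1) = norm (a *\<^sub>R axis i (1::real) + b *\<^sub>R axis j 1)"
      by (simp add: dist_norm norm_minus_commute add_ac)
    also have "\<dots> \<le> a + b"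
      using norm_triangle_ineq[of "a *\<^sub>R axis i (1::real)" "b *\<^sub>R axis j 1"] that
      by (simp add: norm_axis_1)
    finally show ?thesis using that by simp
  qed
  have inS: "x + a *\<^sub>R axis i 1 + b *\<^sub>R axis j 1 \<in> S"
    if "0 \<le> a" "a \<le> t" "0 \<le> b" "b \<le> t" for a b
    using near[OF that] t S(1) by (meson in_mono le_less_trans mem_ball)
  have d: "w differentiable (at (x + a *\<^sub>R axis i 1 + b *\<^sub>R axis j 1))"
    if "0 \<le> a" "a \<le> t" "0 \<le> b" "b \<le> t" "smooth_on S w" for a b and w :: "real^'n \<Rightarrow> real"
    using smooth_on_differentiable[OF S(2) that(5)] inS that by blast
  \<comment> \<open>The increment across the square in direction \<open>j\<close>, as a function of
    the position along \<open>i\<close>; its own increment from 0 to \<open>t\<close> is the second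
    difference.\<close>
  let ?\<psi> = "\<lambda>s. u ((x + t *\<^sub>R axis j 1) + s *\<^sub>R axis i 1) - u (x + s *\<^sub>R axis i 1)"
  have "\<exists>z>0. z < t \<and> ?\<psi> t - ?\<psi> 0 = (t - 0) *
     (pd i u ((x + t *\<^sub>R axis j 1) + z *\<^sub>R axis i 1) - pd i u (x + z *\<^sub>R axis i 1))"
  proof (rule MVT2[OF t(1)])
    fix s assume "0 \<le> s" "s \<le> t"
    with d[of s t u] d[of s 0 u] S(3) t show "(?\<psi> has_real_derivative
      (pd i u ((x + t *\<^sub>R axis j 1) + s *\<^sub>R axis i 1) - pd i u (x + s *\<^sub>R axis i 1))) (at s)"
      by (intro DERIV_diff pd_axis_deriv) (simp_all add: add_ac)
  qed
  then obtain a where a: "0 < a" "a < t" "?\<psi> t - ?\<psi> 0 = t *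
     (pd i u ((x + t *\<^sub>R axis j 1) + a *\<^sub>R axis i 1) - pd i u (x + a *\<^sub>R axis i 1))"
    by auto
  let ?\<chi> = "\<lambda>s. pd i u ((x + a *\<^sub>R axis i 1) + s *\<^sub>R axis j 1)"
  have "\<exists>z>0. z < t \<and> ?\<chi> t - ?\<chi> 0 = (t - 0) * pd j (pd i u) ((x + a *\<^sub>R axis i 1) + z *\<^sub>R axis j 1)"
  proof (rule MVT2[OF t(1)])
    fix s assume "0 \<le> s" "s \<le> t"
    with d[of a s "pd i u"] S(3) a show "(?\<chi> has_real_derivative
      pd j (pd i u) ((x + a *\<^sub>R axis i 1) + s *\<^sub>R axis j 1)) (at s)"
      by (intro pd_axis_deriv) (simp_all add: smooth_intros)
  qed
  then obtain b where b: "0 < b" "b < t"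
    "?\<chi> t - ?\<chi> 0 = t * pd j (pd i u) ((x + a *\<^sub>R axis i 1) + b *\<^sub>R axis j 1)"
    by auto
  have "u (x + t *\<^sub>R axis i 1 + t *\<^sub>R axis j 1) - u (x + t *\<^sub>R axis i 1) - u (x + t *\<^sub>R axis j 1) + u x
      = t * t * pd j (pd i u) (x + a *\<^sub>R axis i 1 + b *\<^sub>R axis j 1)"
    using a(3) b(3) by (simp add: add_ac)
  then show ?thesis
    using near[of a b] a b by auto
qed

text \<open>One and the same second difference equals \<open>t^2\<close> times either mixed
  derivative at some point within \<open>2 t\<close> of \<open>x\<close>. Let \<open>t\<close> tend
  to 0 and use continuity of both mixed derivatives at \<open>x\<close>.\<close>

lemma pd_commute:
  fixes u :: "real^'n::finite \<Rightarrow> real"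
  assumes "open S" "x \<in> S" "smooth_on S u"
  shows "pd i (pd j u) x = pd j (pd i u) x"
proof -
  obtain r where r: "r > 0" "ball x r \<subseteq> S"
    using assms open_contains_ball by blast
  have cont: "isCont (pd i (pd j u)) x" for i j
    by (intro differentiable_imp_continuous_within smooth_on_differentiable[OF assms(1) _ assms(2)]
        smooth_intros assms(3))
  \<comment> \<open>The factor 4 keeps \<open>2 * t n\<close> at most \<open>r / 2\<close>, so the
    squares stay inside the ball.\<close>
  define t where "t n = r / (4 * real (Suc n))" for n
  have t: "0 < t n" "2 * t n < r" for n
  proof -
    show "0 < t n" using r by (simp add: t_def)
    have "t n \<le> r / 4"
      unfolding t_def using r by (intro divide_left_mono) auto
    then show "2 * t n < r" using r by simp
  qed
  have t0: "t \<longlonglongrightarrow> 0"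
    using tendsto_mult_left[OF LIMSEQ_inverse_real_of_nat, of "r/4"]
    by (simp add: t_def[abs_def] field_simps)
  obtain \<xi> where \<xi>: "\<And>n. dist x (\<xi> n) \<le> 2 * t n" "\<And>n.
    u (x + t n *\<^sub>R axis i 1 + t n *\<^sub>R axis j 1) - u (x + t n *\<^sub>R axis i 1) - u (x + t n *\<^sub>R axis j 1) + u x
      = t n * t n * pd j (pd i u) (\<xi> n)"
    using second_difference_eq[OF r(2) assms(1,3) t, where i=i and j=j]
      choice[of "\<lambda>n \<xi>. dist x \<xi> \<le> 2 * t n \<and> u (x + t n *\<^sub>R axis i 1 + t n *\<^sub>R axis j 1)
        - u (x + t n *\<^sub>R axis i 1) - u (x + t n *\<^sub>R axis j 1) + u x = t n * t n * pd j (pd i u) \<xi>"] by blast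
  obtain \<eta> where \<eta>: "\<And>n. dist x (\<eta> n) \<le> 2 * t n" "\<And>n.
    u (x + t n *\<^sub>R axis j 1 + t n *\<^sub>R axis i 1) - u (x + t n *\<^sub>R axis j 1) - u (x + t n *\<^sub>R axis i 1) + u x
      = t n * t n * pd i (pd j u) (\<eta> n)"
    using second_difference_eq[OF r(2) assms(1,3) t, where i=j and j=i]
      choice[of "\<lambda>n \<xi>. dist x \<xi> \<le> 2 * t n \<and> u (x + t n *\<^sub>R axis j 1 + t n *\<^sub>R axis i 1)
        - u (x + t n *\<^sub>R axis j 1) - u (x + t n *\<^sub>R axis i 1) + u x = t n * t n * pd i (pd j u) \<xi>"] by blast
  have lim: "z \<longlonglongrightarrow> x" if "\<And>n. dist x (z n) \<le> 2 * t n" for z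
  proof -
    have "(\<lambda>n. 2 * t n) \<longlonglongrightarrow> 0"
      using tendsto_mult_left[OF t0, of 2] by simp
    moreover have "eventually (\<lambda>n. norm (dist (z n) x) \<le> 2 * t n) sequentially"
      using that by (simp add: dist_commute)
    ultimately have "(\<lambda>n. dist (z n) x) \<longlonglongrightarrow> 0"
      by (rule Lim_null_comparison[rotated])
    then show ?thesis by (simp add: tendsto_dist_iff[of z x])
  qed
  have eq: "pd j (pd i u) (\<xi> n) = pd i (pd j u) (\<eta> n)" for n
  proof -
    have "u (x + t n *\<^sub>R axis i 1 + t n *\<^sub>R axis j 1) = u (x + t n *\<^sub>R axis j 1 + t n *\<^sub>R axis i 1)"
      by (simp add: add_ac)
    then have "t n * t n * pd j (pd i u) (\<xi> n) = t n * t n * pd i (pd j u) (\<eta> n)"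
      using \<xi>(2)[of n] \<eta>(2)[of n] by linarith
    then show ?thesis using t[of n] by simp
  qed
  have "(\<lambda>n. pd j (pd i u) (\<xi> n)) \<longlonglongrightarrow> pd j (pd i u) x"
    "(\<lambda>n. pd i (pd j u) (\<eta> n)) \<longlonglongrightarrow> pd i (pd j u) x"
    by (intro isCont_tendsto_compose[OF cont] lim \<xi>(1) \<eta>(1))+
  then show ?thesis
    unfolding eq by (rule LIMSEQ_unique[symmetric])
qed

section \<open>The Levi-Civita connection in coordinates\<close>

text \<open>The first index \<open>i\<close> is the direction of differentiation, \<open>l\<close>
  the component. Vector fields are preferred to 1-forms because their divergence involves the metric
  only through the contracted Christoffel symbols, which makes the two metrics easy to
  compare.\<close>

definition cov_derivV ::
    "(real^'n \<Rightarrow> real^'n^'n) \<Rightarrow> (real^'n \<Rightarrow> real^'n) \<Rightarrow> 'n::finite \<Rightarrow> 'n \<Rightarrow> real^'n \<Rightarrow> real" where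
  "cov_derivV G X i l x = pd i (\<lambda>y. X y $ l) x + (\<Sum>m\<in>UNIV. christoffel G l i m x * X x $ m)"

definition divV ::
    "(real^'n \<Rightarrow> real^'n^'n) \<Rightarrow> (real^'n \<Rightarrow> real^'n) \<Rightarrow> real^'n::finite \<Rightarrow> real" where
  "divV G X x = (\<Sum>i\<in>UNIV. cov_derivV G X i i x)"

definition raise ::
    "(real^'n \<Rightarrow> real^'n^'n) \<Rightarrow> (real^'n \<Rightarrow> real^'n) \<Rightarrow> real^'n \<Rightarrow> real^'n::finite" where
  "raise G w x = (\<chi> i. \<Sum>j\<in>UNIV. ginv G x i j * w x $ j)"

lemma sum_rotate:
  "(\<Sum>i\<in>A. \<Sum>j\<in>B. \<Sum>k\<in>C. f i j k) = (\<Sum>j\<in>B. \<Sum>k\<in>C. \<Sum>i\<in>A. f i j k)"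
  by (subst sum.swap) (intro sum.cong refl sum.swap)

lemma matrix_inv_inverse:
  fixes A :: "real^'n^'n"
  assumes "invertible A"
  shows "A ** matrix_inv A = mat 1" "matrix_inv A ** A = mat 1"
  using assms someI_ex[of "\<lambda>A'. A ** A' = mat 1 \<and> A' ** A = mat 1"]
  unfolding invertible_def matrix_inv_def by blast+

text \<open>Displays the entries of the inverse as quotients of polynomials in the entries of
  \<open>A\<close>; smoothness of the inverse metric follows from this form.\<close>

lemma matrix_inv_cramer:
  fixes A :: "real^'n^'n"
  assumes "invertible A"
  shows "matrix_inv A $ i $ j = det (\<chi> a b. if b = i then axis j 1 $ a else A $ a $ b) / det A"
proof -
  have "A *v column j (matrix_inv A) = axis j 1"
    using matrix_inv_inverse(1)[OF assms]
    by (simp add: vec_eq_iff matrix_vector_mult_def matrix_matrix_mult_def mat_def column_def axis_def)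
  then show ?thesis
    using cramer[of A "column j (matrix_inv A)" "axis j 1"] assms
    by (simp add: invertible_det_nz column_def vec_eq_iff)
qed

text \<open>Nondegeneracy stands in for positivity, since the coordinate identities below are
  algebraic. It lets the graph metric enter as a second instance as soon as its inverse is written
  down.\<close>

locale smooth_metric =
  fixes S :: "(real^'n::finite) set" and G :: "real^'n \<Rightarrow> real^'n^'n"
  assumes open_S: "open S"
    and smooth_G: "smooth_on S (\<lambda>y. G y $ i $ j)"
    and sym_G: "y \<in> S \<Longrightarrow> G y $ i $ j = G y $ j $ i"
    and inv_G: "y \<in> S \<Longrightarrow> invertible (G y)"
begin

lemma ginv_mult:
  assumes "y \<in> S"
  shows "(\<Sum>m\<in>UNIV. ginv G y i m * G y $ m $ j) = (if i = j then 1 else 0)"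
    and "(\<Sum>m\<in>UNIV. G y $ i $ m * ginv G y m j) = (if i = j then 1 else 0)"
  using matrix_inv_inverse[OF inv_G[OF assms]]
  by (simp_all add: ginv_def vec_eq_iff matrix_matrix_mult_def mat_def)

lemma ginv_sym:
  assumes "y \<in> S"
  shows "ginv G y i j = ginv G y j i"
proof -
  let ?A = "G y" and ?B = "matrix_inv (G y)"
  have "transpose ?A = ?A"
    using sym_G[OF assms] by (simp add: transpose_def vec_eq_iff)
  then have "?A ** transpose ?B = mat 1"
    using matrix_transpose_mul[of ?B ?A] matrix_inv_inverse[OF inv_G[OF assms]]
    by (simp add: transpose_mat)
  then have "transpose ?B = ?B"
    using matrix_inv_inverse[OF inv_G[OF assms]]
    by (metis matrix_mul_assoc matrix_mul_lid matrix_mul_rid)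
  then have "transpose ?B $ i $ j = ?B $ i $ j"
    by simp
  then show ?thesis
    by (simp add: ginv_def transpose_def)
qed

lemma lower_raise:
  assumes "y \<in> S"
  shows "(\<Sum>m\<in>UNIV. G y $ i $ m * (\<Sum>j\<in>UNIV. ginv G y m j * a j)) = a i"
proof -
  have "(\<Sum>m\<in>UNIV. G y $ i $ m * (\<Sum>j\<in>UNIV. ginv G y m j * a j))
      = (\<Sum>j\<in>UNIV. (\<Sum>m\<in>UNIV. G y $ i $ m * ginv G y m j) * a j)"
    unfolding sum_distrib_left sum_distrib_right by (subst sum.swap) (simp add: mult.assoc)
  also have "\<dots> = a i"
    by (simp add: ginv_mult(2)[OF assms] if_distrib[of "\<lambda>t. t * _"] cong: if_cong)
  finally show ?thesis .
qed

lemma raise_lower: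
  assumes "y \<in> S"
  shows "(\<Sum>m\<in>UNIV. ginv G y i m * (\<Sum>j\<in>UNIV. G y $ m $ j * a j)) = a i"
proof -
  have "(\<Sum>m\<in>UNIV. ginv G y i m * (\<Sum>j\<in>UNIV. G y $ m $ j * a j))
      = (\<Sum>j\<in>UNIV. (\<Sum>m\<in>UNIV. ginv G y i m * G y $ m $ j) * a j)"
    unfolding sum_distrib_left sum_distrib_right by (subst sum.swap) (simp add: mult.assoc)
  also have "\<dots> = a i"
    by (simp add: ginv_mult(1)[OF assms] if_distrib[of "\<lambda>t. t * _"] cong: if_cong)
  finally show ?thesis .
qed

lemma smooth_ginv: "smooth_on S (\<lambda>y. ginv G y i j)"
proof (rule smooth_on_cong[OF open_S])
  show "det (\<chi> a b. if b = i then axis j 1 $ a else G y $ a $ b) / det (G y) = ginv G y i j"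
    if "y \<in> S" for y
    using matrix_inv_cramer[OF inv_G[OF that]] by (simp add: ginv_def)
  have "smooth_on S (\<lambda>y. if b = i then axis j 1 $ a else G y $ a $ b)" for a b
    by (cases "b = i") (simp_all add: smooth_G smooth_on_const)
  then show "smooth_on S (\<lambda>y. det (\<chi> a b. if b = i then axis j 1 $ a else G y $ a $ b) / det (G y))"
    unfolding det_def using inv_G
    by (intro smooth_intros open_S)
      (auto simp: smooth_G invertible_det_nz simp flip: det_def)
qed

lemma smooth_christoffel: "smooth_on S (christoffel G l i j)"
  unfolding christoffel_def[abs_def] by (intro smooth_intros open_S smooth_ginv smooth_G)

lemma christoffel_sym:
  assumes "x \<in> S"
  shows "christoffel G l i j x = christoffel G l j i x"
proof -
  have "pd m (\<lambda>y. G y $ i $ j) x = pd m (\<lambda>y. G y $ j $ i) x" for m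
    by (rule pd_cong[OF open_S assms sym_G])
  then show ?thesis by (simp add: christoffel_def add_ac)
qed

lemma christoffel_lower:
  assumes "x \<in> S"
  shows "(\<Sum>m\<in>UNIV. G x $ n $ m * christoffel G m i j x) = 1/2 *
    (pd i (\<lambda>y. G y $ j $ n) x + pd j (\<lambda>y. G y $ i $ n) x - pd n (\<lambda>y. G y $ i $ j) x)"
  unfolding christoffel_def using lower_raise[OF assms]
  by (simp add: mult.left_commute flip: sum_distrib_left sum_divide_distrib)

text \<open>Metric compatibility of the connection: in the sum of the two lowered Christoffel
  symbols all derivatives of the metric except the one in direction \<open>k\<close> cancel.\<close>

lemma pd_metric:
  assumes "x \<in> S"
  shows "pd k (\<lambda>y. G y $ i $ j) x =
    (\<Sum>m\<in>UNIV. G x $ j $ m * christoffel G m k i x) + (\<Sum>m\<in>UNIV. G x $ i $ m * christoffel G m k j x)"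
proof -
  have "pd m (\<lambda>y. G y $ i $ j) x = pd m (\<lambda>y. G y $ j $ i) x" for m i j
    by (rule pd_cong[OF open_S assms sym_G])
  then show ?thesis
    unfolding christoffel_lower[OF assms] by (simp add: algebra_simps)
qed

text \<open>Differentiate the constant product of \<open>G\<close> with its inverse, insert
  \<open>pd_metric\<close>, and solve for the derivative of the inverse by raising the free
  index.\<close>

lemma pd_ginv:
  assumes x: "x \<in> S"
  shows "pd k (\<lambda>y. ginv G y i j) x =
    - (\<Sum>m\<in>UNIV. christoffel G i k m x * ginv G x m j) - (\<Sum>m\<in>UNIV. christoffel G j k m x * ginv G x i m)"
proof -
  let ?\<Gamma> = "\<lambda>l i j. christoffel G l i j x" and ?g = "\<lambda>i j. G x $ i $ j" and ?gi = "\<lambda>i j. ginv G x i j"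
  let ?D = "\<lambda>i j. pd k (\<lambda>y. ginv G y i j) x"
  have gi: "?gi i j = ?gi j i" for i j using ginv_sym[OF x] .
  have eq: "(\<Sum>m\<in>UNIV. ?g n m * ?D m i) = - ?\<Gamma> i k n - (\<Sum>m\<in>UNIV. ?gi i m * (\<Sum>r\<in>UNIV. ?g n r * ?\<Gamma> r k m))" for n
  proof -
    have "pd k (\<lambda>y. \<Sum>m\<in>UNIV. G y $ n $ m * ginv G y m i) x = pd k (\<lambda>y. if n = i then 1 else 0) x"
      using ginv_mult(2) by (intro pd_cong[OF open_S x])
    then have "0 = (\<Sum>m\<in>UNIV. pd k (\<lambda>y. G y $ n $ m) x * ?gi m i + ?g n m * ?D m i)"
      by (simp add: pd_sum_smooth[OF open_S x] pd_mult_smooth[OF open_S x] smooth_intros open_S smooth_G smooth_ginv)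
    then have "(\<Sum>m\<in>UNIV. ?g n m * ?D m i) = - (\<Sum>m\<in>UNIV. ?gi i m * pd k (\<lambda>y. G y $ n $ m) x)"
      by (simp add: sum.distrib gi[of _ i] mult.commute)
    also have "\<dots> = - (\<Sum>m\<in>UNIV. ?gi i m * (\<Sum>r\<in>UNIV. ?g m r * ?\<Gamma> r k n))
        - (\<Sum>m\<in>UNIV. ?gi i m * (\<Sum>r\<in>UNIV. ?g n r * ?\<Gamma> r k m))"
      by (simp add: pd_metric[OF x] distrib_left sum.distrib)
    finally show ?thesis by (simp add: raise_lower[OF x])
  qed
  have "?D j i = (\<Sum>n\<in>UNIV. ?gi j n * (\<Sum>m\<in>UNIV. ?g n m * ?D m i))"
    by (simp add: raise_lower[OF x])
  also have "\<dots> = - (\<Sum>n\<in>UNIV. ?gi j n * ?\<Gamma> i k n)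
      - (\<Sum>n\<in>UNIV. ?gi j n * (\<Sum>m\<in>UNIV. ?gi i m * (\<Sum>r\<in>UNIV. ?g n r * ?\<Gamma> r k m)))"
    by (simp add: eq right_diff_distrib sum_subtractf sum_negf)
  \<comment> \<open>The two contractions are exchanged so that the inverse metric meets the metric
    over \<open>n\<close> and \<open>raise_lower\<close> removes both.\<close>
  also have "(\<Sum>n\<in>UNIV. ?gi j n * (\<Sum>m\<in>UNIV. ?gi i m * (\<Sum>r\<in>UNIV. ?g n r * ?\<Gamma> r k m)))
      = (\<Sum>m\<in>UNIV. ?gi i m * (\<Sum>n\<in>UNIV. ?gi j n * (\<Sum>r\<in>UNIV. ?g n r * ?\<Gamma> r k m)))"
  proof -
    have "(\<Sum>n\<in>UNIV. a n * (\<Sum>m\<in>UNIV. b m * c n m)) = (\<Sum>m\<in>UNIV. b m * (\<Sum>n\<in>UNIV. a n * c n m))"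
      for a b :: "'n \<Rightarrow> real" and c
      unfolding sum_distrib_left by (subst sum.swap) (simp add: mult_ac)
    then show ?thesis .
  qed
  also have "\<dots> = (\<Sum>m\<in>UNIV. ?gi i m * ?\<Gamma> j k m)"
    by (simp add: raise_lower[OF x])
  also have "?D j i = ?D i j"
    by (rule pd_cong[OF open_S x ginv_sym])
  finally show ?thesis
    by (simp add: gi[of _ j] mult.commute)
qed

text \<open>Raising an index commutes with covariant differentiation: of the two terms of
  \<open>pd_ginv\<close>, one cancels the connection term of the vector field and the other becomes
  the connection term of the 1-form.\<close>

lemma cov_derivV_raise:
  assumes x: "x \<in> S" and w: "\<And>j. smooth_on S (\<lambda>y. w y $ j)"
  shows "cov_derivV G (raise G w) i l x = (\<Sum>j\<in>UNIV. ginv G x l j * cov_deriv1 G w i j x)"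
proof -
  let ?\<Gamma> = "\<lambda>l i j. christoffel G l i j x" and ?gi = "\<lambda>i j. ginv G x i j"
  have 1: "(\<Sum>j\<in>UNIV. (\<Sum>m\<in>UNIV. ?\<Gamma> l i m * ?gi m j) * w x $ j)
      = (\<Sum>m\<in>UNIV. ?\<Gamma> l i m * (\<Sum>j\<in>UNIV. ?gi m j * w x $ j))"
    unfolding sum_distrib_left sum_distrib_right by (subst sum.swap) (simp add: mult_ac)
  have 2: "(\<Sum>j\<in>UNIV. (\<Sum>m\<in>UNIV. ?\<Gamma> j i m * ?gi l m) * w x $ j)
      = (\<Sum>j\<in>UNIV. ?gi l j * (\<Sum>m\<in>UNIV. ?\<Gamma> m i j * w x $ m))"
    unfolding sum_distrib_left sum_distrib_right by (subst sum.swap) (simp add: mult_ac)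
  have "pd i (\<lambda>y. raise G w y $ l) x =
      (\<Sum>j\<in>UNIV. pd i (\<lambda>y. ginv G y l j) x * w x $ j) + (\<Sum>j\<in>UNIV. ?gi l j * pd i (\<lambda>y. w y $ j) x)"
    unfolding raise_def
    by (simp add: pd_sum_smooth[OF open_S x] pd_mult_smooth[OF open_S x] smooth_on_mult[OF open_S]
        smooth_ginv w sum.distrib)
  also have "(\<Sum>j\<in>UNIV. pd i (\<lambda>y. ginv G y l j) x * w x $ j) =
      - (\<Sum>m\<in>UNIV. ?\<Gamma> l i m * (\<Sum>j\<in>UNIV. ?gi m j * w x $ j))
      - (\<Sum>j\<in>UNIV. ?gi l j * (\<Sum>m\<in>UNIV. ?\<Gamma> m i j * w x $ m))"
    by (simp add: pd_ginv[OF x] left_diff_distrib sum_subtractf sum_negf 1 2)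
  finally show ?thesis
    by (simp add: cov_derivV_def cov_deriv1_def raise_def right_diff_distrib sum_subtractf)
qed

lemma smooth_raise: "(\<And>j. smooth_on S (\<lambda>y. w y $ j)) \<Longrightarrow> smooth_on S (\<lambda>y. raise G w y $ i)"
  unfolding raise_def by (simp add: smooth_on_sum[OF open_S] smooth_on_mult[OF open_S] smooth_ginv)

lemma div1_eq_divV:
  assumes "x \<in> S" "\<And>j. smooth_on S (\<lambda>y. w y $ j)"
  shows "div1 G w x = divV G (raise G w) x"
  by (simp add: div1_def divV_def cov_derivV_raise[OF assms])

section \<open>Divergence of vector fields, and curvature as a commutator of covariant
  derivatives\<close>

lemma smooth_cov_derivV:
  "(\<And>l. smooth_on S (\<lambda>y. X y $ l)) \<Longrightarrow> smooth_on S (cov_derivV G X i l)"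
  unfolding cov_derivV_def[abs_def] by (intro smooth_intros open_S smooth_christoffel)

lemma smooth_divV: "(\<And>l. smooth_on S (\<lambda>y. X y $ l)) \<Longrightarrow> smooth_on S (divV G X)"
  unfolding divV_def[abs_def] by (intro smooth_intros open_S smooth_cov_derivV)

lemma divV_add:
  assumes "x \<in> S" "\<And>l. smooth_on S (\<lambda>y. X y $ l)" "\<And>l. smooth_on S (\<lambda>y. Y y $ l)"
  shows "divV G (\<lambda>y. X y + Y y) x = divV G X x + divV G Y x"
  by (simp add: divV_def cov_derivV_def pd_add_smooth[OF open_S] assms algebra_simps sum.distrib)

lemma divV_diff:
  assumes "x \<in> S" "\<And>l. smooth_on S (\<lambda>y. X y $ l)" "\<And>l. smooth_on S (\<lambda>y. Y y $ l)"
  shows "divV G (\<lambda>y. X y - Y y) x = divV G X x - divV G Y x"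
  by (simp add: divV_def cov_derivV_def pd_diff_smooth[OF open_S] assms algebra_simps sum.distrib sum_subtractf)

lemma divV_cong:
  assumes "x \<in> S" "\<And>y. y \<in> S \<Longrightarrow> X y = Y y"
  shows "divV G X x = divV G Y x"
  using assms by (simp add: divV_def cov_derivV_def pd_cong[OF open_S assms(1), of "\<lambda>y. X y $ _" "\<lambda>y. Y y $ _"])

lemma divV_scaleR:
  assumes x: "x \<in> S" and "smooth_on S s" "\<And>l. smooth_on S (\<lambda>y. X y $ l)"
  shows "divV G (\<lambda>y. s y *\<^sub>R X y) x = dir_deriv (X x) s x + s x * divV G X x"
  by (simp add: divV_def cov_derivV_def dir_deriv_def pd_mult_smooth[OF open_S] assms algebra_simps
      sum.distrib sum_distrib_left)

text \<open>The Ricci identity. The connection term for the index \<open>j\<close> (and for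
  \<open>i\<close> in the second bracket) is left out on the left: it is symmetric in
  \<open>i\<close> and \<open>j\<close> because the connection is torsion free, so the difference
  does not see it.\<close>

lemma cov_derivV_commute:
  assumes x: "x \<in> S" and X: "\<And>l. smooth_on S (\<lambda>y. X y $ l)"
  shows "(pd i (cov_derivV G X j l) x + (\<Sum>m\<in>UNIV. christoffel G l i m x * cov_derivV G X j m x))
    - (pd j (cov_derivV G X i l) x + (\<Sum>m\<in>UNIV. christoffel G l j m x * cov_derivV G X i m x))
    = (\<Sum>k\<in>UNIV. riemann G l k i j x * X x $ k)"
proof -
  let ?\<Gamma> = "\<lambda>l i j. christoffel G l i j x" and ?X = "\<lambda>l. X x $ l"
  \<comment> \<open>The first term is symmetric in \<open>i\<close> and \<open>j\<close>, and so is
    the sum of the third and the fourth; the second and the fifth antisymmetrize to the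
    curvature.\<close>
  have D: "pd i (cov_derivV G X j l) x + (\<Sum>m\<in>UNIV. ?\<Gamma> l i m * cov_derivV G X j m x)
     = pd i (pd j (\<lambda>y. X y $ l)) x + (\<Sum>m\<in>UNIV. pd i (christoffel G l j m) x * ?X m)
      + (\<Sum>m\<in>UNIV. ?\<Gamma> l j m * pd i (\<lambda>y. X y $ m) x) + (\<Sum>m\<in>UNIV. ?\<Gamma> l i m * pd j (\<lambda>y. X y $ m) x)
      + (\<Sum>k\<in>UNIV. (\<Sum>m\<in>UNIV. ?\<Gamma> l i m * ?\<Gamma> m j k) * ?X k)" for i j
  proof -
    have "(\<Sum>m\<in>UNIV. ?\<Gamma> l i m * (\<Sum>k\<in>UNIV. ?\<Gamma> m j k * ?X k))
       = (\<Sum>k\<in>UNIV. (\<Sum>m\<in>UNIV. ?\<Gamma> l i m * ?\<Gamma> m j k) * ?X k)"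
      unfolding sum_distrib_left sum_distrib_right by (subst sum.swap) (simp add: mult_ac)
    then show ?thesis
      unfolding cov_derivV_def[abs_def]
      by (simp add: pd_add_smooth[OF open_S x] pd_sum_smooth[OF open_S x] pd_mult_smooth[OF open_S x]
          smooth_intros open_S smooth_christoffel X sum.distrib algebra_simps)
  qed
  show ?thesis
    unfolding D riemann_def pd_commute[OF open_S x X, of i j]
    by (simp add: algebra_simps sum.distrib sum_subtractf)
qed

text \<open>Contracting the Ricci identity with \<open>X\<close> gives
  \<open>X^j nabla_i nabla_j X^i - X^j nabla_j nabla_i X^i\<close>. Each half is the divergence of a
  product minus the term where the derivative falls on the other factor, a pointwise integration by
  parts.\<close>

lemma ricci_eq_div:
  assumes x: "x \<in> S" and X: "\<And>l. smooth_on S (\<lambda>y. X y $ l)"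
  shows "(\<Sum>j\<in>UNIV. \<Sum>k\<in>UNIV. ricci G j k x * X x $ j * X x $ k) =
    divV G (\<lambda>y. (\<chi> i. \<Sum>j\<in>UNIV. X y $ j * cov_derivV G X j i y) - divV G X y *\<^sub>R X y) x
    - (\<Sum>i\<in>UNIV. \<Sum>j\<in>UNIV. cov_derivV G X i j x * cov_derivV G X j i x) + (divV G X x)\<^sup>2"
proof -
  let ?\<Gamma> = "\<lambda>l i j. christoffel G l i j x" and ?X = "\<lambda>l. X x $ l" and ?B = "\<lambda>i l. cov_derivV G X i l x"
  let ?dB = "\<lambda>i j l. pd i (cov_derivV G X j l) x"
  have ric: "(\<Sum>k\<in>UNIV. ricci G j k x * ?X k) = (\<Sum>i\<in>UNIV. ?dB i j i)
      + (\<Sum>i\<in>UNIV. \<Sum>m\<in>UNIV. ?\<Gamma> i i m * ?B j m) - (\<Sum>i\<in>UNIV. ?dB j i i)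
      - (\<Sum>i\<in>UNIV. \<Sum>m\<in>UNIV. ?\<Gamma> i j m * ?B i m)" for j
  proof -
    have "(\<Sum>k\<in>UNIV. ricci G j k x * ?X k) = (\<Sum>i\<in>UNIV. \<Sum>k\<in>UNIV. riemann G i k i j x * ?X k)"
      unfolding ricci_def sum_distrib_right by (rule sum.swap)
    then show ?thesis
      by (simp flip: cov_derivV_commute[OF x X] add: sum.distrib sum_subtractf)
  qed
  \<comment> \<open>Matches the connection term created by writing the partial derivative of
    \<open>X\<close> covariantly with the last term of \<open>ric\<close>; this is where torsion
    freeness enters.\<close>
  have sw: "(\<Sum>i\<in>UNIV. \<Sum>j\<in>UNIV. (\<Sum>m\<in>UNIV. ?\<Gamma> j i m * ?X m) * ?B j i)
      = (\<Sum>j\<in>UNIV. ?X j * (\<Sum>i\<in>UNIV. \<Sum>m\<in>UNIV. ?\<Gamma> i j m * ?B i m))"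
  proof -
    have "(\<Sum>i\<in>UNIV. \<Sum>j\<in>UNIV. (\<Sum>m\<in>UNIV. ?\<Gamma> j i m * ?X m) * ?B j i)
      = (\<Sum>i\<in>UNIV. \<Sum>m\<in>UNIV. \<Sum>j\<in>UNIV. ?X m * (?\<Gamma> j m i * ?B j i))"
      unfolding sum_distrib_right by (subst (2) sum.swap) (simp add: christoffel_sym[OF x, of _ _ "_::'n"] mult_ac)
    also have "\<dots> = (\<Sum>m\<in>UNIV. \<Sum>j\<in>UNIV. \<Sum>i\<in>UNIV. ?X m * (?\<Gamma> j m i * ?B j i))"
      by (subst sum.swap) (subst (2) sum.swap, rule refl)
    finally show ?thesis by (simp add: sum_distrib_left)
  qed
  have dX: "pd i (\<lambda>y. X y $ j) x = ?B i j - (\<Sum>m\<in>UNIV. ?\<Gamma> j i m * ?X m)" for i j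
    by (simp add: cov_derivV_def)
  have "divV G (\<lambda>y. \<chi> i. \<Sum>j\<in>UNIV. X y $ j * cov_derivV G X j i y) x
    = (\<Sum>i\<in>UNIV. \<Sum>j\<in>UNIV. ?B i j * ?B j i) - (\<Sum>i\<in>UNIV. \<Sum>j\<in>UNIV. (\<Sum>m\<in>UNIV. ?\<Gamma> j i m * ?X m) * ?B j i)
      + (\<Sum>i\<in>UNIV. \<Sum>j\<in>UNIV. ?X j * ?dB i j i)
      + (\<Sum>i\<in>UNIV. \<Sum>m\<in>UNIV. ?\<Gamma> i i m * (\<Sum>j\<in>UNIV. ?X j * ?B j m))"
    unfolding divV_def cov_derivV_def[of G "\<lambda>y. \<chi> i. _ i y"]
    by (simp add: pd_sum_smooth[OF open_S x] pd_mult_smooth[OF open_S x] smooth_intros open_S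
        smooth_cov_derivV X dX algebra_simps sum.distrib sum_subtractf)
  moreover have "(\<Sum>i\<in>UNIV. \<Sum>j\<in>UNIV. ?X j * ?dB i j i) = (\<Sum>j\<in>UNIV. ?X j * (\<Sum>i\<in>UNIV. ?dB i j i))"
    by (subst sum.swap) (simp add: sum_distrib_left)
  moreover have "(\<Sum>i\<in>UNIV. \<Sum>m\<in>UNIV. ?\<Gamma> i i m * (\<Sum>j\<in>UNIV. ?X j * ?B j m))
      = (\<Sum>j\<in>UNIV. ?X j * (\<Sum>i\<in>UNIV. \<Sum>m\<in>UNIV. ?\<Gamma> i i m * ?B j m))"
  proof -
    have "(\<Sum>i\<in>UNIV. \<Sum>m\<in>UNIV. ?\<Gamma> i i m * (\<Sum>j\<in>UNIV. ?X j * ?B j m))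
      = (\<Sum>i\<in>UNIV. \<Sum>j\<in>UNIV. \<Sum>m\<in>UNIV. ?X j * (?\<Gamma> i i m * ?B j m))"
      unfolding sum_distrib_left by (subst (2) sum.swap) (simp add: mult_ac)
    also have "\<dots> = (\<Sum>j\<in>UNIV. \<Sum>i\<in>UNIV. \<Sum>m\<in>UNIV. ?X j * (?\<Gamma> i i m * ?B j m))"
      by (rule sum.swap)
    finally show ?thesis by (simp add: sum_distrib_left)
  qed
  moreover have "divV G (\<lambda>y. divV G X y *\<^sub>R X y) x
      = (\<Sum>j\<in>UNIV. ?X j * (\<Sum>i\<in>UNIV. ?dB j i i)) + (divV G X x)\<^sup>2"
    unfolding divV_scaleR[OF x smooth_divV[OF X] X] dir_deriv_def
    unfolding divV_def[of G X, abs_def]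
    by (simp add: pd_sum_smooth[OF open_S x smooth_cov_derivV[OF X]] power2_eq_square)
  moreover have "divV G (\<lambda>y. (\<chi> i. \<Sum>j\<in>UNIV. X y $ j * cov_derivV G X j i y) - divV G X y *\<^sub>R X y) x
     = divV G (\<lambda>y. \<chi> i. \<Sum>j\<in>UNIV. X y $ j * cov_derivV G X j i y) x - divV G (\<lambda>y. divV G X y *\<^sub>R X y) x"
    by (rule divV_diff[OF x]) (simp_all add: smooth_intros open_S smooth_cov_derivV smooth_divV X)
  moreover have "(\<Sum>j\<in>UNIV. \<Sum>k\<in>UNIV. ricci G j k x * ?X j * ?X k)
     = (\<Sum>j\<in>UNIV. ?X j * (\<Sum>k\<in>UNIV. ricci G j k x * ?X k))"
    by (simp add: sum_distrib_left mult_ac)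
  ultimately show ?thesis
    unfolding ric sw by (simp add: algebra_simps sum.distrib sum_subtractf)
qed

text \<open>The inverse metric is parallel, so tracing over \<open>j\<close> and \<open>k\<close>
  passes through the covariant derivative: the bracket is \<open>nabla_i C^i_jk\<close> written out,
  for \<open>C\<close> treated as a tensor.\<close>

lemma divV_trace:
  assumes x: "x \<in> S" and C: "\<And>i j k. smooth_on S (C i j k)"
  shows "divV G (\<lambda>y. \<chi> i. \<Sum>j\<in>UNIV. \<Sum>k\<in>UNIV. ginv G y j k * C i j k y) x
    = (\<Sum>j\<in>UNIV. \<Sum>k\<in>UNIV. ginv G x j k * (\<Sum>i\<in>UNIV. pd i (C i j k) x
        + (\<Sum>m\<in>UNIV. christoffel G i i m x * C m j k x)
        - (\<Sum>m\<in>UNIV. christoffel G m i j x * C i m k x)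
        - (\<Sum>m\<in>UNIV. christoffel G m i k x * C i j m x)))"
proof -
  let ?\<Gamma> = "\<lambda>l i j. christoffel G l i j x" and ?gi = "\<lambda>i j. ginv G x i j" and ?C = "\<lambda>i j k. C i j k x"
  have "pd i (\<lambda>y. \<Sum>j\<in>UNIV. \<Sum>k\<in>UNIV. ginv G y j k * C i j k y) x
      + (\<Sum>m\<in>UNIV. ?\<Gamma> i i m * (\<Sum>j\<in>UNIV. \<Sum>k\<in>UNIV. ?gi j k * ?C m j k))
    = (\<Sum>j\<in>UNIV. \<Sum>k\<in>UNIV. ?gi j k * (pd i (C i j k) x + (\<Sum>m\<in>UNIV. ?\<Gamma> i i m * ?C m j k)
        - (\<Sum>m\<in>UNIV. ?\<Gamma> m i j * ?C i m k) - (\<Sum>m\<in>UNIV. ?\<Gamma> m i k * ?C i j m)))" for i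
  proof -
    have 1: "(\<Sum>j\<in>UNIV. \<Sum>k\<in>UNIV. (\<Sum>m\<in>UNIV. ?\<Gamma> j i m * ?gi m k) * ?C i j k)
       = (\<Sum>j\<in>UNIV. \<Sum>k\<in>UNIV. ?gi j k * (\<Sum>m\<in>UNIV. ?\<Gamma> m i j * ?C i m k))"
    proof -
      have "(\<Sum>j\<in>UNIV. \<Sum>k\<in>UNIV. (\<Sum>m\<in>UNIV. ?\<Gamma> j i m * ?gi m k) * ?C i j k)
        = (\<Sum>k\<in>UNIV. \<Sum>j\<in>UNIV. \<Sum>m\<in>UNIV. ?\<Gamma> j i m * ?gi m k * ?C i j k)"
        unfolding sum_distrib_right by (rule sum.swap)
      also have "\<dots> = (\<Sum>k\<in>UNIV. \<Sum>j\<in>UNIV. \<Sum>m\<in>UNIV. ?gi j k * (?\<Gamma> m i j * ?C i m k))"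
        by (subst (2) sum.swap) (simp add: mult_ac)
      also have "\<dots> = (\<Sum>j\<in>UNIV. \<Sum>k\<in>UNIV. \<Sum>m\<in>UNIV. ?gi j k * (?\<Gamma> m i j * ?C i m k))"
        by (rule sum.swap)
      finally show ?thesis by (simp add: sum_distrib_left)
    qed
    have 2: "(\<Sum>j\<in>UNIV. \<Sum>k\<in>UNIV. (\<Sum>m\<in>UNIV. ?\<Gamma> k i m * ?gi j m) * ?C i j k)
       = (\<Sum>j\<in>UNIV. \<Sum>k\<in>UNIV. ?gi j k * (\<Sum>m\<in>UNIV. ?\<Gamma> m i k * ?C i j m))"
      unfolding sum_distrib_right sum_distrib_left by (subst (2) sum.swap) (simp add: mult_ac)
    have 3: "(\<Sum>m\<in>UNIV. ?\<Gamma> i i m * (\<Sum>j\<in>UNIV. \<Sum>k\<in>UNIV. ?gi j k * ?C m j k))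
       = (\<Sum>j\<in>UNIV. \<Sum>k\<in>UNIV. ?gi j k * (\<Sum>m\<in>UNIV. ?\<Gamma> i i m * ?C m j k))"
    proof -
      have "(\<Sum>m\<in>UNIV. ?\<Gamma> i i m * (\<Sum>j\<in>UNIV. \<Sum>k\<in>UNIV. ?gi j k * ?C m j k))
        = (\<Sum>j\<in>UNIV. \<Sum>m\<in>UNIV. \<Sum>k\<in>UNIV. ?gi j k * (?\<Gamma> i i m * ?C m j k))"
        unfolding sum_distrib_left by (subst sum.swap) (simp add: mult_ac)
      also have "\<dots> = (\<Sum>j\<in>UNIV. \<Sum>k\<in>UNIV. \<Sum>m\<in>UNIV. ?gi j k * (?\<Gamma> i i m * ?C m j k))"
        by (subst (2) sum.swap) (rule refl)
      finally show ?thesis by (simp add: sum_distrib_left)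
    qed
    have "pd i (\<lambda>y. \<Sum>j\<in>UNIV. \<Sum>k\<in>UNIV. ginv G y j k * C i j k y) x
      = (\<Sum>j\<in>UNIV. \<Sum>k\<in>UNIV. pd i (\<lambda>y. ginv G y j k) x * ?C i j k + ?gi j k * pd i (C i j k) x)"
      by (simp add: pd_sum_smooth[OF open_S x] pd_mult_smooth[OF open_S x] smooth_intros open_S
        smooth_ginv C)
    then show ?thesis
      by (simp add: pd_ginv[OF x] left_diff_distrib right_diff_distrib distrib_left sum.distrib
          sum_subtractf sum_negf 1 2 3)
  qed
  note eq = this
  show ?thesis
    unfolding divV_def cov_derivV_def
    by (simp add: eq) (subst sum_rotate, simp only: sum_distrib_left)
qed

end

text \<open>The covariant derivatives of \<open>C\<close> and of its trace \<open>l\<close> are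
  those of \<open>H\<close>, so that a later trace with the inverse of \<open>H\<close> commutes
  with them. Expanding around \<open>H\<close> instead of \<open>G\<close> is also what gives the
  quadratic terms the signs opposite to the more common formula.\<close>

lemma ricci_change:
  assumes "smooth_metric S G" "smooth_metric S H" "x \<in> S"
    and C: "\<And>l i j y. C l i j y = christoffel H l i j y - christoffel G l i j y"
    and l: "\<And>k y. l k y = (\<Sum>i\<in>UNIV. C i i k y)"
  shows "ricci H j k x - ricci G j k x =
    (\<Sum>i\<in>UNIV. pd i (C i j k) x + (\<Sum>m\<in>UNIV. christoffel H i i m x * C m j k x)
        - (\<Sum>m\<in>UNIV. christoffel H m i j x * C i m k x)
        - (\<Sum>m\<in>UNIV. christoffel H m i k x * C i j m x))
    - (pd j (l k) x - (\<Sum>m\<in>UNIV. christoffel H m j k x * l m x))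
    - (\<Sum>m\<in>UNIV. l m x * C m j k x) + (\<Sum>i\<in>UNIV. \<Sum>m\<in>UNIV. C i j m x * C m i k x)"
proof -
  interpret G: smooth_metric S G by fact
  interpret H: smooth_metric S H by fact
  note S = G.open_S assms(3)
  let ?\<Gamma> = "\<lambda>l i j. christoffel H l i j x" and ?C = "\<lambda>l i j. C l i j x"
  have Cabs: "C l i j = (\<lambda>y. christoffel H l i j y - christoffel G l i j y)" for l i j
    using C by blast
  have smC: "smooth_on S (C l i j)" for l i j
    unfolding Cabs by (intro smooth_intros G.open_S H.smooth_christoffel G.smooth_christoffel)
  have pdG: "pd a (christoffel G l i j) x = pd a (christoffel H l i j) x - pd a (C l i j) x" for a l i j
    unfolding Cabs by (simp add: pd_diff_smooth[OF S] G.smooth_christoffel H.smooth_christoffel)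
  have G: "christoffel G l i j x = ?\<Gamma> l i j - ?C l i j" for l i j
    by (simp add: C)
  have labs: "l k = (\<lambda>y. \<Sum>i\<in>UNIV. C i i k y)" for k using l by blast
  have pdl: "pd j (l k) x = (\<Sum>i\<in>UNIV. pd j (C i i k) x)"
    unfolding labs by (simp add: pd_sum_smooth[OF S] smC)
  have 1: "(\<Sum>m\<in>UNIV. ?\<Gamma> m j k * l m x) = (\<Sum>i\<in>UNIV. \<Sum>m\<in>UNIV. ?C i i m * ?\<Gamma> m j k)"
    unfolding l sum_distrib_left by (subst sum.swap) (simp add: mult_ac)
  have 2: "(\<Sum>m\<in>UNIV. l m x * ?C m j k) = (\<Sum>i\<in>UNIV. \<Sum>m\<in>UNIV. ?C i i m * ?C m j k)"
    unfolding l sum_distrib_right by (rule sum.swap)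
  \<comment> \<open>The one mixed product whose index pattern differs between the two sides;
    renaming and torsion freeness identify them.\<close>
  have 3: "(\<Sum>i\<in>UNIV. \<Sum>m\<in>UNIV. ?\<Gamma> m i j * ?C i m k) = (\<Sum>i\<in>UNIV. \<Sum>m\<in>UNIV. ?\<Gamma> i j m * ?C m i k)"
    by (subst sum.swap) (simp add: H.christoffel_sym[OF S(2), of _ j])
  show ?thesis
    unfolding ricci_def riemann_def pdG G pdl 1 2
    using 3 by (simp add: algebra_simps sum.distrib sum_subtractf)
qed

text \<open>The trace of \<open>ricci_change\<close>: both derivative terms become divergences for
  \<open>H\<close>, by \<open>divV_trace\<close> and by raising \<open>l\<close>, and merge into the
  divergence of a single field.\<close>

lemma scalar_curvature_change:
  assumes G: "smooth_metric S G" and H: "smooth_metric S H" and x: "x \<in> S"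
    and C: "\<And>l i j y. C l i j y = christoffel H l i j y - christoffel G l i j y"
    and l: "\<And>k y. l y $ k = (\<Sum>i\<in>UNIV. C i i k y)"
  shows "scalar_curvature H x = (\<Sum>j\<in>UNIV. \<Sum>k\<in>UNIV. ginv H x j k * ricci G j k x)
    + divV H (\<lambda>y. (\<chi> i. \<Sum>j\<in>UNIV. \<Sum>k\<in>UNIV. ginv H y j k * C i j k y) - raise H l y) x
    - (\<Sum>j\<in>UNIV. \<Sum>k\<in>UNIV. ginv H x j k * (\<Sum>m\<in>UNIV. l x $ m * C m j k x))
    + (\<Sum>j\<in>UNIV. \<Sum>k\<in>UNIV. ginv H x j k * (\<Sum>i\<in>UNIV. \<Sum>m\<in>UNIV. C i j m x * C m i k x))"
proof -
  interpret G: smooth_metric S G by fact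
  interpret H: smooth_metric S H by fact
  have Cabs: "C l i j = (\<lambda>y. christoffel H l i j y - christoffel G l i j y)" for l i j
    using C by blast
  have smC: "smooth_on S (C l i j)" for l i j
    unfolding Cabs by (intro smooth_intros G.open_S H.smooth_christoffel G.smooth_christoffel)
  have sml: "smooth_on S (\<lambda>y. l y $ k)" for k
    unfolding l by (intro smooth_intros G.open_S smC)
  have "divV H (\<lambda>y. (\<chi> i. \<Sum>j\<in>UNIV. \<Sum>k\<in>UNIV. ginv H y j k * C i j k y) - raise H l y) x
    = divV H (\<lambda>y. \<chi> i. \<Sum>j\<in>UNIV. \<Sum>k\<in>UNIV. ginv H y j k * C i j k y) x - div1 H l x"
    unfolding H.div1_eq_divV[OF x sml]
    by (rule H.divV_diff[OF x]) (simp_all add: H.smooth_raise smooth_intros G.open_S smC sml H.smooth_ginv)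
  moreover have "ricci H j k x = ricci G j k x + (\<Sum>i\<in>UNIV. pd i (C i j k) x + (\<Sum>m\<in>UNIV. christoffel H i i m x * C m j k x)
        - (\<Sum>m\<in>UNIV. christoffel H m i j x * C i m k x)
        - (\<Sum>m\<in>UNIV. christoffel H m i k x * C i j m x))
    - cov_deriv1 H l j k x
    - (\<Sum>m\<in>UNIV. l x $ m * C m j k x) + (\<Sum>i\<in>UNIV. \<Sum>m\<in>UNIV. C i j m x * C m i k x)" for j k
    using ricci_change[OF G H x C l, of j k] by (simp add: cov_deriv1_def)
  ultimately show ?thesis
    unfolding scalar_curvature_def H.divV_trace[OF x smC] div1_def
    by (simp add: distrib_left right_diff_distrib sum.distrib sum_subtractf)
qed

section \<open>The metric of a graph\<close>

context smooth_metric
begin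

lemma pd_pairing:
  assumes x: "x \<in> S" and a: "\<And>m. smooth_on S (\<lambda>y. a y $ m)" and X: "\<And>m. smooth_on S (\<lambda>y. X y $ m)"
  shows "pd i (\<lambda>y. \<Sum>m\<in>UNIV. a y $ m * X y $ m) x =
    (\<Sum>m\<in>UNIV. cov_deriv1 G a i m x * X x $ m) + (\<Sum>m\<in>UNIV. a x $ m * cov_derivV G X i m x)"
proof -
  have "(\<Sum>m\<in>UNIV. (\<Sum>n\<in>UNIV. christoffel G n i m x * a x $ n) * X x $ m)
     = (\<Sum>m\<in>UNIV. a x $ m * (\<Sum>n\<in>UNIV. christoffel G m i n x * X x $ n))"
    unfolding sum_distrib_left sum_distrib_right by (subst sum.swap) (simp add: mult_ac)
  then show ?thesis
    by (simp add: pd_sum_smooth[OF open_S x] pd_mult_smooth[OF open_S x] smooth_on_mult[OF open_S] a X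
        cov_deriv1_def cov_derivV_def left_diff_distrib distrib_left sum.distrib sum_subtractf)
qed

lemma cov_deriv1_insert_vec:
  assumes x: "x \<in> S" and T: "\<And>i j. smooth_on S (\<lambda>y. T y $ i $ j)" and X: "\<And>m. smooth_on S (\<lambda>y. X y $ m)"
  shows "cov_deriv1 G (\<lambda>y. insert_vec (T y) (X y)) i j x =
    (\<Sum>l\<in>UNIV. cov_deriv2 G T i l j x * X x $ l) + (\<Sum>l\<in>UNIV. T x $ l $ j * cov_derivV G X i l x)"
proof -
  have 1: "(\<Sum>l\<in>UNIV. (\<Sum>n\<in>UNIV. christoffel G n i l x * T x $ n $ j) * X x $ l)
     = (\<Sum>l\<in>UNIV. T x $ l $ j * (\<Sum>n\<in>UNIV. christoffel G l i n x * X x $ n))"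
    unfolding sum_distrib_left sum_distrib_right by (subst sum.swap) (simp add: mult_ac)
  have 2: "(\<Sum>l\<in>UNIV. (\<Sum>n\<in>UNIV. christoffel G n i j x * T x $ l $ n) * X x $ l)
     = (\<Sum>n\<in>UNIV. christoffel G n i j x * (\<Sum>l\<in>UNIV. T x $ l $ n * X x $ l))"
    unfolding sum_distrib_left sum_distrib_right by (subst sum.swap) (simp add: mult_ac)
  show ?thesis
    by (simp add: pd_sum_smooth[OF open_S x] pd_mult_smooth[OF open_S x] smooth_on_mult[OF open_S] T X
        insert_vec_def cov_deriv1_def cov_deriv2_def cov_derivV_def left_diff_distrib distrib_left
        sum.distrib sum_subtractf 1 2)
qed

lemma cov_deriv2_metric:
  assumes "x \<in> S"
  shows "cov_deriv2 G G l i j x = 0"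
proof -
  have "(\<Sum>m\<in>UNIV. christoffel G m l i x * G x $ m $ j) = (\<Sum>m\<in>UNIV. G x $ j $ m * christoffel G m l i x)"
    using sym_G[OF assms] by (simp add: mult.commute)
  then show ?thesis
    by (simp add: cov_deriv2_def pd_metric[OF assms] mult.commute)
qed

end

text \<open>Only the contracted Christoffel symbols enter a divergence, so changing the metric adds
  no derivative of \<open>X\<close>.\<close>

lemma divV_change:
  assumes "\<And>k. l k = (\<Sum>i\<in>UNIV. christoffel H i i k x - christoffel G i i k x)"
  shows "divV H X x = divV G X x + (\<Sum>m\<in>UNIV. l m * X x $ m)"
proof -
  have "(\<Sum>m\<in>UNIV. l m * X x $ m) =
    (\<Sum>i\<in>UNIV. \<Sum>m\<in>UNIV. (christoffel H i i m x - christoffel G i i m x) * X x $ m)"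
    unfolding assms sum_distrib_right by (rule sum.swap)
  then show ?thesis
    by (simp add: divV_def cov_derivV_def left_diff_distrib sum.distrib sum_subtractf)
qed

lemma matrix_inv_unique:
  fixes A B :: "real^'n^'n"
  assumes "A ** B = mat 1"
  shows "invertible A" "matrix_inv A = B"
proof -
  show i: "invertible A"
    using assms matrix_left_right_inverse invertible_def by blast
  have "matrix_inv A = matrix_inv A ** (A ** B)"
    by (simp add: assms matrix_mul_rid)
  then show "matrix_inv A = B"
    by (simp add: matrix_mul_assoc matrix_inv_inverse[OF i] matrix_mul_lid)
qed

text \<open>\<open>norm_dF_nonneg\<close> carries the positivity of the metric in the form that is
  needed here: it makes the radicand of the slope at least 1. \<open>Gb\<close> is prescribed on
  \<open>S\<close> only, as components in a chart have arbitrary values outside its image.\<close>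

locale graph_metric_chart = smooth_metric S G
  for S :: "(real^'n::finite) set" and G +
  fixes P F :: "real^'n \<Rightarrow> real" and Gb :: "real^'n \<Rightarrow> real^'n^'n"
  assumes smooth_P: "smooth_on S P" and smooth_F: "smooth_on S F"
    and P_pos: "y \<in> S \<Longrightarrow> P y > 0"
    and norm_dF_nonneg: "y \<in> S \<Longrightarrow> norm1_sq G (differential F) y \<ge> 0"
    and Gb_eq: "y \<in> S \<Longrightarrow> Gb y $ i $ j = G y $ i $ j + (P y)\<^sup>2 * (pd i F y * pd j F y)"
begin

abbreviation "w \<equiv> graph_slope G P F"
abbreviation "v \<equiv> graph_v G P F"
abbreviation "h \<equiv> graph_h G P F"
text \<open>Only the part \<open>h(v, .)\<close>; the form called \<open>q\<close> in the final
  theorem is this one minus \<open>k(v, .)\<close>.\<close>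

abbreviation "q \<equiv> \<lambda>y. insert_vec (h y) (v y)"
abbreviation "pv y \<equiv> dir_deriv (v y) P y"

definition nu :: "real^'n \<Rightarrow> real^'n" where
  "nu y = (P y / w y) *\<^sub>R differential F y"

definition grad_P :: "real^'n \<Rightarrow> real^'n" where
  "grad_P = raise Gb (differential P)"

lemma w_pos: "y \<in> S \<Longrightarrow> w y > 0"
  using norm_dF_nonneg[of y] by (simp add: graph_slope_def add_pos_nonneg)

lemma w_sq: "y \<in> S \<Longrightarrow> (w y)\<^sup>2 = 1 + (P y)\<^sup>2 * norm1_sq G (differential F) y"
  using norm_dF_nonneg[of y] by (simp add: graph_slope_def)

lemma smooth_dF: "smooth_on S (\<lambda>y. differential F y $ i)"
  using smooth_on_pd[OF smooth_F] by (simp add: differential_def)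

lemma smooth_dP: "smooth_on S (\<lambda>y. differential P y $ i)"
  using smooth_on_pd[OF smooth_P] by (simp add: differential_def)

lemma norm1_sq_eq: "norm1_sq G a y = (\<Sum>i\<in>UNIV. a y $ i * raise G a y $ i)"
  by (simp add: norm1_sq_def raise_def sum_distrib_left mult_ac)

lemma smooth_w: "smooth_on S w"
  unfolding graph_slope_def[abs_def] norm1_sq_eq
  by (intro smooth_intros open_S smooth_P smooth_dF smooth_raise)
    (use norm_dF_nonneg in \<open>simp add: norm1_sq_eq add_pos_nonneg\<close>)

lemma w_nz: "y \<in> S \<Longrightarrow> w y \<noteq> 0" and P_nz: "y \<in> S \<Longrightarrow> P y \<noteq> 0"
  using w_pos P_pos by fastforce+

lemma smooth_nu: "smooth_on S (\<lambda>y. nu y $ i)"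
  unfolding nu_def
  by (simp add: smooth_on_mult[OF open_S] smooth_on_divide[OF open_S] smooth_P smooth_w w_nz smooth_dF)

lemma nu_nth: "nu y $ i = P y / w y * pd i F y"
  by (simp add: nu_def differential_def)

lemma v_nth: "v y $ i = (\<Sum>j\<in>UNIV. ginv G y i j * nu y $ j)"
  by (simp add: graph_v_def gradient_def nu_nth sum_distrib_left mult_ac)

lemma v_eq_raise: "v = raise G nu"
  by (simp add: fun_eq_iff vec_eq_iff raise_def v_nth)

lemma smooth_v: "smooth_on S (\<lambda>y. v y $ i)"
  unfolding v_eq_raise by (rule smooth_raise[OF smooth_nu])

text \<open>The left side is \<open>|v|^2\<close> for \<open>G\<close>. The value follows from the
  definition of \<open>w\<close> and supplies every factor \<open>1 - 1/w^2\<close> below.\<close>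

lemma nu_v: "y \<in> S \<Longrightarrow> (\<Sum>i\<in>UNIV. nu y $ i * v y $ i) = 1 - 1 / (w y)\<^sup>2"
proof -
  assume y: "y \<in> S"
  have "(\<Sum>i\<in>UNIV. nu y $ i * v y $ i) = (P y / w y)\<^sup>2 * norm1_sq G (differential F) y"
    by (simp add: graph_v_def gradient_def nu_nth norm1_sq_eq raise_def differential_def
        sum_distrib_left power2_eq_square mult_ac)
  moreover have "(P y)\<^sup>2 * norm1_sq G (differential F) y = (w y)\<^sup>2 - 1"
    using w_sq[OF y] by simp
  ultimately show ?thesis
    using w_nz[OF y] by (simp add: power_divide diff_divide_distrib)
qed

lemma lower_v: "y \<in> S \<Longrightarrow> (\<Sum>m\<in>UNIV. G y $ i $ m * v y $ m) = nu y $ i"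
  unfolding v_nth by (rule lower_raise)

lemma Gb_eq_nu: "y \<in> S \<Longrightarrow> Gb y $ i $ j = G y $ i $ j + (w y)\<^sup>2 * (nu y $ i * nu y $ j)"
  by (simp add: Gb_eq nu_nth power2_eq_square w_nz)

text \<open>The Sherman-Morrison formula for the rank one change \<open>w^2 nu nu\<close>. Its
  coefficient \<open>w^2 / (1 + w^2 |nu|^2)\<close> equals 1, because
  \<open>w^2 |nu|^2 = w^2 - 1\<close> by \<open>nu_v\<close>.\<close>

lemma Gb_inverse:
  assumes y: "y \<in> S"
  shows "invertible (Gb y)" "ginv Gb y i j = ginv G y i j - v y $ i * v y $ j"
proof -
  let ?B = "\<chi> i j. ginv G y i j - v y $ i * v y $ j"
  have "Gb y ** ?B = mat 1"
  proof -
    have "(\<Sum>m\<in>UNIV. Gb y $ i $ m * (ginv G y m j - v y $ m * v y $ j)) = (if i = j then 1 else 0)" for i j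
    proof -
      have "(\<Sum>m\<in>UNIV. Gb y $ i $ m * (ginv G y m j - v y $ m * v y $ j)) =
        (\<Sum>m\<in>UNIV. G y $ i $ m * ginv G y m j) - v y $ j * (\<Sum>m\<in>UNIV. G y $ i $ m * v y $ m)
        + (w y)\<^sup>2 * nu y $ i * (\<Sum>m\<in>UNIV. ginv G y j m * nu y $ m)
        - (w y)\<^sup>2 * nu y $ i * v y $ j * (\<Sum>m\<in>UNIV. nu y $ m * v y $ m)"
        unfolding Gb_eq_nu[OF y] ginv_sym[OF y, of j]
        by (simp add: algebra_simps sum.distrib sum_subtractf sum_distrib_left)
      then show ?thesis
        unfolding lower_v[OF y] nu_v[OF y] ginv_mult(2)[OF y] v_nth[symmetric]
        using w_nz[OF y] by (simp add: field_simps)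
    qed
    then show ?thesis by (simp add: vec_eq_iff matrix_matrix_mult_def mat_def)
  qed
  from matrix_inv_unique[OF this] show "invertible (Gb y)" "ginv Gb y i j = ginv G y i j - v y $ i * v y $ j"
    by (simp_all add: ginv_def)
qed

sublocale bar: smooth_metric S Gb
proof
  show "smooth_on S (\<lambda>y. Gb y $ i $ j)" for i j
    by (rule smooth_on_cong[OF open_S Gb_eq[symmetric]])
      (auto intro!: smooth_intros open_S smooth_G smooth_P smooth_F)
qed (use Gb_inverse in \<open>auto simp: Gb_eq sym_G open_S\<close>)

section \<open>Raising indices with the graph metric\<close>

lemma raise_bar_eq:
  assumes "y \<in> S"
  shows "(\<Sum>m\<in>UNIV. ginv Gb y i m * a m) = (\<Sum>m\<in>UNIV. ginv G y i m * a m) - v y $ i * (\<Sum>m\<in>UNIV. v y $ m * a m)"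
  by (simp add: Gb_inverse[OF assms] algebra_simps sum_subtractf sum_distrib_left)

lemma raise_bar_nu:
  assumes "y \<in> S"
  shows "(\<Sum>m\<in>UNIV. ginv Gb y i m * nu y $ m) = v y $ i / (w y)\<^sup>2"
proof -
  have "(\<Sum>m\<in>UNIV. v y $ m * nu y $ m) = 1 - 1 / (w y)\<^sup>2"
    using nu_v[OF assms] by (simp add: mult.commute)
  then show ?thesis
    unfolding raise_bar_eq[OF assms] v_nth[symmetric] by (simp add: right_diff_distrib)
qed

text \<open>The transpose of \<open>raise_bar_nu\<close>: the inner product of \<open>nu\<close>
  with a 1-form for the graph metric is the value of that form on \<open>v\<close>, divided by
  \<open>w^2\<close>.\<close>

lemma pairing_raise_bar_nu:
  assumes "y \<in> S"
  shows "(\<Sum>i\<in>UNIV. nu y $ i * (\<Sum>m\<in>UNIV. ginv Gb y i m * a m)) = (\<Sum>m\<in>UNIV. v y $ m * a m) / (w y)\<^sup>2"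
proof -
  have "(\<Sum>i\<in>UNIV. nu y $ i * (\<Sum>m\<in>UNIV. ginv Gb y i m * a m))
      = (\<Sum>m\<in>UNIV. (\<Sum>i\<in>UNIV. ginv Gb y m i * nu y $ i) * a m)"
    unfolding sum_distrib_left sum_distrib_right
    by (subst sum.swap) (simp add: bar.ginv_sym[OF assms] mult_ac)
  then show ?thesis
    by (simp add: raise_bar_nu[OF assms] sum_divide_distrib)
qed

lemma grad_P_nth: "grad_P y $ l = (\<Sum>m\<in>UNIV. ginv Gb y l m * pd m P y)"
  by (simp add: grad_P_def raise_def differential_def)

lemma nu_grad_P: "y \<in> S \<Longrightarrow> (\<Sum>i\<in>UNIV. nu y $ i * grad_P y $ i) = pv y / (w y)\<^sup>2"
  by (simp add: grad_P_nth pairing_raise_bar_nu dir_deriv_def)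

section \<open>The connection of the graph metric and the covariant derivative of
  \<open>v\<close>\<close>

lemma smooth_hessian: "smooth_on S (\<lambda>y. hessian G F y $ i $ j)"
  unfolding hessian_def
  by simp (intro smooth_intros open_S smooth_F smooth_christoffel)

lemma smooth_h: "smooth_on S (\<lambda>y. h y $ i $ j)"
  unfolding graph_h_def
  by simp (intro smooth_intros open_S smooth_F smooth_P smooth_w smooth_hessian w_nz)

lemma smooth_insert_vec:
  "(\<And>i j. smooth_on S (\<lambda>y. T y $ i $ j)) \<Longrightarrow> smooth_on S (\<lambda>y. insert_vec (T y) (v y) $ i)"
  unfolding insert_vec_def by simp (intro smooth_intros open_S smooth_v)

lemma hessian_sym: "y \<in> S \<Longrightarrow> hessian G F y $ i $ j = hessian G F y $ j $ i"
  by (simp add: hessian_def pd_commute[OF open_S _ smooth_F, of _ i j] christoffel_sym[of _ _ i j])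

lemma h_sym: "y \<in> S \<Longrightarrow> h y $ i $ j = h y $ j $ i"
  by (simp add: graph_h_def hessian_sym[of _ i j] algebra_simps)

text \<open>Differentiating \<open>P^2 df df\<close> leaves a symmetric part along \<open>df\<close>
  and the part \<open>- P df df dP\<close>. Raised with the graph metric, \<open>df\<close> becomes
  \<open>v / (P w)\<close> and \<open>dP\<close> becomes \<open>grad_P\<close>. The \<open>G\<close>
  part, raised with the same inverse, yields an extra \<open>- v nu(Gamma)\<close>, which completes
  the second partial derivatives of \<open>F\<close> to the Hessian inside \<open>h\<close>.\<close>

lemma christoffel_bar:
  assumes x: "x \<in> S"
  shows "christoffel Gb l i j x = christoffel G l i j x + v x $ l * h x $ i $ j
    - (w x)\<^sup>2 / P x * grad_P x $ l * (nu x $ i * nu x $ j)"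
proof -
  let ?c = "\<lambda>m. pd i (\<lambda>y. G y $ j $ m) x + pd j (\<lambda>y. G y $ i $ m) x - pd m (\<lambda>y. G y $ i $ j) x"
  let ?f = "\<lambda>i. pd i F x" and ?p = "\<lambda>i. pd i P x" and ?P = "P x" and ?w = "w x"
  have pdGb: "pd a (\<lambda>y. Gb y $ b $ c) x = pd a (\<lambda>y. G y $ b $ c) x
      + 2 * ?P * ?p a * ?f b * ?f c + ?P\<^sup>2 * (pd a (pd b F) x * ?f c + ?f b * pd a (pd c F) x)" for a b c
  proof -
    have "pd a (\<lambda>y. Gb y $ b $ c) x = pd a (\<lambda>y. G y $ b $ c + (P y * P y) * (pd b F y * pd c F y)) x"
      by (rule pd_cong[OF open_S x]) (simp add: Gb_eq power2_eq_square)
    also have "\<dots> = pd a (\<lambda>y. G y $ b $ c) x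
      + 2 * ?P * ?p a * ?f b * ?f c + ?P\<^sup>2 * (pd a (pd b F) x * ?f c + ?f b * pd a (pd c F) x)"
      by (simp add: pd_add_smooth[OF open_S x] pd_mult_smooth[OF open_S x] smooth_on_mult[OF open_S]
          smooth_G smooth_P smooth_on_pd[OF smooth_F] power2_eq_square algebra_simps)
    finally show ?thesis .
  qed
  have d: "pd i (\<lambda>y. Gb y $ j $ m) x + pd j (\<lambda>y. Gb y $ i $ m) x - pd m (\<lambda>y. Gb y $ i $ j) x
    = ?c m + 2 * (?P * ?p i * ?f j + ?P * ?p j * ?f i + ?P\<^sup>2 * pd i (pd j F) x) * ?f m
      - 2 * ?P * ?f i * ?f j * ?p m" for m
    unfolding pdGb pd_commute[OF open_S x smooth_F, of m] pd_commute[OF open_S x smooth_F, of j i]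
    by (simp add: algebra_simps)
  have f: "(\<Sum>m\<in>UNIV. ginv Gb x l m * ?f m) = v x $ l / (?P * ?w)"
  proof -
    have "?f m = ?w / ?P * nu x $ m" for m
      using w_nz[OF x] P_nz[OF x] by (simp add: nu_nth)
    then have "(\<Sum>m\<in>UNIV. ginv Gb x l m * ?f m) = ?w / ?P * (\<Sum>m\<in>UNIV. ginv Gb x l m * nu x $ m)"
      by (simp add: sum_distrib_left mult_ac)
    then show ?thesis
      using w_nz[OF x] P_nz[OF x] by (simp add: raise_bar_nu[OF x] power2_eq_square)
  qed
  have c: "(\<Sum>m\<in>UNIV. v x $ m * ?c m) = 2 * (\<Sum>n\<in>UNIV. nu x $ n * christoffel G n i j x)"
  proof -
    have "(\<Sum>m\<in>UNIV. v x $ m * ?c m) = 2 * (\<Sum>m\<in>UNIV. v x $ m * (\<Sum>n\<in>UNIV. G x $ m $ n * christoffel G n i j x))"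
      unfolding christoffel_lower[OF x] by (simp add: sum_distrib_left)
    also have "(\<Sum>m\<in>UNIV. v x $ m * (\<Sum>n\<in>UNIV. G x $ m $ n * christoffel G n i j x))
      = (\<Sum>n\<in>UNIV. (\<Sum>m\<in>UNIV. G x $ n $ m * v x $ m) * christoffel G n i j x)"
      unfolding sum_distrib_left sum_distrib_right
      by (subst sum.swap) (simp add: sym_G[OF x] mult_ac)
    finally show ?thesis by (simp add: lower_v[OF x])
  qed
  have "christoffel Gb l i j x = 1/2 * (\<Sum>m\<in>UNIV. ginv Gb x l m * ?c m)
     + (?P * ?p i * ?f j + ?P * ?p j * ?f i + ?P\<^sup>2 * pd i (pd j F) x) * (\<Sum>m\<in>UNIV. ginv Gb x l m * ?f m)
     - ?P * ?f i * ?f j * (\<Sum>m\<in>UNIV. ginv Gb x l m * ?p m)"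
    unfolding christoffel_def[of Gb] d
    by (simp add: algebra_simps sum.distrib sum_subtractf sum_distrib_left)
  also have "1/2 * (\<Sum>m\<in>UNIV. ginv Gb x l m * ?c m)
     = christoffel G l i j x - v x $ l * (\<Sum>n\<in>UNIV. nu x $ n * christoffel G n i j x)"
    unfolding raise_bar_eq[OF x] c christoffel_def[of G l] by (simp add: algebra_simps)
  also have "(\<Sum>n\<in>UNIV. nu x $ n * christoffel G n i j x) = ?P / ?w * (\<Sum>n\<in>UNIV. christoffel G n i j x * ?f n)"
    by (simp add: nu_nth sum_distrib_left mult_ac)
  finally have eq: "christoffel Gb l i j x = christoffel G l i j x
      - v x $ l * (?P / ?w * (\<Sum>n\<in>UNIV. christoffel G n i j x * ?f n))
      + (?P * ?p i * ?f j + ?P * ?p j * ?f i + ?P\<^sup>2 * pd i (pd j F) x) * (v x $ l / (?P * ?w))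
      - ?P * ?f i * ?f j * grad_P x $ l"
    by (simp only: f grad_P_nth)
  show ?thesis
    unfolding eq graph_h_def hessian_def nu_nth
    using w_nz[OF x] P_nz[OF x] by (simp add: field_simps power2_eq_square)
qed

lemma q_nth: "q y $ j = (\<Sum>i\<in>UNIV. h y $ i $ j * v y $ i)"
  by (simp add: insert_vec_def)

text \<open>Differentiating \<open>w nu = P dF\<close> produces \<open>h\<close> except for its
  summand \<open>f_i p_j / w\<close>, which equals \<open>nu_i p_j / P\<close> and accounts for the
  asymmetry. The derivative of \<open>w\<close> contributes \<open>nu_j\<close> times
  \<open>d log w\<close>, which is \<open>q - (pv / P) nu\<close>.\<close>

lemma cov_deriv1_nu:
  assumes x: "x \<in> S"
  shows "cov_deriv1 G nu i j x = h x $ i $ j - nu x $ j * q x $ i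
    - nu x $ i * (pd j P x - nu x $ j * pv x) / P x"
proof -
  let ?f = "\<lambda>i. pd i F x" and ?p = "\<lambda>i. pd i P x" and ?P = "P x" and ?w = "w x"
  let ?H = "\<lambda>i j. hessian G F x $ i $ j" and ?fu = "\<lambda>m. raise G (differential F) x $ m"
  let ?E = "norm1_sq G (differential F) x"
  define e where "e = (\<Sum>m\<in>UNIV. ?H i m * ?fu m)"
  have cov: "cov_deriv1 G (differential F) i m x = ?H i m" for m
    by (simp add: cov_deriv1_def differential_def hessian_def)
  have dE: "pd i (norm1_sq G (differential F)) x = 2 * e"
  proof -
    have "norm1_sq G (differential F) = (\<lambda>y. \<Sum>m\<in>UNIV. differential F y $ m * raise G (differential F) y $ m)"
      by (simp add: fun_eq_iff norm1_sq_eq)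
    then have "pd i (norm1_sq G (differential F)) x = pd i \<dots> x"
      by simp
    also have "\<dots> = e + (\<Sum>m\<in>UNIV. ?f m * (\<Sum>j\<in>UNIV. ginv G x m j * ?H i j))"
      unfolding pd_pairing[OF x smooth_dF smooth_raise[OF smooth_dF]] cov_derivV_raise[OF x smooth_dF] cov
      by (simp add: e_def differential_def)
    also have "(\<Sum>m\<in>UNIV. ?f m * (\<Sum>j\<in>UNIV. ginv G x m j * ?H i j)) = e"
      unfolding e_def raise_def sum_distrib_left
      by (subst sum.swap) (simp add: sum_distrib_left differential_def ginv_sym[OF x] mult_ac)
    finally show ?thesis by simp
  qed
  have smE: "smooth_on S (norm1_sq G (differential F))"
    unfolding norm1_sq_eq[abs_def] by (intro smooth_intros open_S smooth_dF smooth_raise)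
  \<comment> \<open>Obtained by differentiating \<open>w^2\<close>, which avoids the derivative of
    the square root.\<close>
  have dw: "?w * pd i w x = ?P * ?p i * ?E + ?P\<^sup>2 * e"
  proof -
    have "pd i (\<lambda>y. w y * w y) x = pd i (\<lambda>y. 1 + P y * P y * norm1_sq G (differential F) y) x"
      using w_sq by (intro pd_cong[OF open_S x]) (simp add: power2_eq_square)
    then have "2 * (?w * pd i w x) = 2 * (?P * ?p i * ?E + ?P\<^sup>2 * e)"
      by (simp add: pd_add_smooth[OF open_S x] pd_mult_smooth[OF open_S x] smooth_on_mult[OF open_S]
          smooth_on_const smooth_w smooth_P smE dE power2_eq_square algebra_simps)
    then show ?thesis by simp
  qed
  have dnu: "?w * pd i (\<lambda>y. nu y $ j) x + pd i w x * nu x $ j = ?p i * ?f j + ?P * pd i (pd j F) x"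
  proof -
    have "pd i (\<lambda>y. w y * nu y $ j) x = pd i (\<lambda>y. P y * pd j F y) x"
      using w_nz by (intro pd_cong[OF open_S x]) (simp add: nu_nth)
    then show ?thesis
      by (simp add: pd_mult_smooth[OF open_S x] smooth_w smooth_nu smooth_P smooth_on_pd[OF smooth_F])
  qed
  have vfu: "v x $ m = ?P / ?w * ?fu m" for m
    by (simp add: graph_v_def gradient_def raise_def differential_def)
  have pv: "pv x = ?P / ?w * (\<Sum>m\<in>UNIV. ?p m * ?fu m)"
    by (simp add: dir_deriv_def vfu sum_distrib_left mult_ac)
  have qi: "q x $ i = ?P / ?w\<^sup>2 * (?P * e + ?f i * (\<Sum>m\<in>UNIV. ?p m * ?fu m) + ?p i * ?E)"
  proof -
    have "h x $ i $ m * (?P / ?w * ?fu m)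
        = ?P / ?w\<^sup>2 * (?P * (?H i m * ?fu m) + ?f i * (?p m * ?fu m) + ?p i * (?f m * ?fu m))" for m
      by (simp add: graph_h_def power2_eq_square algebra_simps add_divide_distrib)
    then show ?thesis
      unfolding q_nth h_sym[OF x, of _ i] vfu e_def norm1_sq_eq
      by (simp add: sum.distrib differential_def flip: sum_distrib_left sum_divide_distrib)
  qed
  have G: "(\<Sum>m\<in>UNIV. christoffel G m i j x * nu x $ m) = ?P / ?w * (\<Sum>m\<in>UNIV. christoffel G m i j x * ?f m)"
    unfolding nu_nth sum_distrib_left by (simp add: mult_ac)
  have div: "a = b / c" if "c * a = b" "c \<noteq> 0" for a b c :: real
    using that by auto
  have dw': "pd i w x = (?P * ?p i * ?E + ?P\<^sup>2 * e) / ?w"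
    by (rule div[OF dw w_nz[OF x]])
  have "?w * pd i (\<lambda>y. nu y $ j) x = ?p i * ?f j + ?P * pd i (pd j F) x
      - (?P * ?p i * ?E + ?P\<^sup>2 * e) / ?w * nu x $ j"
    using dnu unfolding dw' by (simp only: eq_diff_eq)
  then have dn: "pd i (\<lambda>y. nu y $ j) x = (?p i * ?f j + ?P * pd i (pd j F) x
      - (?P * ?p i * ?E + ?P\<^sup>2 * e) / ?w * nu x $ j) / ?w"
    by (rule div[OF _ w_nz[OF x]])
  have "cov_deriv1 G nu i j x = (?p i * ?f j + ?P * pd i (pd j F) x
      - (?P * ?p i * ?E + ?P\<^sup>2 * e) / ?w * (?P / ?w * ?f j)) / ?w
      - ?P / ?w * (\<Sum>m\<in>UNIV. christoffel G m i j x * ?f m)"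
    unfolding cov_deriv1_def G dn unfolding nu_nth ..
  also have "\<dots> = (?P * ?H i j + ?f i * ?p j + ?p i * ?f j) / ?w
      - ?P / ?w * ?f j * (?P / ?w\<^sup>2 * (?P * e + ?f i * (\<Sum>m\<in>UNIV. ?p m * ?fu m) + ?p i * ?E))
      - ?P / ?w * ?f i * (?p j - ?P / ?w * ?f j * (?P / ?w * (\<Sum>m\<in>UNIV. ?p m * ?fu m))) / ?P"
  \<comment> \<open>An identity in independent reals: \<open>w\<close> occurs only through its
    inverse, which the simplifier treats as an atom, so \<open>P\<close> is the only factor to be
    cancelled.\<close>
  proof -
    have "(pi * fj + P * H - (P * pi * E + P\<^sup>2 * e) / w * (P / w * fj)) / w - P / w * c
      = (P * (H - c) + fi * pj + pi * fj) / w - P / w * fj * (P / w\<^sup>2 * (P * e + fi * D + pi * E))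
        - P / w * fi * (pj - P / w * fj * (P / w * D)) / P"
      if "P \<noteq> 0" for pi pj fi fj P H E e w c D :: real
    proof -
      have c: "P / w * fi * X / P = fi / w * X" for X
        using that by simp
      show ?thesis
        unfolding c by (simp add: divide_inverse power2_eq_square algebra_simps)
    qed
    from this[OF P_nz[OF x]] show ?thesis
      by (simp add: hessian_def)
  qed
  finally show ?thesis
    unfolding qi pv nu_nth by (simp add: graph_h_def)
qed

text \<open>Raise the index in \<open>cov_deriv1_nu\<close>. The terms with \<open>q\<close> and
  \<open>pv\<close> are multiples of \<open>v\<close>, exactly the corrections that turn raising
  with \<open>G\<close> into raising with the graph metric.\<close>

lemma cov_derivV_v:
  assumes x: "x \<in> S"
  shows "cov_derivV G v i l x = (\<Sum>m\<in>UNIV. ginv Gb x l m * h x $ i $ m) - nu x $ i * grad_P x $ l / P x"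
proof -
  have "cov_derivV G v i l x = (\<Sum>m\<in>UNIV. ginv G x l m * cov_deriv1 G nu i m x)"
    unfolding v_eq_raise by (rule cov_derivV_raise[OF x smooth_nu])
  also have "\<dots> = (\<Sum>m\<in>UNIV. ginv G x l m * h x $ i $ m) - q x $ i * (\<Sum>m\<in>UNIV. ginv G x l m * nu x $ m)
     - nu x $ i / P x * (\<Sum>m\<in>UNIV. ginv G x l m * pd m P x)
     + nu x $ i / P x * pv x * (\<Sum>m\<in>UNIV. ginv G x l m * nu x $ m)"
    unfolding cov_deriv1_nu[OF x]
    by (simp add: algebra_simps diff_divide_distrib add_divide_distrib sum.distrib sum_subtractf
        sum_distrib_left sum_divide_distrib)
  finally show ?thesis
    unfolding grad_P_nth raise_bar_eq[OF x] v_nth[symmetric] q_nth dir_deriv_def h_sym[OF x, of _ i]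
    by (simp add: algebra_simps diff_divide_distrib)
qed

end

section \<open>The scalar curvature of a graph\<close>

context smooth_metric
begin

text \<open>For symmetric \<open>T\<close> the squared norm is the trace of the square of the
  endomorphism with one index raised, the form in which the square of the derivative of
  \<open>v\<close> produces it.\<close>

lemma norm2_sq_mixed:
  assumes x: "x \<in> S" and T: "\<And>i j. T x $ i $ j = T x $ j $ i"
  shows "norm2_sq G T x = (\<Sum>i\<in>UNIV. \<Sum>j\<in>UNIV.
    (\<Sum>m\<in>UNIV. ginv G x j m * T x $ i $ m) * (\<Sum>m\<in>UNIV. ginv G x i m * T x $ j $ m))"
proof -
  have "(\<Sum>i\<in>UNIV. \<Sum>j\<in>UNIV. (\<Sum>m\<in>UNIV. ginv G x j m * T x $ i $ m) * (\<Sum>m\<in>UNIV. ginv G x i m * T x $ j $ m))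
    = (\<Sum>i\<in>UNIV. \<Sum>j\<in>UNIV. \<Sum>m\<in>UNIV. \<Sum>n\<in>UNIV. ginv G x i n * ginv G x m j * T x $ i $ m * T x $ n $ j)"
    unfolding sum_product by (simp add: ginv_sym[OF x] T mult_ac)
  also have "\<dots> = norm2_sq G T x"
    unfolding norm2_sq_def by (rule sum.cong[OF refl sum_rotate])
  finally show ?thesis ..
qed

end

context graph_metric_chart
begin

text \<open>This is \<open>d log w\<close>, the logarithmic derivative of the quotient of the volume
  densities, written through \<open>q\<close> and \<open>nu\<close> because these are the quantities
  to be contracted with it.\<close>

definition lam :: "real^'n \<Rightarrow> real^'n" where
  "lam y = q y - (pv y / P y) *\<^sub>R nu y"

lemma smooth_q: "smooth_on S (\<lambda>y. q y $ i)"
  by (rule smooth_insert_vec[OF smooth_h])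

lemma smooth_trace_bar:
  "(\<And>i j. smooth_on S (\<lambda>y. T y $ i $ j)) \<Longrightarrow> smooth_on S (trace2 Gb T)"
  unfolding trace2_def[abs_def] by (intro smooth_intros open_S bar.smooth_ginv)

lemma christoffel_bar_trace:
  assumes x: "x \<in> S"
  shows "(\<Sum>i\<in>UNIV. christoffel Gb i i k x - christoffel G i i k x) = lam x $ k"
proof -
  have "(\<Sum>i\<in>UNIV. christoffel Gb i i k x - christoffel G i i k x)
     = (\<Sum>i\<in>UNIV. h x $ i $ k * v x $ i) - (w x)\<^sup>2 / P x * nu x $ k * (\<Sum>i\<in>UNIV. nu x $ i * grad_P x $ i)"
    unfolding christoffel_bar[OF x] sum_distrib_left by (simp add: sum_subtractf mult_ac)
  then show ?thesis
    using w_nz[OF x] by (simp add: nu_grad_P[OF x] lam_def insert_vec_def)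
qed

lemma bar_contract_nu:
  assumes "y \<in> S"
  shows "(\<Sum>j\<in>UNIV. \<Sum>k\<in>UNIV. ginv Gb y j k * (a j * nu y $ k)) = (\<Sum>j\<in>UNIV. a j * v y $ j) / (w y)\<^sup>2"
    and "(\<Sum>j\<in>UNIV. \<Sum>k\<in>UNIV. ginv Gb y j k * (nu y $ j * a k)) = (\<Sum>j\<in>UNIV. a j * v y $ j) / (w y)\<^sup>2"
proof -
  have "(\<Sum>j\<in>UNIV. \<Sum>k\<in>UNIV. ginv Gb y j k * (a j * nu y $ k))
      = (\<Sum>j\<in>UNIV. a j * (\<Sum>k\<in>UNIV. ginv Gb y j k * nu y $ k))"
    by (simp add: sum_distrib_left mult_ac)
  then show 1: "(\<Sum>j\<in>UNIV. \<Sum>k\<in>UNIV. ginv Gb y j k * (a j * nu y $ k)) = (\<Sum>j\<in>UNIV. a j * v y $ j) / (w y)\<^sup>2"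
    by (simp add: raise_bar_nu[OF assms] sum_divide_distrib)
  show "(\<Sum>j\<in>UNIV. \<Sum>k\<in>UNIV. ginv Gb y j k * (nu y $ j * a k)) = (\<Sum>j\<in>UNIV. a j * v y $ j) / (w y)\<^sup>2"
    unfolding 1[symmetric] by (subst sum.swap) (simp add: bar.ginv_sym[OF assms] mult_ac)
qed

lemma bar_trace_difference:
  assumes y: "y \<in> S"
  shows "(\<Sum>j\<in>UNIV. \<Sum>k\<in>UNIV. ginv Gb y j k * (christoffel Gb i j k y - christoffel G i j k y))
    = trace2 Gb h y * v y $ i - (1 - 1 / (w y)\<^sup>2) / P y * grad_P y $ i"
proof -
  have "(\<Sum>j\<in>UNIV. \<Sum>k\<in>UNIV. ginv Gb y j k * (christoffel Gb i j k y - christoffel G i j k y))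
    = trace2 Gb h y * v y $ i
      - (w y)\<^sup>2 / P y * grad_P y $ i * (\<Sum>j\<in>UNIV. \<Sum>k\<in>UNIV. ginv Gb y j k * (nu y $ j * nu y $ k))"
    unfolding christoffel_bar[OF y] trace2_def sum_distrib_left sum_distrib_right
    by (simp add: algebra_simps sum_subtractf)
  then show ?thesis
    unfolding bar_contract_nu[OF y] nu_v[OF y] using w_nz[OF y] by simp
qed

lemma raise_bar_lam:
  assumes y: "y \<in> S"
  shows "raise Gb lam y = raise Gb q y - (pv y / (P y * (w y)\<^sup>2)) *\<^sub>R v y"
proof -
  have "(\<Sum>m\<in>UNIV. ginv Gb y i m * lam y $ m)
    = (\<Sum>m\<in>UNIV. ginv Gb y i m * q y $ m) - pv y / P y * (\<Sum>m\<in>UNIV. ginv Gb y i m * nu y $ m)" for i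
    unfolding lam_def sum_distrib_left by (simp add: right_diff_distrib sum_subtractf mult_ac)
  then show ?thesis
    by (simp add: vec_eq_iff raise_def raise_bar_nu[OF y])
qed

text \<open>The coefficient of \<open>grad_P\<close> agrees with the one in
  \<open>bar_trace_difference\<close>. This agreement removes \<open>grad_P\<close> from the
  combined divergence, and with it the second derivatives of \<open>P\<close>.\<close>

lemma cov_derivV_v_v:
  assumes y: "y \<in> S"
  shows "(\<Sum>j\<in>UNIV. v y $ j * cov_derivV G v j i y)
    = raise Gb q y $ i - (1 - 1 / (w y)\<^sup>2) / P y * grad_P y $ i"
proof -
  have "(\<Sum>j\<in>UNIV. v y $ j * (\<Sum>m\<in>UNIV. ginv Gb y i m * h y $ j $ m))
     = (\<Sum>m\<in>UNIV. ginv Gb y i m * (\<Sum>j\<in>UNIV. h y $ j $ m * v y $ j))"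
    unfolding sum_distrib_left by (subst sum.swap) (simp add: mult_ac)
  moreover have "(\<Sum>j\<in>UNIV. v y $ j * (nu y $ j * grad_P y $ i / P y))
     = (\<Sum>j\<in>UNIV. nu y $ j * v y $ j) / P y * grad_P y $ i"
    unfolding sum_divide_distrib sum_distrib_right by (simp add: mult_ac)
  ultimately show ?thesis
    by (simp add: cov_derivV_v[OF y] right_diff_distrib sum_subtractf raise_def insert_vec_def nu_v[OF y])
qed

lemma divV_v:
  assumes y: "y \<in> S"
  shows "divV G v y = trace2 Gb h y - pv y / (P y * (w y)\<^sup>2)"
proof -
  have "divV G v y = trace2 Gb h y - (\<Sum>i\<in>UNIV. nu y $ i * grad_P y $ i) / P y"
    unfolding divV_def cov_derivV_v[OF y] trace2_def by (simp add: sum_subtractf sum_divide_distrib)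
  then show ?thesis by (simp add: nu_grad_P[OF y] mult.commute[of "P y"])
qed

lemma lam_pairing: "(\<Sum>i\<in>UNIV. lam y $ i * a i) = (\<Sum>i\<in>UNIV. q y $ i * a i) - pv y / P y * (\<Sum>i\<in>UNIV. nu y $ i * a i)"
  unfolding lam_def sum_distrib_left by (simp add: algebra_simps sum_subtractf)

lemma q_v: "(\<Sum>i\<in>UNIV. v y $ i * q y $ i) = (\<Sum>i\<in>UNIV. q y $ i * v y $ i)"
  by (simp add: mult.commute)

lemma q_pairing:
  "(\<Sum>j\<in>UNIV. (\<Sum>m\<in>UNIV. h y $ j $ m * a m) * v y $ j) = (\<Sum>i\<in>UNIV. q y $ i * a i)"
  unfolding q_nth sum_distrib_right by (subst sum.swap) (simp add: mult_ac)

lemma trace_cov_derivV_v_sq: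
  assumes x: "x \<in> S"
  shows "(\<Sum>i\<in>UNIV. \<Sum>j\<in>UNIV. cov_derivV G v i j x * cov_derivV G v j i x) = norm2_sq Gb h x
    - 2 * (\<Sum>i\<in>UNIV. q x $ i * grad_P x $ i) / (P x * (w x)\<^sup>2) + (pv x / (P x * (w x)\<^sup>2))\<^sup>2"
proof -
  let ?M = "\<lambda>i j. \<Sum>m\<in>UNIV. ginv Gb x j m * h x $ i $ m" and ?\<nu> = "\<lambda>i. nu x $ i" and ?b = "\<lambda>i. grad_P x $ i"
  have MM: "(\<Sum>i\<in>UNIV. \<Sum>j\<in>UNIV. ?M i j * ?M j i) = norm2_sq Gb h x"
    by (rule bar.norm2_sq_mixed[of x h, OF x h_sym[OF x], symmetric])
  have Mb: "(\<Sum>i\<in>UNIV. \<Sum>j\<in>UNIV. ?M i j * (?\<nu> j * ?b i)) = (\<Sum>i\<in>UNIV. q x $ i * ?b i) / (w x)\<^sup>2"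
  proof -
    have "(\<Sum>j\<in>UNIV. ?\<nu> j * ?M i j) = q x $ i / (w x)\<^sup>2" for i
      unfolding pairing_raise_bar_nu[OF x] q_nth by (simp add: h_sym[OF x, of _ i] mult.commute)
    moreover have "(\<Sum>i\<in>UNIV. \<Sum>j\<in>UNIV. M i j * (?\<nu> j * ?b i)) = (\<Sum>i\<in>UNIV. (\<Sum>j\<in>UNIV. ?\<nu> j * M i j) * ?b i)" for M
      unfolding sum_distrib_right by (simp add: mult_ac)
    ultimately show ?thesis
      by (simp add: sum_divide_distrib)
  qed
  have Mb': "(\<Sum>i\<in>UNIV. \<Sum>j\<in>UNIV. (?\<nu> i * ?b j) * ?M j i) = (\<Sum>i\<in>UNIV. q x $ i * ?b i) / (w x)\<^sup>2"
    unfolding Mb[symmetric] by (subst sum.swap) (simp only: mult_ac)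
  have bb: "(\<Sum>i\<in>UNIV. \<Sum>j\<in>UNIV. (?\<nu> i * ?b j) * (?\<nu> j * ?b i)) = (pv x / (w x)\<^sup>2)\<^sup>2"
  proof -
    have "(\<Sum>i\<in>UNIV. \<Sum>j\<in>UNIV. (?\<nu> i * ?b j) * (?\<nu> j * ?b i))
      = (\<Sum>i\<in>UNIV. ?\<nu> i * ?b i) * (\<Sum>j\<in>UNIV. ?\<nu> j * ?b j)"
      by (simp only: sum_product mult_ac)
    then show ?thesis
      unfolding nu_grad_P[OF x] power2_eq_square[of "pv x / _"] .
  qed
  have "(\<Sum>i\<in>UNIV. \<Sum>j\<in>UNIV. cov_derivV G v i j x * cov_derivV G v j i x) =
    (\<Sum>i\<in>UNIV. \<Sum>j\<in>UNIV. ?M i j * ?M j i) - (\<Sum>i\<in>UNIV. \<Sum>j\<in>UNIV. ?M i j * (?\<nu> j * ?b i)) / P x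
    - (\<Sum>i\<in>UNIV. \<Sum>j\<in>UNIV. (?\<nu> i * ?b j) * ?M j i) / P x
    + (\<Sum>i\<in>UNIV. \<Sum>j\<in>UNIV. (?\<nu> i * ?b j) * (?\<nu> j * ?b i)) / (P x)\<^sup>2"
  proof -
    have "(a - b / P x) * (c - d / P x) = a * c - a * d / P x - b * c / P x + b * d / (P x)\<^sup>2" for a b c d
      by (simp add: power2_eq_square algebra_simps)
    then show ?thesis
      unfolding cov_derivV_v[OF x] by (simp add: sum.distrib sum_subtractf sum_divide_distrib)
  qed
  then show ?thesis
    unfolding MM Mb Mb' bb by (simp add: power_divide power_mult_distrib mult.commute)
qed

text \<open>In the product of two factors \<open>v h - alpha b nu nu\<close> the first terms give
  \<open>q q\<close>, each mixed term carries \<open>nu(v)\<close>, and the last terms carry the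
  square of \<open>nu(b)\<close>; \<open>bar_contract_nu\<close> then evaluates the remaining
  trace.\<close>

lemma bar_trace_difference_sq:
  assumes x: "x \<in> S"
  shows "(\<Sum>j\<in>UNIV. \<Sum>k\<in>UNIV. ginv Gb x j k * (\<Sum>i\<in>UNIV. \<Sum>m\<in>UNIV.
      (christoffel Gb i j m x - christoffel G i j m x) * (christoffel Gb m i k x - christoffel G m i k x)))
    = norm1_sq Gb q x - 2 * (1 - 1 / (w x)\<^sup>2) / P x * (\<Sum>i\<in>UNIV. q x $ i * grad_P x $ i)
      + (1 - 1 / (w x)\<^sup>2) * (pv x)\<^sup>2 / ((P x)\<^sup>2 * (w x)\<^sup>2)"
proof -
  let ?\<nu> = "\<lambda>i. nu x $ i" and ?b = "\<lambda>i. grad_P x $ i" and ?v = "\<lambda>i. v x $ i" and ?h = "\<lambda>i j. h x $ i $ j"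
  define \<alpha> where "\<alpha> = (w x)\<^sup>2 / P x"
  define N where "N = 1 - 1 / (w x)\<^sup>2"
  define hb where "hb j = (\<Sum>m\<in>UNIV. ?h j m * ?b m)" for j
  have C: "christoffel Gb l i j x - christoffel G l i j x = ?v l * ?h i j - \<alpha> * ?b l * ?\<nu> i * ?\<nu> j" for l i j
    unfolding christoffel_bar[OF x] \<alpha>_def by simp
  have CC: "(\<Sum>i\<in>UNIV. \<Sum>m\<in>UNIV. (?v i * ?h j m - \<alpha> * ?b i * ?\<nu> j * ?\<nu> m) * (?v m * ?h i k - \<alpha> * ?b m * ?\<nu> i * ?\<nu> k))
     = q x $ j * q x $ k - \<alpha> * N * (hb j * ?\<nu> k) - \<alpha> * N * (?\<nu> j * hb k)
       + (\<alpha> * (pv x / (w x)\<^sup>2))\<^sup>2 * (?\<nu> j * ?\<nu> k)" for j k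
  proof -
    have "(\<Sum>i\<in>UNIV. \<Sum>m\<in>UNIV. (?v i * ?h j m - \<alpha> * ?b i * ?\<nu> j * ?\<nu> m) * (?v m * ?h i k - \<alpha> * ?b m * ?\<nu> i * ?\<nu> k))
      = (\<Sum>i\<in>UNIV. ?h i k * ?v i) * (\<Sum>m\<in>UNIV. ?h m j * ?v m)
       - \<alpha> * ?\<nu> k * ((\<Sum>i\<in>UNIV. ?\<nu> i * ?v i) * (\<Sum>m\<in>UNIV. ?h j m * ?b m))
       - \<alpha> * ?\<nu> j * ((\<Sum>i\<in>UNIV. ?h k i * ?b i) * (\<Sum>m\<in>UNIV. ?\<nu> m * ?v m))
       + \<alpha> * \<alpha> * ?\<nu> j * ?\<nu> k * ((\<Sum>i\<in>UNIV. ?\<nu> i * ?b i) * (\<Sum>m\<in>UNIV. ?\<nu> m * ?b m))"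
      unfolding sum_product unfolding sum_distrib_left
      by (simp add: algebra_simps sum.distrib sum_subtractf h_sym[OF x, of j] h_sym[OF x, of k])
    then show ?thesis
      unfolding nu_v[OF x] nu_grad_P[OF x] q_nth hb_def N_def by (simp add: power2_eq_square algebra_simps)
  qed
  have n1: "(\<Sum>j\<in>UNIV. \<Sum>k\<in>UNIV. ginv Gb x j k * (q x $ j * q x $ k)) = norm1_sq Gb q x"
    by (simp add: norm1_sq_def mult.assoc)
  have hbv: "(\<Sum>j\<in>UNIV. hb j * ?v j) = (\<Sum>i\<in>UNIV. q x $ i * ?b i)"
    unfolding hb_def by (rule q_pairing)
  have "(\<Sum>j\<in>UNIV. \<Sum>k\<in>UNIV. ginv Gb x j k * (q x $ j * q x $ k - \<alpha> * N * (hb j * ?\<nu> k) - \<alpha> * N * (?\<nu> j * hb k)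
       + (\<alpha> * (pv x / (w x)\<^sup>2))\<^sup>2 * (?\<nu> j * ?\<nu> k)))
    = norm1_sq Gb q x - \<alpha> * N * (\<Sum>j\<in>UNIV. \<Sum>k\<in>UNIV. ginv Gb x j k * (hb j * ?\<nu> k))
      - \<alpha> * N * (\<Sum>j\<in>UNIV. \<Sum>k\<in>UNIV. ginv Gb x j k * (?\<nu> j * hb k))
      + (\<alpha> * (pv x / (w x)\<^sup>2))\<^sup>2 * (\<Sum>j\<in>UNIV. \<Sum>k\<in>UNIV. ginv Gb x j k * (?\<nu> j * ?\<nu> k))"
    unfolding n1[symmetric] sum_distrib_left distrib_left right_diff_distrib
    by (simp add: sum.distrib sum_subtractf mult_ac)
  also have "\<dots> = norm1_sq Gb q x - 2 * (\<alpha> * N * ((\<Sum>i\<in>UNIV. q x $ i * ?b i) / (w x)\<^sup>2))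
      + (\<alpha> * (pv x / (w x)\<^sup>2))\<^sup>2 * (N / (w x)\<^sup>2)"
    unfolding bar_contract_nu[OF x] hbv nu_v[OF x] N_def by simp
  finally have eq: "(\<Sum>j\<in>UNIV. \<Sum>k\<in>UNIV. ginv Gb x j k * (q x $ j * q x $ k - \<alpha> * N * (hb j * ?\<nu> k)
       - \<alpha> * N * (?\<nu> j * hb k) + (\<alpha> * (pv x / (w x)\<^sup>2))\<^sup>2 * (?\<nu> j * ?\<nu> k)))
    = norm1_sq Gb q x - 2 * (\<alpha> * N * ((\<Sum>i\<in>UNIV. q x $ i * ?b i) / (w x)\<^sup>2))
      + (\<alpha> * (pv x / (w x)\<^sup>2))\<^sup>2 * (N / (w x)\<^sup>2)" .
  have e1: "\<alpha> * (pv x / (w x)\<^sup>2) = pv x / P x"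
    using w_nz[OF x] by (simp add: \<alpha>_def)
  have e2: "\<alpha> * N * ((\<Sum>i\<in>UNIV. q x $ i * ?b i) / (w x)\<^sup>2) = N / P x * (\<Sum>i\<in>UNIV. q x $ i * ?b i)"
    using w_nz[OF x] by (simp add: \<alpha>_def)
  show ?thesis
    unfolding C CC eq unfolding e1 e2 by (simp add: N_def power_divide mult.commute)
qed

text \<open>The case \<open>k = 0\<close>, with the term \<open>- 2 / P div(P q)\<close> expanded by
  the product rule.\<close>

theorem scalar_curvature_graph:
  assumes x: "x \<in> S"
  shows "scalar_curvature Gb x = scalar_curvature G x + norm2_sq Gb h x + 2 * norm1_sq Gb q x
    - 2 * div1 Gb q x - 2 / P x * (\<Sum>i\<in>UNIV. q x $ i * grad_P x $ i)
    + (trace2 Gb h x)\<^sup>2 + 2 * dir_deriv (v x) (trace2 Gb h) x"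
proof -
  define C where "C l i j y = christoffel Gb l i j y - christoffel G l i j y" for l i j y
  define l where "l y = (\<chi> k. \<Sum>i\<in>UNIV. C i i k y)" for y
  define N where "N y = 1 - 1 / (w y)\<^sup>2" for y
  define Y where "Y y = (\<chi> i. \<Sum>j\<in>UNIV. v y $ j * cov_derivV G v j i y) - divV G v y *\<^sub>R v y" for y
  define Z where "Z y = trace2 Gb h y *\<^sub>R v y - raise Gb q y" for y
  have l: "l y = lam y" if "y \<in> S" for y
    using christoffel_bar_trace[OF that] by (simp add: l_def C_def vec_eq_iff)
  have smY: "smooth_on S (\<lambda>y. Y y $ i)" for i
    unfolding Y_def by simp (intro smooth_intros open_S smooth_v smooth_cov_derivV smooth_divV)
  have smtr: "smooth_on S (trace2 Gb h)"
    by (rule smooth_trace_bar[OF smooth_h])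
  have smZ: "smooth_on S (\<lambda>y. Z y $ i)" for i
    unfolding Z_def by simp (intro smooth_intros open_S smooth_v smtr bar.smooth_raise smooth_q)
  \<comment> \<open>The split isolates \<open>Y\<close>, the field of \<open>ricci_eq_div\<close>
    for \<open>X = v\<close>. Its divergence for \<open>G\<close> reappears in \<open>ricv\<close>
    with the opposite effect, so it is never evaluated.\<close>
  have A: "(\<chi> i. \<Sum>j\<in>UNIV. \<Sum>k\<in>UNIV. ginv Gb y j k * C i j k y) - raise Gb l y = Y y + (Z y + Z y)"
    if y: "y \<in> S" for y
  proof -
    have "raise Gb l y = raise Gb lam y" by (simp add: raise_def l[OF y])
    then show ?thesis
      unfolding C_def Y_def Z_def bar_trace_difference[OF y] cov_derivV_v_v[OF y] divV_v[OF y] raise_bar_lam[OF y]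
      by (simp add: vec_eq_iff algebra_simps)
  qed
  have divbar: "divV Gb X x = divV G X x + (\<Sum>m\<in>UNIV. lam x $ m * X x $ m)" for X
    by (rule divV_change[OF christoffel_bar_trace[OF x, symmetric]])
  define tb where "tb = trace2 Gb h x"
  define s where "s = pv x / (P x * (w x)\<^sup>2)"
  define lv where "lv = (\<Sum>m\<in>UNIV. lam x $ m * v x $ m)"
  define lb where "lb = (\<Sum>m\<in>UNIV. lam x $ m * grad_P x $ m)"
  define lQ where "lQ = (\<Sum>m\<in>UNIV. lam x $ m * raise Gb q x $ m)"
  define qb where "qb = (\<Sum>i\<in>UNIV. q x $ i * grad_P x $ i)"
  define qv where "qv = (\<Sum>i\<in>UNIV. q x $ i * v x $ i)"
  have divA: "divV Gb (\<lambda>y. (\<chi> i. \<Sum>j\<in>UNIV. \<Sum>k\<in>UNIV. ginv Gb y j k * C i j k y) - raise Gb l y) x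
    = divV G Y x + (lQ - N x / P x * lb - (tb - s) * lv)
      + 2 * (dir_deriv (v x) (trace2 Gb h) x + tb * (tb - s + lv) - div1 Gb q x)"
  proof -
    have "divV Gb (\<lambda>y. (\<chi> i. \<Sum>j\<in>UNIV. \<Sum>k\<in>UNIV. ginv Gb y j k * C i j k y) - raise Gb l y) x
      = divV Gb (\<lambda>y. Y y + (Z y + Z y)) x"
      by (rule bar.divV_cong[OF x A])
    also have "\<dots> = divV Gb Y x + divV Gb (\<lambda>y. Z y + Z y) x"
      by (rule bar.divV_add[OF x smY]) (unfold vector_add_component, rule smooth_on_add[OF open_S smZ smZ])
    also have "divV Gb (\<lambda>y. Z y + Z y) x = 2 * divV Gb Z x"
      using bar.divV_add[OF x smZ smZ] by simp
    also have "divV Gb Y x = divV G Y x + (lQ - N x / P x * lb - (tb - s) * lv)"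
    proof -
      have "Y x $ m = raise Gb q x $ m - N x / P x * grad_P x $ m - (tb - s) * v x $ m" for m
        by (simp add: Y_def cov_derivV_v_v[OF x] divV_v[OF x] tb_def s_def N_def)
      then have "(\<Sum>m\<in>UNIV. lam x $ m * Y x $ m) = lQ - N x / P x * lb - (tb - s) * lv"
        unfolding lQ_def lb_def lv_def sum_distrib_left by (simp add: right_diff_distrib sum_subtractf mult_ac)
      then show ?thesis unfolding divbar by simp
    qed
    also have "divV Gb Z x = dir_deriv (v x) (trace2 Gb h) x + tb * (tb - s + lv) - div1 Gb q x"
    proof -
      have "divV Gb Z x = divV Gb (\<lambda>y. trace2 Gb h y *\<^sub>R v y) x - divV Gb (raise Gb q) x"
        unfolding Z_def
        by (rule bar.divV_diff[OF x]) (simp_all add: smooth_on_mult[OF open_S] smooth_v smtr bar.smooth_raise smooth_q)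
      also have "divV Gb (raise Gb q) x = div1 Gb q x"
        using bar.div1_eq_divV[OF x, of q] smooth_q by simp
      also have "divV Gb (\<lambda>y. trace2 Gb h y *\<^sub>R v y) x = dir_deriv (v x) (trace2 Gb h) x + tb * (tb - s + lv)"
        unfolding bar.divV_scaleR[OF x smtr smooth_v] divbar divV_v[OF x] tb_def s_def lv_def by simp
      finally show ?thesis .
    qed
    finally show ?thesis .
  qed
  have ric: "(\<Sum>j\<in>UNIV. \<Sum>k\<in>UNIV. ginv Gb x j k * ricci G j k x) = scalar_curvature G x
     - (\<Sum>j\<in>UNIV. \<Sum>k\<in>UNIV. ricci G j k x * v x $ j * v x $ k)"
    unfolding Gb_inverse[OF x] scalar_curvature_def by (simp add: algebra_simps sum_subtractf)
  have ricv: "(\<Sum>j\<in>UNIV. \<Sum>k\<in>UNIV. ricci G j k x * v x $ j * v x $ k)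
     = divV G Y x - (norm2_sq Gb h x - 2 * qb / (P x * (w x)\<^sup>2) + s\<^sup>2) + (tb - s)\<^sup>2"
    unfolding ricci_eq_div[OF x smooth_v] trace_cov_derivV_v_sq[OF x] divV_v[OF x] Y_def s_def tb_def qb_def
    by simp
  have lC: "(\<Sum>j\<in>UNIV. \<Sum>k\<in>UNIV. ginv Gb x j k * (\<Sum>m\<in>UNIV. l x $ m * C m j k x)) = tb * lv - N x / P x * lb"
  proof -
    have "(\<Sum>j\<in>UNIV. \<Sum>k\<in>UNIV. ginv Gb x j k * (\<Sum>m\<in>UNIV. l x $ m * C m j k x))
      = (\<Sum>m\<in>UNIV. lam x $ m * (\<Sum>j\<in>UNIV. \<Sum>k\<in>UNIV. ginv Gb x j k * C m j k x))"
      unfolding sum_distrib_left l[OF x] by (rule trans[OF _ sum_rotate[symmetric]]) (simp only: mult_ac)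
    also have "\<dots> = tb * lv - N x / P x * lb"
      unfolding C_def bar_trace_difference[OF x] tb_def lv_def lb_def N_def sum_distrib_left
      by (simp add: right_diff_distrib sum_subtractf mult_ac)
    finally show ?thesis .
  qed
  have lv: "lv = qv - pv x / P x * N x"
    unfolding lv_def lam_pairing nu_v[OF x] qv_def N_def ..
  have lQ: "lQ = norm1_sq Gb q x - s * qv"
  proof -
    have "(\<Sum>i\<in>UNIV. q x $ i * raise Gb q x $ i) = norm1_sq Gb q x"
      by (simp add: norm1_sq_def raise_def sum_distrib_left mult_ac)
    moreover have "(\<Sum>i\<in>UNIV. nu x $ i * raise Gb q x $ i) = qv / (w x)\<^sup>2"
      by (simp add: raise_def pairing_raise_bar_nu[OF x] qv_def q_v)
    ultimately show ?thesis
      unfolding lQ_def lam_pairing s_def by simp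
  qed
  have pw: "pv x / P x = s * (w x)\<^sup>2"
    using w_nz[OF x] by (simp add: s_def)
  have "scalar_curvature Gb x = scalar_curvature G x - (divV G Y x - (norm2_sq Gb h x - 2 * qb / (P x * (w x)\<^sup>2) + s\<^sup>2) + (tb - s)\<^sup>2)
    + (divV G Y x + (lQ - N x / P x * lb - (tb - s) * lv)
      + 2 * (dir_deriv (v x) (trace2 Gb h) x + tb * (tb - s + lv) - div1 Gb q x))
    - (tb * lv - N x / P x * lb)
    + (norm1_sq Gb q x - 2 * N x / P x * qb + N x * (pv x)\<^sup>2 / ((P x)\<^sup>2 * (w x)\<^sup>2))"
  proof -
    have lC': "l y $ k = (\<Sum>i\<in>UNIV. C i i k y)" for y k
      by (simp add: l_def)
    show ?thesis
      unfolding scalar_curvature_change[OF smooth_metric_axioms bar.smooth_metric_axioms x C_def lC']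
        divA ric ricv lC
      unfolding C_def bar_trace_difference_sq[OF x] N_def qb_def by simp
  qed
  also have "N x * (pv x)\<^sup>2 / ((P x)\<^sup>2 * (w x)\<^sup>2) = N x * s\<^sup>2 * (w x)\<^sup>2"
    using w_nz[OF x] P_nz[OF x] by (simp add: s_def field_simps power2_eq_square)
  \<comment> \<open>Here \<open>lb\<close> cancels and \<open>lv\<close> survives with coefficient
    \<open>s\<close>. By \<open>lv\<close> and \<open>lQ\<close>, the sum \<open>s * lv + lQ\<close>
    is the norm of \<open>q\<close> minus \<open>N s^2 w^2\<close>, which cancels the last term of
    the quadratic part; that part brings the second copy of the norm.\<close>
  finally have "scalar_curvature Gb x = scalar_curvature G x + norm2_sq Gb h x - 2 * qb / (P x * (w x)\<^sup>2)
     - 2 * N x / P x * qb + 2 * norm1_sq Gb q x - 2 * div1 Gb q x + tb\<^sup>2 + 2 * dir_deriv (v x) (trace2 Gb h) x"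
    unfolding lv lQ pw by (simp add: power2_eq_square algebra_simps)
  \<comment> \<open>Since \<open>1/w^2 = 1 - N\<close>, the two contributions of \<open>qb\<close>
    add up to the coefficient \<open>2 / P\<close> of the product rule.\<close>
  also have "2 * qb / (P x * (w x)\<^sup>2) = 2 / P x * qb - 2 * N x / P x * qb"
    by (simp add: N_def algebra_simps diff_divide_distrib)
  finally show ?thesis
    by (simp add: qb_def tb_def)
qed

end

section \<open>The identity in a chart\<close>

context smooth_metric
begin

lemma pairing_raise_sym:
  assumes "x \<in> S"
  shows "(\<Sum>i\<in>UNIV. a i * (\<Sum>j\<in>UNIV. ginv G x i j * b j)) = (\<Sum>i\<in>UNIV. b i * (\<Sum>j\<in>UNIV. ginv G x i j * a j))"
  unfolding sum_distrib_left by (subst sum.swap) (simp add: ginv_sym[OF assms] mult_ac)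

lemma div1_diff:
  assumes "x \<in> S" "\<And>l. smooth_on S (\<lambda>y. a y $ l)" "\<And>l. smooth_on S (\<lambda>y. b y $ l)"
  shows "div1 G (\<lambda>y. a y - b y) x = div1 G a x - div1 G b x"
  by (simp add: div1_def cov_deriv1_def pd_diff_smooth[OF open_S] assms algebra_simps sum.distrib sum_subtractf)

lemma div1_scaleR:
  assumes x: "x \<in> S" and s: "smooth_on S s" and a: "\<And>l. smooth_on S (\<lambda>y. a y $ l)"
  shows "div1 G (\<lambda>y. s y *\<^sub>R a y) x = (\<Sum>i\<in>UNIV. a x $ i * raise G (differential s) x $ i) + s x * div1 G a x"
proof -
  have "div1 G (\<lambda>y. s y *\<^sub>R a y) x = divV G (raise G (\<lambda>y. s y *\<^sub>R a y)) x"
    using a by (intro div1_eq_divV[OF x]) (simp add: smooth_on_mult[OF open_S s])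
  also have "raise G (\<lambda>y. s y *\<^sub>R a y) = (\<lambda>y. s y *\<^sub>R raise G a y)"
    by (simp add: fun_eq_iff vec_eq_iff raise_def sum_distrib_left mult_ac)
  also have "divV G \<dots> x = dir_deriv (raise G a x) s x + s x * div1 G a x"
    using divV_scaleR[OF x s smooth_raise[OF a]] div1_eq_divV[OF x a] by simp
  also have "dir_deriv (raise G a x) s x = (\<Sum>i\<in>UNIV. a x $ i * raise G (differential s) x $ i)"
    using pairing_raise_sym[OF x, of "\<lambda>i. a x $ i" "\<lambda>i. pd i s x"]
    by (simp add: dir_deriv_def raise_def differential_def mult.commute)
  finally show ?thesis .
qed

text \<open>The metric is parallel, so the divergence of \<open>tr(T) G\<close> is the differential
  of the trace.\<close>

lemma div2_trace_free:
  assumes x: "x \<in> S" and T: "\<And>i j. smooth_on S (\<lambda>y. T y $ i $ j)"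
  shows "div2 G (\<lambda>y. T y - trace2 G T y *\<^sub>R G y) x $ j = div2 G T x $ j - pd j (trace2 G T) x"
proof -
  have smt: "smooth_on S (trace2 G T)"
    unfolding trace2_def[abs_def] by (intro smooth_intros open_S smooth_ginv T)
  have "cov_deriv2 G (\<lambda>y. T y - trace2 G T y *\<^sub>R G y) l i j x = cov_deriv2 G T l i j x
      - pd l (trace2 G T) x * G x $ i $ j - trace2 G T x * cov_deriv2 G G l i j x" for l i
    by (simp add: cov_deriv2_def pd_diff_smooth[OF open_S x] pd_mult_smooth[OF open_S x] T smt smooth_G
        smooth_on_mult[OF open_S] algebra_simps sum.distrib sum_subtractf sum_distrib_left)
  then have "div2 G (\<lambda>y. T y - trace2 G T y *\<^sub>R G y) x $ j = div2 G T x $ j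
     - (\<Sum>l\<in>UNIV. pd l (trace2 G T) x * (\<Sum>i\<in>UNIV. ginv G x l i * G x $ i $ j))"
    by (simp add: div2_def cov_deriv2_metric[OF x] right_diff_distrib sum_subtractf sum_distrib_left mult_ac)
  then show ?thesis
    by (simp add: ginv_mult[OF x] if_distrib[of "\<lambda>t. _ * t"] cong: if_cong)
qed

text \<open>The Leibniz rule. Symmetry of \<open>T\<close> moves the contraction to the slot that
  \<open>div2\<close> contracts.\<close>

lemma div1_insert_vec:
  assumes x: "x \<in> S" and T: "\<And>i j. smooth_on S (\<lambda>y. T y $ i $ j)" and sym: "\<And>y i j. y \<in> S \<Longrightarrow> T y $ i $ j = T y $ j $ i"
    and X: "\<And>l. smooth_on S (\<lambda>y. X y $ l)"
  shows "div1 G (\<lambda>y. insert_vec (T y) (X y)) x = eval1 (div2 G T x) (X x)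
    + (\<Sum>j\<in>UNIV. \<Sum>l\<in>UNIV. cov_derivV G X j l x * (\<Sum>m\<in>UNIV. ginv G x j m * T x $ l $ m))"
proof -
  have cs: "cov_deriv2 G T i l j x = cov_deriv2 G T i j l x" for i j l
    using pd_cong[OF open_S x sym] by (simp add: cov_deriv2_def sym[OF x, of _ j] sym[OF x, of _ l])
  have "(\<Sum>j\<in>UNIV. \<Sum>m\<in>UNIV. ginv G x j m * (\<Sum>l\<in>UNIV. cov_deriv2 G T j l m x * X x $ l)) = eval1 (div2 G T x) (X x)"
    unfolding eval1_def div2_def sum_distrib_left sum_distrib_right vec_lambda_beta
    by (rule trans[OF _ sum_rotate[symmetric]]) (simp add: cs[of _ _ "_::'n"] mult_ac)
  moreover have "(\<Sum>j\<in>UNIV. \<Sum>m\<in>UNIV. ginv G x j m * (\<Sum>l\<in>UNIV. T x $ l $ m * cov_derivV G X j l x))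
     = (\<Sum>j\<in>UNIV. \<Sum>l\<in>UNIV. cov_derivV G X j l x * (\<Sum>m\<in>UNIV. ginv G x j m * T x $ l $ m))"
    unfolding sum_distrib_left
    by (rule sum.cong[OF refl], subst sum.swap) (simp add: mult_ac)
  ultimately show ?thesis
    by (simp add: div1_def cov_deriv1_insert_vec[OF x T X] distrib_left sum.distrib)
qed

end

context graph_metric_chart
begin

lemma eval1_momentum_density:
  assumes x: "x \<in> S" and K: "\<And>i j. smooth_on S (\<lambda>y. K y $ i $ j)"
  shows "eval1 (momentum_density G K x) (v x)
    = 1 / (8 * pi) * (eval1 (div2 G K x) (v x) - dir_deriv (v x) (trace2 G K) x)"
  unfolding momentum_density_def eval1_def dir_deriv_def vector_scaleR_component div2_trace_free[OF x K]
  unfolding left_diff_distrib right_diff_distrib sum_subtractf sum_distrib_left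
  by (simp add: algebra_simps diff_divide_distrib sum_subtractf)

text \<open>Raising \<open>k(v, .)\<close> with the graph metric instead of \<open>G\<close>
  subtracts \<open>k(v, v) v\<close>, the source of the terms with \<open>k(v, v)\<close>. What
  remains is the Leibniz rule for \<open>G\<close> and the change of divergence.\<close>

lemma div1_bar_insert_vec:
  assumes x: "x \<in> S" and K: "\<And>i j. smooth_on S (\<lambda>y. K y $ i $ j)"
    and sym: "\<And>y i j. y \<in> S \<Longrightarrow> K y $ i $ j = K y $ j $ i"
  shows "div1 Gb (\<lambda>y. insert_vec (K y) (v y)) x = eval1 (div2 G K x) (v x)
    - dir_deriv (v x) (\<lambda>y. eval2 (K y) (v y) (v y)) x
    + (\<Sum>i\<in>UNIV. \<Sum>j\<in>UNIV. (\<Sum>m\<in>UNIV. ginv Gb x j m * h x $ i $ m) * (\<Sum>m\<in>UNIV. ginv Gb x i m * K x $ j $ m))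
    + 2 * (\<Sum>i\<in>UNIV. insert_vec (K x) (v x) $ i * raise Gb q x $ i)
    - (\<Sum>i\<in>UNIV. insert_vec (K x) (v x) $ i * grad_P x $ i) / P x
    - eval2 (K x) (v x) (v x) * trace2 Gb h x"
proof -
  define \<kappa> where "\<kappa> y = insert_vec (K y) (v y)" for y
  define kvv where "kvv y = eval2 (K y) (v y) (v y)" for y
  let ?\<nu> = "\<lambda>i. nu x $ i" and ?b = "\<lambda>i. grad_P x $ i" and ?v = "\<lambda>i. v x $ i" and ?\<kappa> = "\<lambda>i. \<kappa> x $ i"
  define mh where "mh i j = (\<Sum>m\<in>UNIV. ginv Gb x j m * h x $ i $ m)" for i j
  define mk where "mk i j = (\<Sum>m\<in>UNIV. ginv Gb x j m * K x $ i $ m)" for i j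
  have sm\<kappa>: "smooth_on S (\<lambda>y. \<kappa> y $ i)" for i
    unfolding \<kappa>_def by (rule smooth_insert_vec[OF K])
  have smkvv: "smooth_on S kvv"
    unfolding kvv_def[abs_def] eval2_def by (intro smooth_intros open_S K smooth_v)
  have kvv_pair: "(\<Sum>m\<in>UNIV. v y $ m * \<kappa> y $ m) = kvv y" for y
    unfolding kvv_def eval2_def \<kappa>_def insert_vec_def sum_distrib_left vec_lambda_beta
    by (subst sum.swap) (simp add: sum_distrib_left mult_ac)
  have raise\<kappa>: "raise Gb \<kappa> y = raise G \<kappa> y - kvv y *\<^sub>R v y" if "y \<in> S" for y
    using raise_bar_eq[OF that, of _ "\<lambda>m. \<kappa> y $ m"] kvv_pair[of y] by (simp add: vec_eq_iff raise_def)
  have \<kappa>_sym: "(\<Sum>m\<in>UNIV. v x $ m * K x $ l $ m) = ?\<kappa> l" for l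
    unfolding \<kappa>_def insert_vec_def by (simp add: sym[OF x, of l] mult.commute)
  have "div1 Gb \<kappa> x = divV Gb (raise Gb \<kappa>) x"
    by (rule bar.div1_eq_divV[OF x sm\<kappa>])
  also have "\<dots> = divV G (raise Gb \<kappa>) x + (\<Sum>m\<in>UNIV. lam x $ m * raise Gb \<kappa> x $ m)"
    by (rule divV_change[OF christoffel_bar_trace[OF x, symmetric]])
  also have "divV G (raise Gb \<kappa>) x = divV G (\<lambda>y. raise G \<kappa> y - kvv y *\<^sub>R v y) x"
    by (rule divV_cong[OF x raise\<kappa>])
  also have "\<dots> = div1 G \<kappa> x - (dir_deriv (v x) kvv x + kvv x * divV G v x)"
  proof -
    have "divV G (\<lambda>y. raise G \<kappa> y - kvv y *\<^sub>R v y) x = divV G (raise G \<kappa>) x - divV G (\<lambda>y. kvv y *\<^sub>R v y) x"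
      by (rule divV_diff[OF x smooth_raise[OF sm\<kappa>]]) (simp add: smooth_on_mult[OF open_S smkvv smooth_v])
    then show ?thesis
      unfolding divV_scaleR[OF x smkvv smooth_v] div1_eq_divV[OF x sm\<kappa>] .
  qed
  also have "div1 G \<kappa> x = eval1 (div2 G K x) (v x) + (\<Sum>j\<in>UNIV. \<Sum>l\<in>UNIV. mh j l * mk l j)
      + (\<Sum>i\<in>UNIV. ?\<kappa> i * raise Gb q x $ i) - (\<Sum>i\<in>UNIV. ?\<kappa> i * ?b i) / P x"
  proof -
    \<comment> \<open>The derivative of \<open>v\<close> is known with an index raised by the graph
      metric, so \<open>K\<close> is rewritten in the same way.\<close>
    have e1: "(\<Sum>m\<in>UNIV. ginv G x j m * K x $ l $ m) = mk l j + ?v j * ?\<kappa> l" for j l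
      unfolding mk_def raise_bar_eq[OF x] \<kappa>_sym by simp
    have e2: "cov_derivV G v j l x = mh j l - ?\<nu> j * ?b l / P x" for j l
      by (simp add: cov_derivV_v[OF x] mh_def)
    have e3: "(\<Sum>j\<in>UNIV. \<Sum>l\<in>UNIV. (mh j l - ?\<nu> j * ?b l / P x) * (mk l j + ?v j * ?\<kappa> l))
      = (\<Sum>j\<in>UNIV. \<Sum>l\<in>UNIV. mh j l * mk l j) + (\<Sum>j\<in>UNIV. \<Sum>l\<in>UNIV. ?\<kappa> l * (?v j * mh j l))
       - (\<Sum>j\<in>UNIV. \<Sum>l\<in>UNIV. ?b l * (?\<nu> j * mk l j)) / P x
       - (\<Sum>j\<in>UNIV. \<Sum>l\<in>UNIV. (?\<nu> j * ?v j) * (?\<kappa> l * ?b l)) / P x"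
      by (simp add: algebra_simps sum.distrib sum_subtractf sum_divide_distrib add_divide_distrib)
    have e4: "(\<Sum>j\<in>UNIV. \<Sum>l\<in>UNIV. ?\<kappa> l * (?v j * mh j l)) = (\<Sum>i\<in>UNIV. ?\<kappa> i * raise Gb q x $ i)"
    proof -
      have "(\<Sum>j\<in>UNIV. ?v j * mh j l) = raise Gb q x $ l" for l
        unfolding mh_def raise_def vec_lambda_beta insert_vec_def sum_distrib_left
        by (subst sum.swap) (simp add: mult_ac)
      then show ?thesis
        by (subst sum.swap) (simp flip: sum_distrib_left)
    qed
    have e5: "(\<Sum>j\<in>UNIV. \<Sum>l\<in>UNIV. ?b l * (?\<nu> j * mk l j)) = (\<Sum>i\<in>UNIV. ?\<kappa> i * ?b i) / (w x)\<^sup>2"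
    proof -
      have "(\<Sum>j\<in>UNIV. ?\<nu> j * mk l j) = ?\<kappa> l / (w x)\<^sup>2" for l
        unfolding mk_def pairing_raise_bar_nu[OF x] \<kappa>_sym ..
      then show ?thesis
        by (subst sum.swap) (simp add: sum_divide_distrib mult.commute flip: sum_distrib_left)
    qed
    \<comment> \<open>This weight and the weight \<open>1/w^2\<close> of \<open>e5\<close> sum to 1,
      leaving the pairing with \<open>grad_P\<close> divided by \<open>P\<close>.\<close>
    have e6: "(\<Sum>j\<in>UNIV. \<Sum>l\<in>UNIV. (?\<nu> j * ?v j) * (?\<kappa> l * ?b l)) = (1 - 1 / (w x)\<^sup>2) * (\<Sum>i\<in>UNIV. ?\<kappa> i * ?b i)"
      unfolding nu_v[OF x, symmetric] sum_product ..
    have e7: "div1 G \<kappa> x = eval1 (div2 G K x) (v x)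
        + (\<Sum>j\<in>UNIV. \<Sum>l\<in>UNIV. cov_derivV G v j l x * (\<Sum>m\<in>UNIV. ginv G x j m * K x $ l $ m))"
      unfolding \<kappa>_def by (rule div1_insert_vec[OF x K sym smooth_v])
    show ?thesis
      unfolding e7 e1 e2 e3 e4 e5 e6 by (simp add: algebra_simps diff_divide_distrib)
  qed
  \<comment> \<open>Supplies the second copy of the pairing with \<open>q\<close>; its term with
    \<open>pv\<close> cancels the one coming from \<open>divV_v\<close>.\<close>
  also have "(\<Sum>m\<in>UNIV. lam x $ m * raise Gb \<kappa> x $ m)
      = (\<Sum>i\<in>UNIV. ?\<kappa> i * raise Gb q x $ i) - pv x / P x * (kvv x / (w x)\<^sup>2)"
    unfolding lam_pairing raise_def vec_lambda_beta pairing_raise_bar_nu[OF x] kvv_pair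
    by (simp add: bar.pairing_raise_sym[OF x, of "\<lambda>i. q x $ i"])
  finally show ?thesis
    unfolding divV_v[OF x] mh_def mk_def \<kappa>_def kvv_def[abs_def] by (simp add: algebra_simps)
qed

theorem schoen_yau_identity_chart:
  assumes x: "x \<in> S" and K: "\<And>i j. smooth_on S (\<lambda>y. K y $ i $ j)"
    and sym: "\<And>y i j. y \<in> S \<Longrightarrow> K y $ i $ j = K y $ j $ i"
  shows "scalar_curvature Gb x =
    16 * pi * (energy_density G K x - eval1 (momentum_density G K x) (v x))
    + norm2_sq Gb (\<lambda>y. h y - K y) x
    + 2 * norm1_sq Gb (\<lambda>y. q y - insert_vec (K y) (v y)) x
    - 2 / P x * div1 Gb (\<lambda>y. P y *\<^sub>R (q y - insert_vec (K y) (v y))) x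
    + (trace2 Gb h x)\<^sup>2 - (trace2 Gb K x)\<^sup>2
    + 2 * dir_deriv (v x) (\<lambda>y. trace2 Gb h y - trace2 Gb K y) x
    + 2 * eval2 (K x) (v x) (v x) * (trace2 Gb h x - trace2 Gb K x)"
proof -
  define \<kappa> where "\<kappa> y = insert_vec (K y) (v y)" for y
  define kvv where "kvv y = eval2 (K y) (v y) (v y)" for y
  let ?v = "\<lambda>i. v x $ i" and ?\<kappa> = "\<lambda>i. \<kappa> x $ i" and ?q = "\<lambda>i. q x $ i" and ?b = "\<lambda>i. grad_P x $ i"
  define mh where "mh i j = (\<Sum>m\<in>UNIV. ginv Gb x j m * h x $ i $ m)" for i j
  define mk where "mk i j = (\<Sum>m\<in>UNIV. ginv Gb x j m * K x $ i $ m)" for i j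
  define mg where "mg i j = (\<Sum>m\<in>UNIV. ginv G x j m * K x $ i $ m)" for i j
  define hk where "hk = (\<Sum>i\<in>UNIV. \<Sum>j\<in>UNIV. mh i j * mk j i)"
  define q\<kappa> where "q\<kappa> = (\<Sum>i\<in>UNIV. ?\<kappa> i * raise Gb q x $ i)"
  define \<kappa>\<kappa> where "\<kappa>\<kappa> = (\<Sum>i\<in>UNIV. ?\<kappa> i * raise G \<kappa> x $ i)"
  have sm\<kappa>: "smooth_on S (\<lambda>y. \<kappa> y $ i)" for i
    unfolding \<kappa>_def by (rule smooth_insert_vec[OF K])
  have smkvv: "smooth_on S kvv"
    unfolding kvv_def[abs_def] eval2_def by (intro smooth_intros open_S K smooth_v)
  have smtK: "smooth_on S (trace2 G K)"
    unfolding trace2_def[abs_def] by (intro smooth_intros open_S K smooth_ginv)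
  have kvv_pair: "(\<Sum>m\<in>UNIV. v y $ m * \<kappa> y $ m) = kvv y" for y
    unfolding kvv_def eval2_def \<kappa>_def insert_vec_def sum_distrib_left vec_lambda_beta
    by (subst sum.swap) (simp add: sum_distrib_left mult_ac)
  have \<kappa>_sym: "(\<Sum>m\<in>UNIV. v x $ m * K x $ l $ m) = ?\<kappa> l" for l
    unfolding \<kappa>_def insert_vec_def by (simp add: sym[OF x, of l] mult.commute)
  have trK: "trace2 Gb K y = trace2 G K y - kvv y" if "y \<in> S" for y
    unfolding trace2_def Gb_inverse[OF that] kvv_def eval2_def by (simp add: algebra_simps sum_subtractf)
  have n1: "norm1_sq Gb (\<lambda>y. q y - \<kappa> y) x = norm1_sq Gb q x - 2 * q\<kappa> + (\<kappa>\<kappa> - (kvv x)\<^sup>2)"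
  proof -
    have norm1: "norm1_sq Gb a x = (\<Sum>i\<in>UNIV. a x $ i * (\<Sum>j\<in>UNIV. ginv Gb x i j * a x $ j))" for a
      by (simp add: norm1_sq_def sum_distrib_left mult_ac)
    have "norm1_sq Gb (\<lambda>y. q y - \<kappa> y) x = norm1_sq Gb q x
      - (\<Sum>i\<in>UNIV. ?q i * (\<Sum>j\<in>UNIV. ginv Gb x i j * ?\<kappa> j)) - q\<kappa> + norm1_sq Gb \<kappa> x"
      unfolding norm1 q\<kappa>_def raise_def
      by (simp add: algebra_simps sum.distrib sum_subtractf)
    also have "(\<Sum>i\<in>UNIV. ?q i * (\<Sum>j\<in>UNIV. ginv Gb x i j * ?\<kappa> j)) = q\<kappa>"
      unfolding q\<kappa>_def raise_def vec_lambda_beta by (rule bar.pairing_raise_sym[OF x])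
    also have "norm1_sq Gb \<kappa> x = \<kappa>\<kappa> - (kvv x)\<^sup>2"
    proof -
      have "norm1_sq Gb \<kappa> x = \<kappa>\<kappa> - (\<Sum>i\<in>UNIV. ?\<kappa> i * (?v i * kvv x))"
        unfolding norm1 raise_bar_eq[OF x] kvv_pair \<kappa>\<kappa>_def raise_def
        by (simp add: right_diff_distrib sum_subtractf)
      also have "(\<Sum>i\<in>UNIV. ?\<kappa> i * (?v i * kvv x)) = (\<Sum>i\<in>UNIV. ?v i * ?\<kappa> i) * kvv x"
        unfolding sum_distrib_right by (simp add: mult_ac)
      finally show ?thesis by (simp add: kvv_pair power2_eq_square)
    qed
    finally show ?thesis by simp
  qed
  \<comment> \<open>The term \<open>- 2 * \<kappa>\<kappa>\<close> cancels twice the one in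
    \<open>n1\<close>, so the two norms together contribute the norm of \<open>K\<close> for
    \<open>G\<close> minus \<open>kvv^2\<close> at second order in \<open>K\<close>.\<close>
  have n2: "norm2_sq Gb (\<lambda>y. h y - K y) x = norm2_sq Gb h x - 2 * hk + (norm2_sq G K x - 2 * \<kappa>\<kappa> + (kvv x)\<^sup>2)"
  proof -
    have "norm2_sq Gb (\<lambda>y. h y - K y) x = (\<Sum>i\<in>UNIV. \<Sum>j\<in>UNIV. (mh i j - mk i j) * (mh j i - mk j i))"
      using bar.norm2_sq_mixed[of x "\<lambda>y. h y - K y"] x
      by (simp add: h_sym[OF x] sym[OF x] mh_def mk_def right_diff_distrib sum_subtractf)
    also have "\<dots> = (\<Sum>i\<in>UNIV. \<Sum>j\<in>UNIV. mh i j * mh j i) - hk - (\<Sum>i\<in>UNIV. \<Sum>j\<in>UNIV. mk i j * mh j i)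
        + (\<Sum>i\<in>UNIV. \<Sum>j\<in>UNIV. mk i j * mk j i)"
      unfolding hk_def by (simp add: left_diff_distrib right_diff_distrib sum.distrib sum_subtractf)
    also have "(\<Sum>i\<in>UNIV. \<Sum>j\<in>UNIV. mh i j * mh j i) = norm2_sq Gb h x"
      unfolding mh_def by (rule bar.norm2_sq_mixed[of x h, OF x h_sym[OF x], symmetric])
    also have "(\<Sum>i\<in>UNIV. \<Sum>j\<in>UNIV. mk i j * mh j i) = hk"
      unfolding hk_def by (subst sum.swap) (simp add: mult.commute)
    also have "(\<Sum>i\<in>UNIV. \<Sum>j\<in>UNIV. mk i j * mk j i) = norm2_sq G K x - 2 * \<kappa>\<kappa> + (kvv x)\<^sup>2"
    proof -
      have mk: "mk i j = mg i j - ?v j * ?\<kappa> i" for i j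
        unfolding mk_def mg_def raise_bar_eq[OF x] \<kappa>_sym ..
      have "(\<Sum>i\<in>UNIV. \<Sum>j\<in>UNIV. mk i j * mk j i) = (\<Sum>i\<in>UNIV. \<Sum>j\<in>UNIV. mg i j * mg j i)
         - (\<Sum>i\<in>UNIV. \<Sum>j\<in>UNIV. ?\<kappa> j * (?v i * mg i j)) - (\<Sum>i\<in>UNIV. \<Sum>j\<in>UNIV. ?\<kappa> i * (?v j * mg j i))
         + (\<Sum>i\<in>UNIV. \<Sum>j\<in>UNIV. (?v i * ?\<kappa> i) * (?v j * ?\<kappa> j))"
        unfolding mk by (simp add: algebra_simps sum.distrib sum_subtractf)
      also have "(\<Sum>i\<in>UNIV. \<Sum>j\<in>UNIV. ?\<kappa> j * (?v i * mg i j)) = (\<Sum>i\<in>UNIV. \<Sum>j\<in>UNIV. ?\<kappa> i * (?v j * mg j i))"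
        by (rule sum.swap)
      also have "(\<Sum>i\<in>UNIV. \<Sum>j\<in>UNIV. ?\<kappa> i * (?v j * mg j i)) = \<kappa>\<kappa>"
      proof -
        have "(\<Sum>j\<in>UNIV. ?v j * mg j i) = raise G \<kappa> x $ i" for i
          unfolding mg_def raise_def vec_lambda_beta \<kappa>_def insert_vec_def sum_distrib_left
          by (subst sum.swap) (simp add: mult_ac)
        then show ?thesis
          unfolding \<kappa>\<kappa>_def by (simp flip: sum_distrib_left)
      qed
      also have "(\<Sum>i\<in>UNIV. \<Sum>j\<in>UNIV. (?v i * ?\<kappa> i) * (?v j * ?\<kappa> j)) = (kvv x)\<^sup>2"
        unfolding sum_product[symmetric] kvv_pair power2_eq_square ..
      also have "(\<Sum>i\<in>UNIV. \<Sum>j\<in>UNIV. mg i j * mg j i) = norm2_sq G K x"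
        unfolding mg_def by (rule norm2_sq_mixed[of x K, OF x sym[OF x], symmetric])
      finally show ?thesis by simp
    qed
    finally show ?thesis by simp
  qed
  have dv: "div1 Gb (\<lambda>y. P y *\<^sub>R (q y - \<kappa> y)) x = (\<Sum>i\<in>UNIV. ?q i * ?b i) - (\<Sum>i\<in>UNIV. ?\<kappa> i * ?b i)
      + P x * (div1 Gb q x - div1 Gb \<kappa> x)"
  proof -
    have sm: "smooth_on S (\<lambda>y. (q y - \<kappa> y) $ l)" for l
      by (simp add: smooth_on_diff[OF open_S smooth_q sm\<kappa>])
    show ?thesis
      unfolding bar.div1_scaleR[OF x smooth_P sm] grad_P_def bar.div1_diff[OF x smooth_q sm\<kappa>]
      by (simp add: left_diff_distrib sum_subtractf)
  qed
  have dtr: "dir_deriv (v x) (\<lambda>y. trace2 Gb h y - trace2 Gb K y) x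
     = dir_deriv (v x) (trace2 Gb h) x - dir_deriv (v x) (trace2 G K) x + dir_deriv (v x) kvv x"
  proof -
    have "pd i (\<lambda>y. trace2 Gb h y - trace2 Gb K y) x
      = pd i (\<lambda>y. (trace2 Gb h y - trace2 G K y) + kvv y) x" for i
      by (rule pd_cong[OF open_S x]) (simp add: trK)
    also have "\<dots> i = pd i (trace2 Gb h) x - pd i (trace2 G K) x + pd i kvv x" for i
      by (simp add: pd_add_smooth[OF open_S x] pd_diff_smooth[OF open_S x] smooth_on_diff[OF open_S]
          smooth_trace_bar[OF smooth_h] smtK smkvv)
    finally have eq: "pd i (\<lambda>y. trace2 Gb h y - trace2 Gb K y) x
      = pd i (trace2 Gb h) x - pd i (trace2 G K) x + pd i kvv x" for i .
    show ?thesis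
      unfolding dir_deriv_def eq by (simp add: algebra_simps sum.distrib sum_subtractf)
  qed
  have mu: "16 * pi * (energy_density G K x - eval1 (momentum_density G K x) (v x))
     = scalar_curvature G x + (trace2 G K x)\<^sup>2 - norm2_sq G K x
       - 2 * (eval1 (div2 G K x) (v x) - dir_deriv (v x) (trace2 G K) x)"
    unfolding energy_density_def eval1_momentum_density[OF x K] by (simp add: field_simps)
  have d\<kappa>: "div1 Gb \<kappa> x = eval1 (div2 G K x) (v x) - dir_deriv (v x) kvv x + hk + 2 * q\<kappa>
      - (\<Sum>i\<in>UNIV. ?\<kappa> i * ?b i) / P x - kvv x * trace2 Gb h x"
    using div1_bar_insert_vec[OF x K sym]
    unfolding hk_def mh_def mk_def q\<kappa>_def \<kappa>_def kvv_def[abs_def] .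
  have P: "2 / P x * (P x * t) = 2 * t" for t
    using P_nz[OF x] by simp
  show ?thesis
    unfolding \<kappa>_def[symmetric] kvv_def[symmetric] mu n1 n2 dv dtr scalar_curvature_graph[OF x] d\<kappa>
      trK[OF x] distrib_left[of "2 / P x"] P
    by (simp add: power2_eq_square algebra_simps)
qed

end

section \<open>Charts and tangent vectors\<close>

lemma is_chart_props:
  assumes "is_chart M c"
  shows "fst c \<subseteq> topspace M" "inj_on (snd c) (fst c)"
    and "openin M V \<Longrightarrow> open (snd c ` (fst c \<inter> V))"
proof -
  have hom: "homeomorphic_map (subtopology M (fst c)) (top_of_set (snd c ` fst c)) (snd c)"
    and o: "openin M (fst c)" "open (snd c ` fst c)"
    using assms by (auto simp: is_chart_def)
  show sub: "fst c \<subseteq> topspace M" using o(1) openin_subset by blast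
  show "inj_on (snd c) (fst c)"
    using homeomorphic_imp_injective_map[OF hom] sub by (simp add: Int_absorb1)
  assume V: "openin M V"
  have "openin (subtopology M (fst c)) (fst c \<inter> V)"
    using V by (auto simp: openin_subtopology)
  then have "openin (top_of_set (snd c ` fst c)) (snd c ` (fst c \<inter> V))"
    using homeomorphic_imp_open_map[OF hom] by (simp add: open_map_def)
  then show "open (snd c ` (fst c \<inter> V))"
    using o(2) openin_open_eq by blast
qed

section \<open>Germs of smooth functions, coordinate vectors and components of tensors\<close>

lemma coord_fun_simps:
  "coord_fun c (\<lambda>y. u y + w y) = (\<lambda>x. coord_fun c u x + coord_fun c w x)"
  "coord_fun c (\<lambda>y. u y * w y) = (\<lambda>x. coord_fun c u x * coord_fun c w x)"
  "coord_fun c (\<lambda>y. a * u y) = (\<lambda>x. a * coord_fun c u x)"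
  by (simp_all add: coord_fun_def o_def)

locale manifold_chart =
  fixes M :: "'a topology" and A :: "('a, 'n::finite) chart set" and c :: "('a, 'n) chart"
  assumes mfd: "smooth_manifold M A" and c: "c \<in> A"
begin

lemma chart: "d \<in> A \<Longrightarrow> is_chart M d"
  using mfd by (simp add: smooth_manifold_def)

abbreviation "S \<equiv> snd c ` fst c"

lemma open_image: "open S"
  using chart[OF c] by (simp add: is_chart_def)

lemma chart_inv_in: "x \<in> S \<Longrightarrow> chart_inv c x \<in> fst c"
  unfolding chart_inv_def by (rule inv_into_into)

lemma chart_chart_inv: "x \<in> S \<Longrightarrow> snd c (chart_inv c x) = x"
  unfolding chart_inv_def by (rule f_inv_into_f)

lemma chart_inv_in_M: "x \<in> S \<Longrightarrow> chart_inv c x \<in> topspace M"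
  using chart_inv_in is_chart_props(1)[OF chart[OF c]] by blast

lemma smooth_near_coord:
  assumes "smooth_near M A p u" "p \<in> fst c"
  obtains T where "open T" "snd c p \<in> T" "smooth_on T (coord_fun c u)"
proof -
  obtain V where V: "openin M V" "p \<in> V" "smooth_fun_on A V u"
    using assms(1) by (auto simp: smooth_near_def)
  show ?thesis
  proof
    show "open (snd c ` (fst c \<inter> V))" using is_chart_props(3)[OF chart[OF c] V(1)] .
    show "smooth_on (snd c ` (fst c \<inter> V)) (coord_fun c u)" using V(3) c by (simp add: smooth_fun_on_def)
  qed (use V assms in auto)
qed

lemma smooth_near_combine:
  assumes "smooth_near M A p u" "smooth_near M A p w"
  shows "smooth_near M A p (\<lambda>y. u y + w y)" "smooth_near M A p (\<lambda>y. u y * w y)"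
proof -
  obtain V where V: "openin M V" "p \<in> V" "smooth_fun_on A V u"
    using assms(1) by (auto simp: smooth_near_def)
  obtain W where W: "openin M W" "p \<in> W" "smooth_fun_on A W w"
    using assms(2) by (auto simp: smooth_near_def)
  have o: "openin M (V \<inter> W)" "p \<in> V \<inter> W" using V W by auto
  have sm: "open (snd d ` (fst d \<inter> (V \<inter> W)))" "smooth_on (snd d ` (fst d \<inter> (V \<inter> W))) (coord_fun d u)"
    "smooth_on (snd d ` (fst d \<inter> (V \<inter> W))) (coord_fun d w)" if d: "d \<in> A" for d
  proof -
    show "open (snd d ` (fst d \<inter> (V \<inter> W)))" using is_chart_props(3)[OF chart[OF d] o(1)] .
    have *: "smooth_on (snd d ` (fst d \<inter> V)) (coord_fun d u)" "smooth_on (snd d ` (fst d \<inter> W)) (coord_fun d w)"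
      using V(3) W(3) d by (auto simp: smooth_fun_on_def)
    show "smooth_on (snd d ` (fst d \<inter> (V \<inter> W))) (coord_fun d u)"
      by (rule smooth_on_subset[OF *(1)]) blast
    show "smooth_on (snd d ` (fst d \<inter> (V \<inter> W))) (coord_fun d w)"
      by (rule smooth_on_subset[OF *(2)]) blast
  qed
  show "smooth_near M A p (\<lambda>y. u y + w y)" "smooth_near M A p (\<lambda>y. u y * w y)"
    unfolding smooth_near_def smooth_fun_on_def coord_fun_simps
    by (intro exI[of _ "V \<inter> W"] conjI ballI o smooth_on_add smooth_on_mult sm; assumption)+
qed

lemma smooth_near_const: "p \<in> topspace M \<Longrightarrow> smooth_near M A p (\<lambda>y. a)"
  unfolding smooth_near_def smooth_fun_on_def coord_fun_def o_def
  using smooth_on_const openin_topspace by blast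

text \<open>Beyond the sum and product rules this needs that smooth germs are closed under sums and
  products: \<open>coord_vec\<close> is set to 0 on every other function, so linearity would break
  if a sum left the class.\<close>

lemma coord_vec_tangent:
  assumes p: "p \<in> fst c"
  shows "coord_vec M A c i p \<in> tangent_space M A p"
proof -
  have pM: "p \<in> topspace M" using p is_chart_props(1)[OF chart[OF c]] by blast
  have inv: "chart_inv c (snd c p) = p"
    using is_chart_props(2)[OF chart[OF c]] p by (simp add: chart_inv_def)
  have d: "coord_fun c u differentiable (at (snd c p))" if "smooth_near M A p u" for u
    using smooth_near_coord[OF that p] smooth_on_differentiable by metis
  have at: "coord_fun c u (snd c p) = u p" for u
    by (simp add: coord_fun_def inv)
  have sc: "smooth_near M A p (\<lambda>y. a * u y)" if "smooth_near M A p u" for a u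
    using smooth_near_combine(2)[OF smooth_near_const[OF pM] that] .
  have "coord_vec M A c i p (\<lambda>y. u y + w y) = coord_vec M A c i p u + coord_vec M A c i p w \<and>
      coord_vec M A c i p (\<lambda>y. u y * w y) = u p * coord_vec M A c i p w + w p * coord_vec M A c i p u"
    if "smooth_near M A p u" "smooth_near M A p w" for u w
    using that smooth_near_combine[OF that]
    by (simp add: coord_vec_def coord_fun_simps pd_add pd_mult d at mult.commute)
  moreover have "coord_vec M A c i p (\<lambda>y. a * u y) = a * coord_vec M A c i p u"
    if "smooth_near M A p u" for a u
    using that sc[OF that] pd_mult[of "\<lambda>y. a" "snd c p" "coord_fun c u" i]
    by (simp add: coord_vec_def coord_fun_simps(3) d)
  moreover have "coord_vec M A c i p u = 0" if "\<not> smooth_near M A p u" for u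
    using that by (simp add: coord_vec_def)
  ultimately show ?thesis
    unfolding tangent_space_def by blast
qed

lemma tangent_space_lincomb:
  assumes "X \<in> tangent_space M A p" "Y \<in> tangent_space M A p"
  shows "(\<lambda>u. a * X u + b * Y u) \<in> tangent_space M A p"
  using assms unfolding tangent_space_def by (auto simp: algebra_simps)

text \<open>Tensors are linear on tangent vectors only, so membership of each partial sum in the
  tangent space is carried along in the induction.\<close>

lemma tensor_sum:
  assumes T: "smooth_tensor2 M A T" and p: "p \<in> topspace M" and Z: "Z \<in> tangent_space M A p"
    and X: "\<And>i. X i \<in> tangent_space M A p" and "finite I"
  shows "(\<lambda>u. \<Sum>i\<in>I. a i * X i u) \<in> tangent_space M A p \<and>
    T p (\<lambda>u. \<Sum>i\<in>I. a i * X i u) Z = (\<Sum>i\<in>I. a i * T p (X i) Z) \<and>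
    T p Z (\<lambda>u. \<Sum>i\<in>I. a i * X i u) = (\<Sum>i\<in>I. a i * T p Z (X i))"
proof -
  have lin: "T p (\<lambda>u. a * X u + b * Y u) Z = a * T p X Z + b * T p Y Z"
    "T p Z (\<lambda>u. a * X u + b * Y u) = a * T p Z X + b * T p Z Y"
    if "X \<in> tangent_space M A p" "Y \<in> tangent_space M A p" for X Y a b
    using T p Z that unfolding smooth_tensor2_def by blast+
  show ?thesis
    using \<open>finite I\<close>
  proof (induction I rule: finite_induct)
    case empty
    show ?case
      \<comment> \<open>The zero vector is represented as \<open>0 * Z + 0 * Z\<close>, as linearity
        is available for combinations of two tangent vectors.\<close>
      using tangent_space_lincomb[OF Z Z, of 0 0] lin[OF Z Z, of 0 0] by simp
  next
    case (insert j I)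
    then show ?case
      using tangent_space_lincomb[OF X[of j], where Y = "\<lambda>u. \<Sum>i\<in>I. a i * X i u" and a = "a j" and b = 1]
        lin[OF X[of j], where Y = "\<lambda>u. \<Sum>i\<in>I. a i * X i u" and a = "a j" and b = 1] by simp
  qed
qed

text \<open>Coordinate functions read off components, which makes the coordinate vectors linearly
  independent. Their smoothness near \<open>p\<close> in every chart of the atlas is smoothness of
  the transition maps.\<close>

lemma coord_vec_coordinate:
  assumes p: "p \<in> fst c"
  shows "coord_vec M A c i p (\<lambda>y. snd c y $ j) = (if i = j then 1 else 0)"
proof -
  have "smooth_near M A p (\<lambda>y. snd c y $ j)"
    unfolding smooth_near_def
  proof (intro exI conjI)
    show "openin M (fst c)" using chart[OF c] by (simp add: is_chart_def)
    show "smooth_fun_on A (fst c) (\<lambda>y. snd c y $ j)"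
      unfolding smooth_fun_on_def
    proof
      fix d assume d: "d \<in> A"
      have "smooth_on (snd d ` (fst d \<inter> fst c)) (snd c \<circ> chart_inv d)"
        using mfd d c by (simp add: smooth_manifold_def)
      moreover have "open (snd d ` (fst d \<inter> fst c))"
        using is_chart_props(3)[OF chart[OF d]] chart[OF c] by (simp add: is_chart_def)
      ultimately show "smooth_on (snd d ` (fst d \<inter> fst c)) (coord_fun d (\<lambda>y. snd c y $ j))"
        using smooth_on_vec_nth by (fastforce simp: coord_fun_def o_def)
    qed
  qed fact
  moreover have "pd i (coord_fun c (\<lambda>y. snd c y $ j)) (snd c p) = pd i (\<lambda>x. x $ j) (snd c p)"
    by (rule pd_cong[OF open_image]) (use p chart_chart_inv in \<open>auto simp: coord_fun_def\<close>)
  moreover have "pd i (\<lambda>x. x $ j) (snd c p) = axis i 1 $ j"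
    by (rule pd_eqI) (rule bounded_linear.has_derivative[OF bounded_linear_vec_nth has_derivative_ident])
  ultimately show ?thesis
    by (simp add: coord_vec_def axis_def)
qed

lemma coord_tensor2_quadratic:
  assumes T: "smooth_tensor2 M A T" and x: "x \<in> S"
  defines "p \<equiv> chart_inv c x"
  shows "(\<Sum>i\<in>UNIV. a $ i * (\<Sum>j\<in>UNIV. coord_tensor2 M A c T x $ i $ j * a $ j))
    = T p (\<lambda>u. \<Sum>i\<in>UNIV. a $ i * coord_vec M A c i p u) (\<lambda>u. \<Sum>i\<in>UNIV. a $ i * coord_vec M A c i p u)"
proof -
  have p: "p \<in> topspace M" and X: "coord_vec M A c i p \<in> tangent_space M A p" for i
    using chart_inv_in_M[OF x] coord_vec_tangent[OF chart_inv_in[OF x]] by (auto simp: p_def)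
  let ?Y = "\<lambda>u. \<Sum>i\<in>UNIV. a $ i * coord_vec M A c i p u"
  note sum = tensor_sum[where X = "\<lambda>i. coord_vec M A c i p" and a = "\<lambda>i. a $ i", OF T p _ X finite]
  have Y: "?Y \<in> tangent_space M A p"
    using sum[OF X] by blast
  have "T p ?Y ?Y = (\<Sum>i\<in>UNIV. a $ i * T p (coord_vec M A c i p) ?Y)"
    using sum[OF Y] by blast
  also have "\<dots> = (\<Sum>i\<in>UNIV. a $ i * (\<Sum>j\<in>UNIV. a $ j * T p (coord_vec M A c i p) (coord_vec M A c j p)))"
    using sum[OF X] by simp
  finally show ?thesis
    by (simp add: coord_tensor2_def p_def mult.commute)
qed

lemma coord_metric_pos:
  assumes g: "riemannian_metric M A g" and x: "x \<in> S" and a: "a \<noteq> 0"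
  shows "(\<Sum>i\<in>UNIV. a $ i * (\<Sum>j\<in>UNIV. coord_tensor2 M A c g x $ i $ j * a $ j)) > 0"
proof -
  define p where "p = chart_inv c x"
  have gT: "smooth_tensor2 M A g"
    using g by (simp add: riemannian_metric_def symmetric_tensor2_def)
  have p: "p \<in> topspace M" and X: "coord_vec M A c i p \<in> tangent_space M A p" for i
    using chart_inv_in_M[OF x] coord_vec_tangent[OF chart_inv_in[OF x]] by (auto simp: p_def)
  let ?Y = "\<lambda>u. \<Sum>i\<in>UNIV. a $ i * coord_vec M A c i p u"
  have Y: "?Y \<in> tangent_space M A p"
    using tensor_sum[where X = "\<lambda>i. coord_vec M A c i p" and a = "\<lambda>i. a $ i", OF gT p X X finite] by blast
  obtain j where j: "a $ j \<noteq> 0" using a by (auto simp: vec_eq_iff)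
  \<comment> \<open>Testing on a coordinate function shows that the tangent vector is nonzero, so
    positivity of \<open>g\<close> applies.\<close>
  have "?Y (\<lambda>y. snd c y $ j) = a $ j"
    using coord_vec_coordinate[OF chart_inv_in[OF x]]
    by (simp add: p_def if_distrib[of "\<lambda>t. _ * t"] cong: if_cong)
  then have "?Y \<noteq> (\<lambda>u. 0)"
    using j fun_cong[of ?Y "\<lambda>u. 0" "\<lambda>y. snd c y $ j"] by auto
  then have "g p ?Y ?Y > 0"
    using g p Y unfolding riemannian_metric_def by blast
  then show ?thesis
    using coord_tensor2_quadratic[OF gT x] by (simp add: p_def)
qed

lemma coord_tensor2_sym:
  assumes "symmetric_tensor2 M A T" and x: "x \<in> S"
  shows "coord_tensor2 M A c T x $ i $ j = coord_tensor2 M A c T x $ j $ i"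
  using assms(1) chart_inv_in_M[OF x] coord_vec_tangent[OF chart_inv_in[OF x]]
  by (simp add: coord_tensor2_def symmetric_tensor2_def)

lemma coord_tensor2_smooth:
  assumes "symmetric_tensor2 M A T"
  shows "smooth_on S (\<lambda>x. coord_tensor2 M A c T x $ i $ j)"
  using assms c by (simp add: symmetric_tensor2_def smooth_tensor2_def)

lemma coord_fun_smooth:
  assumes "smooth_fun_on A (topspace M) u"
  shows "smooth_on S (coord_fun c u)"
  using assms c is_chart_props(1)[OF chart[OF c]] by (auto simp: smooth_fun_on_def Int_absorb2)

text \<open>Smoothness of \<open>f\<close> guarantees that the coordinate vectors take their genuine
  values on \<open>f\<close> and not the default 0.\<close>

lemma coord_graph_metric:
  assumes f: "smooth_fun_on A (topspace M) f" and x: "x \<in> S"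
  shows "coord_tensor2 M A c (graph_metric g \<phi> f) x $ i $ j = coord_tensor2 M A c g x $ i $ j
    + (coord_fun c \<phi> x)\<^sup>2 * (pd i (coord_fun c f) x * pd j (coord_fun c f) x)"
proof -
  have "smooth_near M A (chart_inv c x) f"
    using f chart_inv_in_M[OF x] openin_topspace unfolding smooth_near_def by blast
  then show ?thesis
    by (simp add: coord_tensor2_def graph_metric_def coord_vec_def chart_chart_inv[OF x] coord_fun_def)
qed

end

lemma graph_metric_chart_coord:
  assumes "manifold_chart M A c" and g: "riemannian_metric M A g"
    and f: "smooth_fun_on A (topspace M) f" and \<phi>: "smooth_fun_on A (topspace M) \<phi>"
    and pos: "\<And>p. p \<in> topspace M \<Longrightarrow> \<phi> p > 0"
  shows "graph_metric_chart (snd c ` fst c) (coord_tensor2 M A c g) (coord_fun c \<phi>) (coord_fun c f)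
    (coord_tensor2 M A c (graph_metric g \<phi> f))"
proof -
  interpret manifold_chart M A c by fact
  let ?G = "coord_tensor2 M A c g"
  have sg: "symmetric_tensor2 M A g" using g by (simp add: riemannian_metric_def)
  have "invertible (?G y)" if y: "y \<in> S" for y
  proof -
    have "a = 0" if "?G y *v a = 0" for a
    proof (rule ccontr)
      assume "a \<noteq> 0"
      from coord_metric_pos[OF g y this] show False
        using that by (simp add: vec_eq_iff matrix_vector_mult_def)
    qed
    then show ?thesis
      using matrix_left_invertible_ker invertible_left_inverse by blast
  qed
  then interpret smooth_metric S ?G
    by unfold_locales (use coord_tensor2_sym[OF sg] coord_tensor2_smooth[OF sg] open_image in auto)
  have "norm1_sq ?G (differential (coord_fun c f)) y \<ge> 0" if y: "y \<in> S" for y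
  proof -
    let ?a = "differential (coord_fun c f) y"
    \<comment> \<open>The gradient of \<open>f\<close>: the squared norm of the differential is the
      metric evaluated on this vector twice, so it inherits the sign from
      \<open>coord_metric_pos\<close>.\<close>
    define b where "b = raise ?G (differential (coord_fun c f)) y"
    have "norm1_sq ?G (differential (coord_fun c f)) y = (\<Sum>i\<in>UNIV. b $ i * ?a $ i)"
      unfolding norm1_sq_def b_def raise_def vec_lambda_beta sum_distrib_right by (simp add: mult_ac)
    also have "\<dots> = (\<Sum>i\<in>UNIV. b $ i * (\<Sum>j\<in>UNIV. ?G y $ i $ j * b $ j))"
      using lower_raise[OF y, of _ "\<lambda>j. ?a $ j"] by (simp add: b_def raise_def)
    also have "\<dots> \<ge> 0"
      using coord_metric_pos[OF g y, of b] by (cases "b = 0") auto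
    finally show ?thesis .
  qed
  then show ?thesis
    by unfold_locales (use coord_graph_metric[OF f] coord_fun_smooth[OF f] coord_fun_smooth[OF \<phi>]
      pos[OF chart_inv_in_M] in \<open>auto simp: coord_fun_def\<close>)
qed

theorem mainTheorem1:
  fixes M :: "'a topology" and A :: "('a, 3) chart set"
    and g k :: "'a tensor2" and f \<phi> :: "'a \<Rightarrow> real"
  assumes "smooth_manifold M A"
    and "riemannian_metric M A g"
    and "symmetric_tensor2 M A k"
    and "smooth_fun_on A (topspace M) f"
    and "smooth_fun_on A (topspace M) \<phi>"
    and "\<And>p. p \<in> topspace M \<Longrightarrow> \<phi> p > 0"
  shows "\<forall>c\<in>A. \<forall>p\<in>fst c.
    (let x = snd c p;
         G = coord_tensor2 M A c g;
         Gb = coord_tensor2 M A c (graph_metric g \<phi> f);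
         K = coord_tensor2 M A c k;
         F = coord_fun c f;
         P = coord_fun c \<phi>;
         v = graph_v G P F;
         h = graph_h G P F;
         \<mu> = energy_density G K;
         J = momentum_density G K;
         q = (\<lambda>y. insert_vec (h y) (v y) - insert_vec (K y) (v y));
         H = (\<lambda>y. trace2 Gb h y - trace2 Gb K y)
     in scalar_curvature Gb x =
          16 * pi * (\<mu> x - eval1 (J x) (v x))
          + norm2_sq Gb (\<lambda>y. h y - K y) x
          + 2 * norm1_sq Gb q x
          - 2 / P x * div1 Gb (\<lambda>y. P y *\<^sub>R q y) x
          + (trace2 Gb h x)\<^sup>2 - (trace2 Gb K x)\<^sup>2
          + 2 * dir_deriv (v x) H x
          + 2 * eval2 (K x) (v x) (v x) * H x)"
proof (intro ballI, goal_cases)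
  case (1 c p)
  note c = 1(1) and p = 1(2)
  interpret manifold_chart M A c
    using assms(1) c by (simp add: manifold_chart_def)
  interpret graph_metric_chart "snd c ` fst c" "coord_tensor2 M A c g" "coord_fun c \<phi>" "coord_fun c f"
    "coord_tensor2 M A c (graph_metric g \<phi> f)"
    by (rule graph_metric_chart_coord[OF manifold_chart_axioms assms(2,4,5,6)])
  show ?case
    unfolding Let_def
    by (rule schoen_yau_identity_chart[OF _ coord_tensor2_smooth[OF assms(3)] coord_tensor2_sym[OF assms(3)]])
      (use p in auto)
qed

end
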